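(* Let $\mathbb{D}$ be a division ring with finite dimension $d$ over a central subfield $\mathbb{F}$. Let $n\geq 1$ be such that $|\mathbb{F}|\geq nd$, and assume that $\mathbb{D}$ is not of quadratic type over $\mathbb{F}$. The optimal trivial spectrum subspaces of $\mathrm{M}_n(\mathbb{D})$ are exactly the spaces that are similar to a space of the form $H_1\vee\cdots\vee H_n$ where $H_1,\dots,H_n$ are $\mathbb{F}$-linear hyperplanes of $\mathbb{D}$ that do not contain $1_{\mathbb{D}}$. Two such spaces $H_1\vee\cdots\vee H_n$ and $H'_1\vee\cdots\vee H'_n$ are similar in the algebra $\mathrm{M}_n(\mathbb{D})$ if and only if, for all $i\in\{1,\dots,n\}$, the hyperplanes $H_i$ and $H'_i$ are conjugated in $\mathbb{D}$ (that is, $H'_i=aH_ia^{-1}$ for some $a\in\mathbb{D}^\times$).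
   Context: A central subfield of $\mathbb{D}$ is a subfield contained in the center of $\mathbb{D}$. An $\mathbb{F}$-linear subspace $S$ of $\mathrm{M}_n(\mathbb{D})$ has trivial spectrum if $I_n-M$ is invertible for all $M\in S$; it is optimal if it has the greatest possible dimension over $\mathbb{F}$ among all trivial spectrum $\mathbb{F}$-linear subspaces of $\mathrm{M}_n(\mathbb{D})$. For subsets $H_1,\dots,H_n$ of $\mathbb{D}$, the joint $H_1\vee\cdots\vee H_n$ is the set of all upper-triangular matrices of $\mathrm{M}_n(\mathbb{D})$ whose $i$-th diagonal entry belongs to $H_i$ for each $i$, the entries above the diagonal being arbitrary. Two subsets $\mathcal{S},\mathcal{T}$ of $\mathrm{M}_n(\mathbb{D})$ are similar if $\mathcal{T}=Q\mathcal{S}Q^{-1}$ for some $Q\in\mathrm{GL}_n(\mathbb{D})$. $\mathbb{D}$ is of quadratic type over $\mathbb{F}$ if one of the following holds: (i) $d=1$; (ii) $d=2$ and $\mathbb{D}$ is a separable field extension of $\mathbb{F}$; (iii) $d=4$ and $\mathbb{D}$ is a quaternion algebra over $\mathbb{F}$; (iv) $d=2^m$ for some $m\geq 1$, $\operatorname{char}(\mathbb{F})=2$, $\mathbb{D}$ is a field and $x^2\in\mathbb{F}$ for all $x\in\mathbb{D}$. *)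

theory Defs
  imports
    "Jordan_Normal_Form.Matrix"
    "Jordan_Normal_Form.VS_Connect"
    "HOL-Algebra.Finite_Extensions"
begin

section \<open>Central subfields and linear structure\<close>

text \<open>The division ring is a type of class division_ring, accessed through its HOL-Algebra record
  \<^term>\<open>class_ring\<close>; the base field is a subset of it.\<close>

definition ring_center :: "'a::ring_1 set" where
  "ring_center = {z. \<forall>x. z * x = x * z}"

definition central_subfield :: "'a::division_ring set \<Rightarrow> bool" where
  "central_subfield F \<longleftrightarrow> subfield F class_ring \<and> F \<subseteq> ring_center"

definition base_field :: "'a::ring_1 set \<Rightarrow> 'a ring" where
  "base_field F = class_ring\<lparr>carrier := F\<rparr>"

text \<open>In \<open>ring_module\<close> and in \<^const>\<open>module_mat\<close> the scalars are a priori all elements of the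
  ring, acting by left multiplication. Only scalars from the carrier of the base field matter to
  the locales \<^locale>\<open>vectorspace\<close> and \<^locale>\<open>VectorSpace.subspace\<close>.\<close>

definition ring_module :: "('a::ring_1, 'a) module" where
  "ring_module = \<lparr>carrier = UNIV, monoid.mult = (*), one = 1, zero = 0, add = (+), smult = (*)\<rparr>"

definition finite_degree :: "'a::division_ring set \<Rightarrow> bool" where
  "finite_degree F \<longleftrightarrow> vectorspace.fin_dim (base_field F) (ring_module :: ('a, 'a) module)"

definition degree_over :: "'a::division_ring set \<Rightarrow> nat" where
  "degree_over F = vectorspace.dim (base_field F) (ring_module :: ('a, 'a) module)"

definition linear_hyperplane :: "'a::division_ring set \<Rightarrow> 'a set \<Rightarrow> bool" where
  "linear_hyperplane F H \<longleftrightarrow>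
     VectorSpace.subspace (base_field F) H ring_module \<and>
     Suc (vectorspace.dim (base_field F) (ring_module\<lparr>carrier := H\<rparr>)) = degree_over F"


section \<open>Division rings of quadratic type\<close>

text \<open>Polynomials are those of HOL-Algebra: coefficient lists, leading coefficient first, with
  \<open>[]\<close> for the zero polynomial. The first function may produce leading zeros, which the
  second one removes.\<close>

fun deriv_coeffs :: "'a::ring_1 list \<Rightarrow> 'a list" where
  "deriv_coeffs [] = []"
| "deriv_coeffs [a] = []"
| "deriv_coeffs (a # b # p) = of_nat (Suc (length p)) * a # deriv_coeffs (b # p)"

definition poly_deriv :: "'a::ring_1 list \<Rightarrow> 'a list" where
  "poly_deriv p = ring.normalize class_ring (deriv_coeffs p)"

text \<open>A polynomial over \<open>F\<close> is separable if it is coprime with its derivative, that is, if the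
  two generate the unit ideal of \<open>F[X]\<close>.\<close>

definition separable_poly :: "'a::ring_1 set \<Rightarrow> 'a list \<Rightarrow> bool" where
  "separable_poly F p \<longleftrightarrow>
     (let P = univ_poly class_ring F in
      \<exists>u \<in> carrier P. \<exists>v \<in> carrier P.
        u \<otimes>\<^bsub>P\<^esub> p \<oplus>\<^bsub>P\<^esub> v \<otimes>\<^bsub>P\<^esub> poly_deriv p = \<one>\<^bsub>P\<^esub>)"

definition separable_field_extension :: "'a::division_ring set \<Rightarrow> bool" where
  "separable_field_extension F \<longleftrightarrow>
     field (class_ring :: 'a ring) \<and>
     (\<forall>x::'a. ring.algebraic class_ring F x \<and> separable_poly F (ring.Irr class_ring F x))"

text \<open>A quaternion algebra is a central simple algebra of dimension 4.\<close>

definition quaternion_algebra :: "'a::division_ring set \<Rightarrow> bool" where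
  "quaternion_algebra F \<longleftrightarrow>
     ring_center = F \<and>
     (\<forall>I. ideal I (class_ring :: 'a ring) \<longrightarrow> I = {0} \<or> I = UNIV) \<and>
     degree_over F = 4"

text \<open>\<open>F\<close> and the ring have the same characteristic, as \<open>F\<close> contains 1.\<close>

definition quadratic_type :: "'a::division_ring set \<Rightarrow> bool" where
  "quadratic_type F \<longleftrightarrow>
     degree_over F = 1 \<or>
     degree_over F = 2 \<and> separable_field_extension F \<or>
     degree_over F = 4 \<and> quaternion_algebra F \<or>
     (\<exists>m\<ge>1. degree_over F = 2 ^ m) \<and> CHAR('a) = 2 \<and>
       field (class_ring :: 'a ring) \<and> (\<forall>x::'a. x ^ 2 \<in> F)"


section \<open>Trivial spectrum spaces of matrices\<close>

definition matrix_subspace :: "'a::division_ring set \<Rightarrow> nat \<Rightarrow> 'a mat set \<Rightarrow> bool" where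
  "matrix_subspace F n S \<longleftrightarrow>
     VectorSpace.subspace (base_field F) S (module_mat TYPE('a) n n)"

definition matrix_dim :: "'a::division_ring set \<Rightarrow> nat \<Rightarrow> 'a mat set \<Rightarrow> nat" where
  "matrix_dim F n S = vectorspace.dim (base_field F) ((module_mat TYPE('a) n n)\<lparr>carrier := S\<rparr>)"

definition trivial_spectrum :: "'a::division_ring set \<Rightarrow> nat \<Rightarrow> 'a mat set \<Rightarrow> bool" where
  "trivial_spectrum F n S \<longleftrightarrow>
     matrix_subspace F n S \<and> (\<forall>M\<in>S. invertible_mat (1\<^sub>m n - M))"

definition optimal_trivial_spectrum :: "'a::division_ring set \<Rightarrow> nat \<Rightarrow> 'a mat set \<Rightarrow> bool" where
  "optimal_trivial_spectrum F n S \<longleftrightarrow>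
     trivial_spectrum F n S \<and>
     (\<forall>T. trivial_spectrum F n T \<longrightarrow> matrix_dim F n T \<le> matrix_dim F n S)"

text \<open>The indices of \<open>H\<close> run over \<open>0, \<dots>, n - 1\<close>.\<close>

definition joint :: "nat \<Rightarrow> (nat \<Rightarrow> 'a::zero set) \<Rightarrow> 'a mat set" where
  "joint n H = {M \<in> carrier_mat n n. upper_triangular M \<and> (\<forall>i<n. M $$ (i, i) \<in> H i)}"

definition similar_sets :: "nat \<Rightarrow> 'a::ring_1 mat set \<Rightarrow> 'a mat set \<Rightarrow> bool" where
  "similar_sets n S T \<longleftrightarrow>
     (\<exists>Q \<in> carrier_mat n n. \<exists>P \<in> carrier_mat n n.
        inverts_mat Q P \<and> inverts_mat P Q \<and> T = (\<lambda>M. Q * M * P) ` S)"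

definition conjugate_sets :: "'a::division_ring set \<Rightarrow> 'a set \<Rightarrow> bool" where
  "conjugate_sets A B \<longleftrightarrow> (\<exists>a. a \<noteq> 0 \<and> B = (\<lambda>x. a * x * inverse a) ` A)"

end

(* Let V have trivial spectrum, and for a column x put L(x) = {w | x w in V}. Pick x with L(x) of
   least dimension: the operator w |-> x w, modulo V, then has maximal rank in the space of all
   these operators, so (F being large) y w lies in V + x D^n for all w in L(x) and all columns y.
   If w is such a row with w x = 0 and w y = 1, then w is fixed by y w + x u in V, which is absurd.
   Hence dim L(x) <= d - 1, and, splitting off x, induction gives
   dim V <= d n (n - 1) / 2 + n (d - 1), which the joints attain.

   In the case of equality L(x) = H v0 with v0 x = 1 and H a hyperplane avoiding 1. In a basis
   adapted to x and v0, V contains matrices [K C; R a] for all K in a joint J (by induction) and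
   all C, where R and a modulo H are determined by K and C. No column (E, 1) is fixed; taking
   C = E - K E this condition is affine in K and quadratic in E. It forces the bilinear form
   b(C, E) = R(C) E mod H to satisfy b(K E, E) = 0 for K in J. If b were nonzero, it would induce
   an additive map s on D with s(e) e in F for all e, and e + s(e)/s(1) would be a trace: every
   element of D would be quadratic over F with an additive trace, and D would be of quadratic
   type. So b = 0, then R = 0 and a lies in H, that is, V is a joint. *)

theory Submission
  imports Defs "Jordan_Normal_Form.DL_Rank"
begin

section \<open>Subspaces of finite-dimensional vector spaces\<close>

text \<open>Without determinants over \<open>D\<close>, invertibility of \<open>1 - M\<close> is
  weakened to \<open>nofix\<close>: no nonzero column and no nonzero row is fixed by a matrix of the
  space. This passes to similar spaces and to the leading blocks met in the induction. The lower
  bound \<open>n d\<close> for the size of \<open>F\<close> is an eigenvalue count. If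
  \<open>y w\<close> were outside \<open>V + x D^n\<close> for some \<open>w\<close> in
  \<open>L(x)\<close>, a partial operator on a space of dimension \<open>n d - dim L(x) + 1\<close>
  would have every element of \<open>F\<close> as an eigenvalue. For \<open>dim L(x) \<ge> 2\<close>
  this dimension is below \<open>n d\<close>. For \<open>dim L(x) \<le> 1\<close> the bound
  \<open>d - 1\<close> is clear and not attained, because \<open>d \<ge> 3\<close>: in degrees 1 and
  2 every \<open>D\<close> is of quadratic type. For \<open>d > 1\<close>, the list of quadratic
  types is what an additive \<open>T\<close> with values in \<open>F\<close> and
  \<open>x^2 - T(x) x\<close> in \<open>F\<close> leaves: either \<open>T(x) = 2 x\<close> for all
  \<open>x\<close>, which forces characteristic 2 and all squares into \<open>F\<close>, or some
  \<open>x\<close> spans with 1 a separable quadratic field that is \<open>D\<close> itself or a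
  plane in a quaternion algebra \<open>D\<close>.\<close>

lemma (in vectorspace) subspace_iff:
  "VectorSpace.subspace K S V \<longleftrightarrow> S \<subseteq> carrier V \<and> \<zero>\<^bsub>V\<^esub> \<in> S \<and> (\<forall>v\<in>S. \<forall>w\<in>S. v \<oplus>\<^bsub>V\<^esub> w \<in> S) \<and>
     (\<forall>c\<in>carrier K. \<forall>v\<in>S. c \<odot>\<^bsub>V\<^esub> v \<in> S)"
  unfolding VectorSpace.subspace_def LinearCombinations.submodule_def
  using vectorspace_axioms module_axioms by blast

lemma (in vectorspace) subspace_closed:
  assumes "VectorSpace.subspace K S V"
  shows "S \<subseteq> carrier V" "\<zero>\<^bsub>V\<^esub> \<in> S" "v \<in> S \<Longrightarrow> w \<in> S \<Longrightarrow> v \<oplus>\<^bsub>V\<^esub> w \<in> S"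
    "c \<in> carrier K \<Longrightarrow> v \<in> S \<Longrightarrow> c \<odot>\<^bsub>V\<^esub> v \<in> S"
  using assms[unfolded subspace_iff] by blast+

lemma (in vectorspace) lin_indpt_vs:
  assumes "VectorSpace.subspace K S V" "A \<subseteq> S"
  shows "LinearCombinations.module.lin_dep K (vs S) A = lin_dep A" "LinearCombinations.module.span K (vs S) A = span A"
  using span_li_not_depend[OF assms(2) is_module[OF assms(1)]] by simp_all

text \<open>Independent subsets of \<open>S\<close> stay independent in \<open>V\<close>, so their
  sizes are bounded by \<open>dim\<close>; a maximal one is a finite basis of
  \<open>S\<close>.\<close>

lemma (in vectorspace) subspace_fin_dim:
  assumes "fin_dim" "VectorSpace.subspace K S V"
  shows "vectorspace.fin_dim K (vs S)"
proof -
  interpret S: vectorspace K "vs S" using assms(2) by (rule subspace_is_vs)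
  have SV: "S \<subseteq> carrier V" by (rule subspace_closed(1)[OF assms(2)])
  have "\<exists>A. finite A \<and> maximal A (\<lambda>A. A \<subseteq> carrier (vs S) \<and> S.lin_indpt A)"
  proof (rule maximal_exists[where N = dim and B = "{}"])
    fix A assume A: "A \<subseteq> carrier (vs S) \<and> S.lin_indpt A"
    then have "A \<subseteq> S" by simp
    then have "lin_indpt A" using A lin_indpt_vs(1)[OF assms(2)] by blast
    moreover have "A \<subseteq> carrier V" using \<open>A \<subseteq> S\<close> SV by (rule subset_trans)
    ultimately show "finite A \<and> card A \<le> dim" using li_le_dim[OF assms(1)] by blast
  qed (auto simp: S.lin_dep_def)
  then obtain A where "finite A" "S.basis A" using S.max_li_is_basis by blast
  then show ?thesis unfolding S.fin_dim_def S.basis_def by blast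
qed

lemma (in vectorspace) subspace_basis:
  assumes "fin_dim" "VectorSpace.subspace K S V"
  obtains A where "finite A" "A \<subseteq> S" "lin_indpt A" "span A = S" "card A = vectorspace.dim K (vs S)"
proof -
  interpret S: vectorspace K "vs S" using assms(2) by (rule subspace_is_vs)
  obtain A where A: "finite A" "S.basis A"
    using S.finite_basis_exists[OF subspace_fin_dim[OF assms]] by blast
  then have "A \<subseteq> S" unfolding S.basis_def by simp
  with A show ?thesis
    using that[of A] lin_indpt_vs[OF assms(2), of A] S.dim_basis unfolding S.basis_def by auto
qed

lemma (in vectorspace) subspace_dim_span:
  assumes "A \<subseteq> carrier V" "finite A" "lin_indpt A"
  shows "vectorspace.dim K (vs (span A)) = card A"
proof -
  have sub: "VectorSpace.subspace K (span A) V" using assms(1) by (rule span_is_subspace)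
  interpret S: vectorspace K "vs (span A)" using sub by (rule subspace_is_vs)
  have "A \<subseteq> span A" using assms(1) by (rule in_own_span)
  then have "S.basis A" unfolding S.basis_def using lin_indpt_vs[OF sub, of A] assms by auto
  then show ?thesis using S.dim_basis[OF assms(2)] by simp
qed

lemma (in vectorspace) subspace_dim_mono:
  assumes "fin_dim" "VectorSpace.subspace K S V" "VectorSpace.subspace K T V" "S \<subseteq> T"
  shows "vectorspace.dim K (vs S) \<le> vectorspace.dim K (vs T)"
proof -
  interpret T: vectorspace K "vs T" using assms(3) by (rule subspace_is_vs)
  obtain A where A: "finite A" "A \<subseteq> S" "lin_indpt A" "card A = vectorspace.dim K (vs S)"
    using subspace_basis[OF assms(1,2)] by metis
  have "T.lin_indpt A" "A \<subseteq> T" using lin_indpt_vs[OF assms(3)] A assms(4) by auto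
  then show ?thesis using T.li_le_dim(2)[OF subspace_fin_dim[OF assms(1,3)], of A] A by simp
qed

lemma (in vectorspace) subspace_dim_eq:
  assumes "fin_dim" "VectorSpace.subspace K S V" "VectorSpace.subspace K T V" "S \<subseteq> T"
    and "vectorspace.dim K (vs T) \<le> vectorspace.dim K (vs S)"
  shows "S = T"
proof -
  interpret T: vectorspace K "vs T" using assms(3) by (rule subspace_is_vs)
  obtain A where A: "finite A" "A \<subseteq> S" "lin_indpt A" "span A = S" "card A = vectorspace.dim K (vs S)"
    using subspace_basis[OF assms(1,2)] by metis
  have "T.lin_indpt A" "A \<subseteq> T" using lin_indpt_vs[OF assms(3)] A assms(4) by auto
  then have "T.basis A"
    using T.dim_li_is_basis[OF subspace_fin_dim[OF assms(1,3)] A(1)] assms(5) A(5) by simp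
  then have "T.span A = T" unfolding T.basis_def by simp
  then show ?thesis using A(4) lin_indpt_vs(2)[OF assms(3) \<open>A \<subseteq> T\<close>] by simp
qed

lemma (in vectorspace) subspace_zero: "VectorSpace.subspace K {\<zero>\<^bsub>V\<^esub>} V"
  unfolding subspace_iff by auto

lemma (in vectorspace) dim_subspace_zero: "vectorspace.dim K (vs {\<zero>\<^bsub>V\<^esub>}) = 0"
proof -
  have "lin_indpt {}" by (auto simp: lin_dep_def)
  then show ?thesis using subspace_dim_span[of "{}"] by (simp add: span_empty)
qed

section \<open>Adjoining a vector, direct sums and complements\<close>

definition (in vectorspace) adjoin :: "'c set \<Rightarrow> 'c \<Rightarrow> 'c set" where
  "adjoin S v = {s \<oplus>\<^bsub>V\<^esub> c \<odot>\<^bsub>V\<^esub> v | s c. s \<in> S \<and> c \<in> carrier K}"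

lemma (in vectorspace) adjoin_span:
  assumes "A \<subseteq> carrier V" "v \<in> carrier V" "finite A"
  shows "adjoin (span A) v = span (A \<union> {v})"
proof -
  have "span {v} = {c \<odot>\<^bsub>V\<^esub> v | c. c \<in> carrier K}"
  proof -
    have "span {v} = {lincomb a {v} | a. a \<in> {v} \<rightarrow> carrier K}"
      using finite_span[of "{v}"] assms(2) by simp
    also have "\<dots> = {a v \<odot>\<^bsub>V\<^esub> v | a. a \<in> {v} \<rightarrow> carrier K}"
    proof -
      have "lincomb a {v} = a v \<odot>\<^bsub>V\<^esub> v" if "a \<in> {v} \<rightarrow> carrier K" for a
        unfolding lincomb_def using that assms(2) by simp
      then show ?thesis by (intro Collect_cong ex_cong1) auto
    qed
    also have "\<dots> = {c \<odot>\<^bsub>V\<^esub> v | c. c \<in> carrier K}"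
    proof (rule Collect_cong)
      fix w
      have "c \<odot>\<^bsub>V\<^esub> v = (\<lambda>_. c) v \<odot>\<^bsub>V\<^esub> v \<and> (\<lambda>_. c) \<in> {v} \<rightarrow> carrier K" if "c \<in> carrier K" for c
        using that by simp
      then show "(\<exists>a. w = a v \<odot>\<^bsub>V\<^esub> v \<and> a \<in> {v} \<rightarrow> carrier K) \<longleftrightarrow>
          (\<exists>c. w = c \<odot>\<^bsub>V\<^esub> v \<and> c \<in> carrier K)" by (metis Pi_mem insertI1)
    qed
    finally show ?thesis .
  qed
  moreover have "span (A \<union> {v}) = submodule_sum (span A) (span {v})"
    using assms by (intro span_union_is_sum) auto
  ultimately show ?thesis unfolding submodule_sum_def adjoin_def by auto
qed

lemma (in vectorspace)
  assumes "fin_dim" "VectorSpace.subspace K S V" "v \<in> carrier V" "v \<notin> S"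
  shows subspace_adjoin: "VectorSpace.subspace K (adjoin S v) V"
    and dim_adjoin: "vectorspace.dim K (vs (adjoin S v)) = Suc (vectorspace.dim K (vs S))"
proof -
  obtain A where A: "finite A" "A \<subseteq> S" "lin_indpt A" "span A = S" "card A = vectorspace.dim K (vs S)"
    using subspace_basis[OF assms(1,2)] by metis
  have AV: "A \<subseteq> carrier V" using A(2) subspace_closed(1)[OF assms(2)] by blast
  have eq: "adjoin S v = span (A \<union> {v})" using adjoin_span[OF AV assms(3) A(1)] A(4) by simp
  have "v \<notin> A" using A assms by auto
  have li: "lin_indpt (A \<union> {v})"
    using lin_dep_iff_in_span[OF AV A(3) assms(3) \<open>v \<notin> A\<close>] assms(4) unfolding A(4) by blast
  show "VectorSpace.subspace K (adjoin S v) V" unfolding eq using AV assms(3) by (intro span_is_subspace) auto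
  show "vectorspace.dim K (vs (adjoin S v)) = Suc (vectorspace.dim K (vs S))"
    unfolding eq using subspace_dim_span[of "A \<union> {v}"] li AV assms(3) A \<open>v \<notin> A\<close> by simp
qed

lemma (in vectorspace) adjoin_least:
  assumes "VectorSpace.subspace K S V" "S \<subseteq> T" "VectorSpace.subspace K T V" "v \<in> T"
  shows "adjoin S v \<subseteq> T"
  using assms unfolding adjoin_def subspace_iff by blast

lemma (in vectorspace) dim_subspace_pos:
  assumes "fin_dim" "VectorSpace.subspace K S V" "0 < vectorspace.dim K (vs S)"
  obtains v where "v \<in> S" "v \<noteq> \<zero>\<^bsub>V\<^esub>"
proof -
  have "S \<noteq> {\<zero>\<^bsub>V\<^esub>}" using assms(3) dim_subspace_zero by auto
  then show ?thesis using that subspace_closed(2)[OF assms(2)] by blast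
qed

text \<open>Below \<open>T\<close> there is a subspace with \<open>P\<close> in every dimension up
  to that of \<open>T\<close>, since a proper subspace can be enlarged by a vector of
  \<open>T\<close>. In the top dimension it must be \<open>T\<close> itself.\<close>

lemma (in vectorspace) subspace_induct [consumes 2, case_names zero adjoin]:
  assumes "fin_dim" "VectorSpace.subspace K T V"
    and "P {\<zero>\<^bsub>V\<^esub>}"
    and "\<And>S v. VectorSpace.subspace K S V \<Longrightarrow> S \<subseteq> T \<Longrightarrow> v \<in> T \<Longrightarrow> v \<notin> S \<Longrightarrow> P S \<Longrightarrow> P (adjoin S v)"
  shows "P T"
proof -
  have "\<exists>S. VectorSpace.subspace K S V \<and> S \<subseteq> T \<and> P S \<and> vectorspace.dim K (vs S) = k"
    if "k \<le> vectorspace.dim K (vs T)" for k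
    using that
  proof (induction k)
    case 0
    have "\<zero>\<^bsub>V\<^esub> \<in> T" by (rule subspace_closed(2)[OF assms(2)])
    then show ?case using assms(3) subspace_zero dim_subspace_zero
      by (intro exI[of _ "{\<zero>\<^bsub>V\<^esub>}"]) auto
  next
    case (Suc k)
    then obtain S where S: "VectorSpace.subspace K S V" "S \<subseteq> T" "P S" "vectorspace.dim K (vs S) = k" by auto
    have "S \<noteq> T" using S(4) Suc.prems by auto
    then obtain v where v: "v \<in> T" "v \<notin> S" using S(2) by auto
    have "v \<in> carrier V" using v subspace_closed(1)[OF assms(2)] by blast
    then show ?case
      using subspace_adjoin[OF assms(1) S(1) _ v(2)] dim_adjoin[OF assms(1) S(1) _ v(2)] S v
        assms(4)[of S v] adjoin_least[OF S(1,2) assms(2) v(1)] by blast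
  qed
  then obtain S where "VectorSpace.subspace K S V" "S \<subseteq> T" "P S" "vectorspace.dim K (vs S) = vectorspace.dim K (vs T)"
    by blast
  then show ?thesis using subspace_dim_eq[OF assms(1) _ assms(2), of S] by simp
qed

lemma (in vectorspace) in_subspace_sum:
  "x \<in> subspace_sum S T \<longleftrightarrow> (\<exists>s\<in>S. \<exists>t\<in>T. x = s \<oplus>\<^bsub>V\<^esub> t)"
  unfolding submodule_sum_def by auto

text \<open>Induction on \<open>T\<close>: adjoining \<open>v\<close> to \<open>T'\<close> adjoins
  \<open>v\<close> to the sum. The vector is new there, because \<open>v = s + t\<close> would put
  \<open>s = v - t\<close> into both \<open>S\<close> and \<open>T\<close>, so that
  \<open>s = 0\<close> and \<open>v\<close> is in \<open>T'\<close>.\<close>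

lemma (in vectorspace) dim_direct_sum:
  assumes "fin_dim" "VectorSpace.subspace K S V" "VectorSpace.subspace K T V" "S \<inter> T = {\<zero>\<^bsub>V\<^esub>}"
  shows "vectorspace.dim K (vs (subspace_sum S T)) = vectorspace.dim K (vs S) + vectorspace.dim K (vs T)"
proof -
  have S: "S \<subseteq> carrier V" "T \<subseteq> carrier V" using assms(2,3) subspace_closed(1) by blast+
  from assms(1,3) show ?thesis
  proof (induction rule: subspace_induct)
    case zero
    have "subspace_sum S {\<zero>\<^bsub>V\<^esub>} = S" unfolding submodule_sum_def using S by force
    then show ?case using dim_subspace_zero by simp
  next
    case (adjoin T' v)
    have TV: "T' \<subseteq> carrier V" and vV: "v \<in> carrier V" using adjoin S by auto
    have sub: "VectorSpace.subspace K (subspace_sum S T') V" using assms(2) adjoin(1) by (rule sum_is_subspace)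
    have eq: "subspace_sum S (adjoin T' v) = adjoin (subspace_sum S T') v"
    proof -
      have "s \<oplus>\<^bsub>V\<^esub> (t \<oplus>\<^bsub>V\<^esub> c \<odot>\<^bsub>V\<^esub> v) = s \<oplus>\<^bsub>V\<^esub> t \<oplus>\<^bsub>V\<^esub> c \<odot>\<^bsub>V\<^esub> v"
        if "s \<in> S" "t \<in> T'" "c \<in> carrier K" for s t c
        using that S TV vV by (subst M.add.m_assoc) auto
      then have "(\<exists>s\<in>S. \<exists>w. (\<exists>t c. w = t \<oplus>\<^bsub>V\<^esub> c \<odot>\<^bsub>V\<^esub> v \<and> t \<in> T' \<and> c \<in> carrier K) \<and> x = s \<oplus>\<^bsub>V\<^esub> w) \<longleftrightarrow>
          (\<exists>w c. (\<exists>s\<in>S. \<exists>t\<in>T'. w = s \<oplus>\<^bsub>V\<^esub> t) \<and> c \<in> carrier K \<and> x = w \<oplus>\<^bsub>V\<^esub> c \<odot>\<^bsub>V\<^esub> v)" for x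
        by metis
      then show ?thesis unfolding set_eq_iff in_subspace_sum adjoin_def mem_Collect_eq Bex_def by blast
    qed
    have "v \<notin> subspace_sum S T'"
    proof
      assume "v \<in> subspace_sum S T'"
      then obtain s t where st: "s \<in> S" "t \<in> T'" "v = s \<oplus>\<^bsub>V\<^esub> t" unfolding submodule_sum_def by auto
      have "\<ominus>\<^bsub>V\<^esub> t = (\<ominus>\<^bsub>K\<^esub> \<one>\<^bsub>K\<^esub>) \<odot>\<^bsub>V\<^esub> t" using st TV smult_minus_1 by auto
      then have mt: "\<ominus>\<^bsub>V\<^esub> t \<in> T" using st adjoin(2) subspace_closed(4)[OF assms(3)] by auto
      have "s \<in> carrier V" "t \<in> carrier V" using st S TV by blast+
      then have "s = v \<oplus>\<^bsub>V\<^esub> \<ominus>\<^bsub>V\<^esub> t"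
        unfolding st(3) by (subst M.a_assoc) (auto simp: M.r_neg)
      then have "s \<in> T" using adjoin(3) mt subspace_closed(3)[OF assms(3)] by auto
      then have "s = \<zero>\<^bsub>V\<^esub>" using st assms(4) by auto
      then show False using st adjoin(4) TV by auto
    qed
    then show ?case unfolding eq
      using dim_adjoin[OF assms(1) sub vV] dim_adjoin[OF assms(1) adjoin(1) vV adjoin(4)] adjoin(5) by simp
  qed
qed

lemma (in vectorspace) dim_disjoint_le:
  assumes "fin_dim" "VectorSpace.subspace K S V" "VectorSpace.subspace K T V" "S \<inter> T = {\<zero>\<^bsub>V\<^esub>}"
  shows "vectorspace.dim K (vs S) + vectorspace.dim K (vs T) \<le> dim"
proof -
  have "VectorSpace.subspace K (subspace_sum S T) V" using assms by (intro sum_is_subspace)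
  then have "vectorspace.dim K (vs (subspace_sum S T)) \<le> dim"
    using subspace_dim[OF _ assms(1)] subspace_fin_dim[OF assms(1)] by blast
  then show ?thesis using dim_direct_sum[OF assms] by simp
qed

text \<open>A subspace meeting \<open>S\<close> trivially keeps this property when a vector outside
  its sum with \<open>S\<close> is adjoined; such vectors exist until the dimensions add up to
  \<open>dim\<close>.\<close>

lemma (in vectorspace) complement_exists:
  assumes "fin_dim" "VectorSpace.subspace K S V"
  obtains T where "VectorSpace.subspace K T V" "S \<inter> T = {\<zero>\<^bsub>V\<^esub>}"
    "vectorspace.dim K (vs S) + vectorspace.dim K (vs T) = dim"
proof -
  have self: "VectorSpace.subspace K (carrier V) V" unfolding subspace_iff by auto
  have "\<exists>T. VectorSpace.subspace K T V \<and> S \<inter> T = {\<zero>\<^bsub>V\<^esub>} \<and> vectorspace.dim K (vs T) = k"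
    if "k + vectorspace.dim K (vs S) \<le> dim" for k
    using that
  proof (induction k)
    case 0
    have "\<zero>\<^bsub>V\<^esub> \<in> S" by (rule subspace_closed(2)[OF assms(2)])
    then show ?case using subspace_zero dim_subspace_zero by (intro exI[of _ "{\<zero>\<^bsub>V\<^esub>}"]) auto
  next
    case (Suc k)
    then obtain T where T: "VectorSpace.subspace K T V" "S \<inter> T = {\<zero>\<^bsub>V\<^esub>}" "vectorspace.dim K (vs T) = k" by auto
    have SV: "S \<subseteq> carrier V" "T \<subseteq> carrier V" using assms(2) T(1) subspace_closed(1) by blast+
    have sub: "VectorSpace.subspace K (subspace_sum S T) V" using assms(2) T(1) by (rule sum_is_subspace)
    have "subspace_sum S T \<noteq> carrier V"
      using dim_direct_sum[OF assms T(1,2)] Suc.prems T(3) by auto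
    then obtain v where v: "v \<in> carrier V" "v \<notin> subspace_sum S T"
      using subspace_closed(1)[OF sub] by auto
    have ST: "S \<subseteq> subspace_sum S T" "T \<subseteq> subspace_sum S T"
      using in_sum_vs[OF assms(2) T(1)] in_sum_vs[OF T(1) assms(2)] vsum_comm[OF assms(2) T(1)] by auto
    have "v \<notin> T" using v ST by auto
    have "S \<inter> adjoin T v \<subseteq> {\<zero>\<^bsub>V\<^esub>}"
    proof
      fix s assume "s \<in> S \<inter> adjoin T v"
      then obtain t c where s: "s \<in> S" "t \<in> T" "c \<in> carrier K" "s = t \<oplus>\<^bsub>V\<^esub> c \<odot>\<^bsub>V\<^esub> v"
        unfolding adjoin_def by auto
      have cl: "t \<in> carrier V" "s \<in> carrier V" "c \<odot>\<^bsub>V\<^esub> v \<in> carrier V" using s SV v by auto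
      show "s \<in> {\<zero>\<^bsub>V\<^esub>}"
      proof (cases "c = \<zero>\<^bsub>K\<^esub>")
        case True
        then have "s = t" using s cl v by simp
        then show ?thesis using s T(2) by auto
      next
        case False
        have "(\<ominus>\<^bsub>K\<^esub> \<one>\<^bsub>K\<^esub>) \<odot>\<^bsub>V\<^esub> t = \<ominus>\<^bsub>V\<^esub> t" using smult_minus_1 cl by simp
        then have m: "\<ominus>\<^bsub>V\<^esub> t \<in> subspace_sum S T"
          using subspace_closed(4)[OF sub, of "\<ominus>\<^bsub>K\<^esub> \<one>\<^bsub>K\<^esub>" t] s ST by auto
        have "c \<odot>\<^bsub>V\<^esub> v = s \<oplus>\<^bsub>V\<^esub> \<ominus>\<^bsub>V\<^esub> t"
          unfolding s(4) using cl
          by (subst M.a_comm[OF cl(1,3)], subst M.a_assoc) (auto simp: M.r_neg)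
        moreover have "s \<in> subspace_sum S T" using s(1) ST by blast
        ultimately have w: "c \<odot>\<^bsub>V\<^esub> v \<in> subspace_sum S T"
          using subspace_closed(3)[OF sub _ m] by metis
        have "v = inv\<^bsub>K\<^esub> c \<odot>\<^bsub>V\<^esub> (c \<odot>\<^bsub>V\<^esub> v)" using mult_inverse[OF s(3) v(1) refl False] .
        moreover have "inv\<^bsub>K\<^esub> c \<in> carrier K" using s(3) False by (rule inverse_exists)
        ultimately have "v \<in> subspace_sum S T" using w subspace_closed(4)[OF sub] by metis
        then show ?thesis using v by simp
      qed
    qed
    moreover have sub': "VectorSpace.subspace K (adjoin T v) V" by (rule subspace_adjoin[OF assms(1) T(1) v(1) \<open>v \<notin> T\<close>])
    ultimately have "S \<inter> adjoin T v = {\<zero>\<^bsub>V\<^esub>}"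
      using subspace_closed(2)[OF assms(2)] subspace_closed(2)[OF sub'] by blast
    then show ?case using sub' dim_adjoin[OF assms(1) T(1) v(1) \<open>v \<notin> T\<close>] T(3) by blast
  qed
  moreover have "vectorspace.dim K (vs S) \<le> dim"
    using subspace_dim[OF assms(2,1)] subspace_fin_dim[OF assms] by blast
  ultimately show ?thesis using that
    by (metis add.commute le_add_diff_inverse2 order_refl)
qed

text \<open>Linearity of \<open>f\<close> is asked on \<open>S\<close> only, so its values elsewhere
  are of no concern. The target \<open>W\<close> may a priori have infinite dimension; finiteness of
  the image is a conclusion, from which the matrix spaces get their finite dimension.\<close>

lemma subspace_rank_nullity:
  assumes "vectorspace K V" "vectorspace.fin_dim K V" "vectorspace K W" "VectorSpace.subspace K S V"
    and "\<And>v. v \<in> S \<Longrightarrow> f v \<in> carrier W"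
    and "\<And>v w. v \<in> S \<Longrightarrow> w \<in> S \<Longrightarrow> f (v \<oplus>\<^bsub>V\<^esub> w) = f v \<oplus>\<^bsub>W\<^esub> f w"
    and "\<And>c v. c \<in> carrier K \<Longrightarrow> v \<in> S \<Longrightarrow> f (c \<odot>\<^bsub>V\<^esub> v) = c \<odot>\<^bsub>W\<^esub> f v"
  shows "vectorspace.dim K (V\<lparr>carrier := S\<rparr>) =
    vectorspace.dim K (W\<lparr>carrier := f ` S\<rparr>) + vectorspace.dim K (V\<lparr>carrier := {v \<in> S. f v = \<zero>\<^bsub>W\<^esub>}\<rparr>)"
    and "VectorSpace.subspace K (f ` S) W" "VectorSpace.subspace K {v \<in> S. f v = \<zero>\<^bsub>W\<^esub>} V"
    and "vectorspace.fin_dim K (W\<lparr>carrier := f ` S\<rparr>)"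
proof -
  interpret V: vectorspace K V by fact
  interpret W: vectorspace K W by fact
  interpret S: vectorspace K "V\<lparr>carrier := S\<rparr>" using assms(4) by (rule V.subspace_is_vs)
  have "f \<in> LinearCombinations.module_hom K (V\<lparr>carrier := S\<rparr>) W"
    unfolding LinearCombinations.module_hom_def using assms(5-7) by (simp add: Pi_def)
  then interpret f: linear_map K "V\<lparr>carrier := S\<rparr>" W f
    by (intro linear_map.intro mod_hom.intro mod_hom_axioms.intro S.vectorspace_axioms
        W.vectorspace_axioms S.module_axioms W.module_axioms)
  have fd: "S.fin_dim" by (rule V.subspace_fin_dim[OF assms(2,4)])
  show "vectorspace.dim K (V\<lparr>carrier := S\<rparr>) =
    vectorspace.dim K (W\<lparr>carrier := f ` S\<rparr>) + vectorspace.dim K (V\<lparr>carrier := {v \<in> S. f v = \<zero>\<^bsub>W\<^esub>}\<rparr>)"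
    using f.rank_nullity_main(1)[OF fd] unfolding f.im_def f.ker_def by simp
  show im: "VectorSpace.subspace K (f ` S) W" using f.imT_is_subspace unfolding f.im_def by simp
  show "VectorSpace.subspace K {v \<in> S. f v = \<zero>\<^bsub>W\<^esub>} V"
    using f.kerT_is_subspace V.subspace_closed(1)[OF assms(4)]
    unfolding f.ker_def S.subspace_iff V.subspace_iff by auto
  interpret I: vectorspace K "W\<lparr>carrier := f ` S\<rparr>" using im by (rule W.subspace_is_vs)
  have "f \<in> LinearCombinations.module_hom K (V\<lparr>carrier := S\<rparr>) (W\<lparr>carrier := f ` S\<rparr>)"
    unfolding LinearCombinations.module_hom_def using assms(6,7) by (simp add: Pi_def)
  then interpret g: linear_map K "V\<lparr>carrier := S\<rparr>" "W\<lparr>carrier := f ` S\<rparr>" f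
    by (intro linear_map.intro mod_hom.intro mod_hom_axioms.intro S.vectorspace_axioms
        I.vectorspace_axioms S.module_axioms I.module_axioms)
  show "vectorspace.fin_dim K (W\<lparr>carrier := f ` S\<rparr>)" using g.surj_fin_dim[OF fd] by simp
qed

section \<open>Division rings over a central subfield\<close>

locale central_division =
  fixes F :: "'a::division_ring set"
  assumes central: "central_subfield F"
    and finite_degree: "finite_degree F"
begin

abbreviation "K \<equiv> base_field F"
abbreviation "dsub S \<equiv> VectorSpace.subspace K S (ring_module :: ('a, 'a) module)"
abbreviation "ddim S \<equiv> vectorspace.dim K (ring_module\<lparr>carrier := S\<rparr> :: ('a, 'a) module)"
abbreviation "msub r c S \<equiv> VectorSpace.subspace K S (module_mat TYPE('a) r c)"
abbreviation "mdim r c S \<equiv> vectorspace.dim K (module_mat TYPE('a) r c\<lparr>carrier := S\<rparr>)"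
abbreviation "degF \<equiv> degree_over F"

lemma carrier_base_field [simp]: "carrier K = F"
  and ops_base_field: "\<zero>\<^bsub>K\<^esub> = 0" "\<one>\<^bsub>K\<^esub> = 1" "x \<oplus>\<^bsub>K\<^esub> y = x + y" "x \<otimes>\<^bsub>K\<^esub> y = x * y"
  by (simp_all add: base_field_def)

lemma field_base_field: "field K"
  using central ring.subfield_iff(2)[OF class_ring.ring_axioms, of F] unfolding central_subfield_def base_field_def by simp

lemma F_comm: "c \<in> F \<Longrightarrow> c * x = x * c"
  using central unfolding central_subfield_def ring_center_def by auto

lemma F_zero [simp]: "0 \<in> F" and F_one [simp]: "1 \<in> F"
  and F_add: "x \<in> F \<Longrightarrow> y \<in> F \<Longrightarrow> x + y \<in> F"
  and F_mult: "x \<in> F \<Longrightarrow> y \<in> F \<Longrightarrow> x * y \<in> F"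
proof -
  interpret field K by (rule field_base_field)
  show "0 \<in> F" "1 \<in> F" using zero_closed one_closed by (simp_all add: ops_base_field)
  show "x \<in> F \<Longrightarrow> y \<in> F \<Longrightarrow> x + y \<in> F" "x \<in> F \<Longrightarrow> y \<in> F \<Longrightarrow> x * y \<in> F"
    using a_closed[of x y] m_closed[of x y] by (simp_all add: ops_base_field)
qed

lemma F_uminus: "x \<in> F \<Longrightarrow> - x \<in> F"
proof -
  interpret field K by (rule field_base_field)
  assume "x \<in> F"
  then obtain y where "y \<in> F" "y + x = 0"
    using add.l_inv_ex[of x] by (auto simp: ops_base_field)
  then show "- x \<in> F" by (metis eq_neg_iff_add_eq_0)
qed

lemma F_diff: "x \<in> F \<Longrightarrow> y \<in> F \<Longrightarrow> x - y \<in> F"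
  using F_add[of x "- y"] F_uminus by simp

lemma F_inverse: assumes "x \<in> F" shows "inverse x \<in> F"
proof (cases "x = 0")
  case False
  interpret field K by (rule field_base_field)
  have "x \<in> Units K" using False assms field_Units by (simp add: ops_base_field)
  then obtain y where "y \<in> F" "x * y = 1" unfolding Units_def by (auto simp: ops_base_field)
  then show ?thesis by (metis inverse_unique)
qed simp

lemma ring_module_simps [simp]:
  "carrier (ring_module :: ('a, 'a) module) = UNIV" "\<zero>\<^bsub>(ring_module :: ('a, 'a) module)\<^esub> = 0"
  "x \<oplus>\<^bsub>(ring_module :: ('a, 'a) module)\<^esub> y = x + y" "c \<odot>\<^bsub>(ring_module :: ('a, 'a) module)\<^esub> y = c * y"
  by (simp_all add: ring_module_def)

lemma ring_vs: "vectorspace K (ring_module :: ('a, 'a) module)"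
proof -
  interpret K: field K by (rule field_base_field)
  interpret abelian_group "ring_module :: ('a, 'a) module"
    by (rule abelian_groupI) (auto simp: add.assoc add.commute intro: exI[of _ "- x" for x :: 'a])
  show ?thesis
    by unfold_locales (auto simp: ops_base_field distrib_left distrib_right mult.assoc)
qed

lemma ring_fd: "vectorspace.fin_dim K (ring_module :: ('a, 'a) module)"
  using finite_degree unfolding finite_degree_def .

lemma mat_vs: "vectorspace K (module_mat TYPE('a) r c)"
proof -
  interpret K: field K by (rule field_base_field)
  interpret abelian_group "module_mat TYPE('a) r c"
  proof (rule abelian_groupI)
    fix x assume "x \<in> carrier (module_mat TYPE('a) r c)"
    then show "\<exists>y\<in>carrier (module_mat TYPE('a) r c). y \<oplus>\<^bsub>module_mat TYPE('a) r c\<^esub> x = \<zero>\<^bsub>module_mat TYPE('a) r c\<^esub>"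
      by (intro bexI[of _ "- x"]) (auto simp: module_mat_simps)
  qed (auto simp: module_mat_simps assoc_add_mat comm_add_mat)
  show ?thesis
    by unfold_locales
      (auto simp: module_mat_simps ops_base_field distrib_left distrib_right mult.assoc intro!: eq_matI)
qed

lemma msub_iff: "msub r c S \<longleftrightarrow> S \<subseteq> carrier_mat r c \<and> 0\<^sub>m r c \<in> S \<and>
    (\<forall>v\<in>S. \<forall>w\<in>S. v + w \<in> S) \<and> (\<forall>k\<in>F. \<forall>v\<in>S. k \<cdot>\<^sub>m v \<in> S)"
  using vectorspace.subspace_iff[OF mat_vs, of S r c] by (simp add: module_mat_simps)

lemma dsub_iff: "dsub S \<longleftrightarrow> 0 \<in> S \<and> (\<forall>v\<in>S. \<forall>w\<in>S. v + w \<in> S) \<and> (\<forall>k\<in>F. \<forall>v\<in>S. k * v \<in> S)"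
  using vectorspace.subspace_iff[OF ring_vs, of S] by simp

lemma dsub_uminus: assumes "dsub S" "v \<in> S" shows "- v \<in> S"
proof -
  have "(- 1) * v \<in> S" using assms F_uminus[OF F_one] unfolding dsub_iff by blast
  then show ?thesis by simp
qed

lemma dsub_diff: "dsub S \<Longrightarrow> v \<in> S \<Longrightarrow> w \<in> S \<Longrightarrow> v - w \<in> S"
  using dsub_uminus[of S w] unfolding dsub_iff by (metis diff_conv_add_uminus)

lemma msub_uminus: assumes "msub r c S" "v \<in> S" shows "- v \<in> S"
proof -
  have "(- 1) \<cdot>\<^sub>m v \<in> S" using assms F_uminus[OF F_one] unfolding msub_iff by blast
  moreover have "(- 1) \<cdot>\<^sub>m v = - v" by (intro eq_matI) auto
  ultimately show ?thesis by simp
qed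

lemma msub_diff: assumes "msub r c S" "v \<in> S" "w \<in> S" shows "v - w \<in> S"
proof -
  have "v \<in> carrier_mat r c" "w \<in> carrier_mat r c" using assms msub_iff by auto
  then have "v - w = v + - w" by (intro eq_matI) auto
  then show ?thesis using msub_uminus[OF assms(1,3)] assms unfolding msub_iff by auto
qed

section \<open>Matrices with prescribed entry sets and their dimensions\<close>

definition single :: "nat \<Rightarrow> nat \<Rightarrow> nat \<times> nat \<Rightarrow> 'a \<Rightarrow> 'a mat" where
  "single r c p a = mat r c (\<lambda>q. if q = p then a else 0)"

text \<open>Full matrix spaces and joints are both of this form, so one dimension formula, a sum
  over the positions, serves for both.\<close>

definition box :: "nat \<Rightarrow> nat \<Rightarrow> (nat \<times> nat \<Rightarrow> 'a set) \<Rightarrow> 'a mat set" where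
  "box r c A = {M \<in> carrier_mat r c. \<forall>i<r. \<forall>j<c. M $$ (i, j) \<in> A (i, j)}"

lemma single_carrier [simp]: "single r c p a \<in> carrier_mat r c"
  by (simp add: single_def)

lemma single_index [simp]: "i < r \<Longrightarrow> j < c \<Longrightarrow> single r c p a $$ (i, j) = (if (i, j) = p then a else 0)"
  by (simp add: single_def)

lemma single_dim [simp]: "dim_row (single r c p a) = r" "dim_col (single r c p a) = c"
  by (simp_all add: single_def)

lemma msub_box: "(\<And>p. dsub (A p)) \<Longrightarrow> msub r c (box r c A)"
  unfolding msub_iff box_def by (auto simp: dsub_iff)

lemma dsub_zero: "dsub {0}" and dsub_UNIV: "dsub UNIV"
  unfolding dsub_iff by auto

lemma ddim_zero: "ddim {0} = 0"
  using vectorspace.dim_subspace_zero[OF ring_vs] by simp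

lemma ddim_UNIV: "ddim UNIV = degF"
  unfolding degree_over_def by (simp add: ring_module_def)

lemma single_space:
  assumes "dsub A" "i < r" "j < c"
  shows "msub r c (single r c (i, j) ` A)" "mdim r c (single r c (i, j) ` A) = ddim A"
    "vectorspace.fin_dim K (module_mat TYPE('a) r c\<lparr>carrier := single r c (i, j) ` A\<rparr>)"
proof -
  have 1: "single r c (i, j) (v + w) = single r c (i, j) v + single r c (i, j) w" for v w :: 'a
    by (intro eq_matI) auto
  have 2: "single r c (i, j) (k * v) = k \<cdot>\<^sub>m single r c (i, j) v" for k v :: 'a
    by (intro eq_matI) auto
  have ker: "{v \<in> A. single r c (i, j) v = 0\<^sub>m r c} = {0}"
  proof -
    have "v = 0" if "single r c (i, j) v = 0\<^sub>m r c" for v :: 'a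
      using arg_cong[OF that, of "\<lambda>M. M $$ (i, j)"] assms by simp
    moreover have "single r c (i, j) 0 = (0\<^sub>m r c :: 'a mat)" by (intro eq_matI) auto
    ultimately show ?thesis using assms(1) dsub_iff by auto
  qed
  note rn = subspace_rank_nullity[OF ring_vs ring_fd mat_vs assms(1), of "single r c (i, j)" r c]
  show "msub r c (single r c (i, j) ` A)"
    by (rule rn(2)) (auto simp: module_mat_simps 1 2)
  show "mdim r c (single r c (i, j) ` A) = ddim A"
    by (subst rn(1)) (auto simp: module_mat_simps 1 2 ker ddim_zero)
  show "vectorspace.fin_dim K (module_mat TYPE('a) r c\<lparr>carrier := single r c (i, j) ` A\<rparr>)"
    by (rule rn(4)) (auto simp: module_mat_simps 1 2)
qed

text \<open>Boxes are built by opening one position at a time: positions outside the index set carry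
  \<open>{0}\<close>, and a new position contributes a direct summand isomorphic to its entry
  set.\<close>

lemma box_insert:
  assumes A: "\<And>p. dsub (A p)" and p: "(i, j) \<notin> I" "i < r" "j < c"
  shows "box r c (\<lambda>q. if q \<in> insert (i, j) I then A q else {0}) =
      module.submodule_sum (module_mat TYPE('a) r c)
        (box r c (\<lambda>q. if q \<in> I then A q else {0})) (single r c (i, j) ` A (i, j))"
    and "box r c (\<lambda>q. if q \<in> I then A q else {0}) \<inter> single r c (i, j) ` A (i, j) = {0\<^sub>m r c}"
proof -
  have A0: "0 \<in> A q" for q using A unfolding dsub_iff by blast
  interpret vectorspace K "module_mat TYPE('a) r c" by (rule mat_vs)
  show "box r c (\<lambda>q. if q \<in> insert (i, j) I then A q else {0}) =
      subspace_sum
        (box r c (\<lambda>q. if q \<in> I then A q else {0})) (single r c (i, j) ` A (i, j))" (is "?L = ?R")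
  proof
    show "?L \<subseteq> ?R"
    proof
      fix M assume M: "M \<in> ?L"
      define N where "N = mat r c (\<lambda>q. if q = (i, j) then 0 else M $$ q)"
      have "N \<in> box r c (\<lambda>q. if q \<in> I then A q else {0})"
      proof -
        have "N $$ (a, b) \<in> (if (a, b) \<in> I then A (a, b) else {0})" if "a < r" "b < c" for a b
        proof (cases "(a, b) = (i, j)")
          case False
          have "M $$ (a, b) \<in> (if (a, b) \<in> insert (i, j) I then A (a, b) else {0})"
            using M that unfolding box_def by blast
          then show ?thesis using False that by (auto simp: N_def split: if_splits)
        qed (use that p in \<open>simp add: N_def\<close>)
        then show ?thesis unfolding box_def by (simp add: N_def)
      qed
      moreover have "M $$ (i, j) \<in> (if (i, j) \<in> insert (i, j) I then A (i, j) else {0})"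
        using M p unfolding box_def by blast
      then have "M $$ (i, j) \<in> A (i, j)" by simp
      moreover have "M = N + single r c (i, j) (M $$ (i, j))"
        using M unfolding N_def box_def by (intro eq_matI) auto
      ultimately show "M \<in> ?R" unfolding in_subspace_sum module_mat_simps by blast
    qed
    show "?R \<subseteq> ?L"
      using A0 p unfolding box_def in_subspace_sum subset_iff by (auto simp: module_mat_simps)
  qed
  have "M = 0\<^sub>m r c" if "M \<in> box r c (\<lambda>q. if q \<in> I then A q else {0})" "M = single r c (i, j) a" for M a
  proof -
    have "M $$ (i, j) \<in> (if (i, j) \<in> I then A (i, j) else {0})"
      using that(1) p unfolding box_def by blast
    then have "M $$ (i, j) = 0" using p by simp
    then have "a = 0" using that(2) p by simp
    then show ?thesis using that(2) by (intro eq_matI) auto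
  qed
  moreover have "0\<^sub>m r c \<in> box r c (\<lambda>q. if q \<in> I then A q else {0})"
    using A0 unfolding box_def by auto
  moreover have "0\<^sub>m r c = single r c (i, j) 0" by (intro eq_matI) auto
  ultimately show "box r c (\<lambda>q. if q \<in> I then A q else {0}) \<inter> single r c (i, j) ` A (i, j) = {0\<^sub>m r c}"
    using A0[of "(i, j)"] by blast
qed

lemma box_cong: "(\<And>i j. i < r \<Longrightarrow> j < c \<Longrightarrow> A (i, j) = B (i, j)) \<Longrightarrow> box r c A = box r c B"
  unfolding box_def by auto

lemma mat_fd: "vectorspace.fin_dim K (module_mat TYPE('a) r c)"
proof -
  interpret vectorspace K "module_mat TYPE('a) r c" by (rule mat_vs)
  have sub: "dsub (if q \<in> I then UNIV else {0})" for q :: "nat \<times> nat" and I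
    using dsub_zero dsub_UNIV by simp
  have "vectorspace.fin_dim K (vs (box r c (\<lambda>q. if q \<in> I then UNIV else {0})))"
    if "finite I" "I \<subseteq> {..<r} \<times> {..<c}" for I
    using that
  proof (induction I rule: finite_induct)
    case empty
    have "box r c (\<lambda>q. {0}) = {0\<^sub>m r c}" unfolding box_def by (auto intro!: eq_matI)
    moreover have "vectorspace.fin_dim K (vs {0\<^sub>m r c})"
    proof -
      interpret Z: vectorspace K "vs {0\<^sub>m r c}"
        using subspace_zero by (intro subspace_is_vs) (simp add: module_mat_simps)
      have "Z.gen_set {}" using Z.span_empty by (simp add: module_mat_simps)
      then show ?thesis unfolding Z.fin_dim_def by (intro exI[of _ "{}"]) simp
    qed
    ultimately show ?case by simp
  next
    case (insert p I)
    obtain i j where p: "p = (i, j)" by (cases p)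
    note b = box_insert(1)[of "\<lambda>_. UNIV" i j I r c, OF dsub_UNIV]
    show ?case
      unfolding p using insert p
      by (subst b) (auto intro!: fin_dim_subspace_sum msub_box sub single_space dsub_UNIV)
  qed
  from this[of "{..<r} \<times> {..<c}"]
  have "vectorspace.fin_dim K (vs (box r c (\<lambda>q. if q \<in> {..<r} \<times> {..<c} then UNIV else {0})))" by simp
  also have "box r c (\<lambda>q. if q \<in> {..<r} \<times> {..<c} then UNIV else {0}) = carrier_mat r c"
    unfolding box_def by auto
  also have "vs (carrier_mat r c) = module_mat TYPE('a) r c" by (simp add: module_mat_def)
  finally show ?thesis .
qed

lemma mdim_zero: "mdim r c {0\<^sub>m r c} = 0"
  using vectorspace.dim_subspace_zero[OF mat_vs] by (simp add: module_mat_simps)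

lemma msub_zero: "msub r c {0\<^sub>m r c}" and msub_carrier: "msub r c (carrier_mat r c)"
  unfolding msub_iff by auto

lemma mdim_box:
  assumes A: "\<And>p. dsub (A p)"
  shows "mdim r c (box r c A) = (\<Sum>p\<in>{..<r} \<times> {..<c}. ddim (A p))"
proof -
  have sub: "dsub (if q \<in> I then A q else {0})" for q I
    using A dsub_zero by simp
  have "mdim r c (box r c (\<lambda>q. if q \<in> I then A q else {0})) = (\<Sum>p\<in>I. ddim (A p))"
    if "finite I" "I \<subseteq> {..<r} \<times> {..<c}" for I
    using that
  proof (induction I rule: finite_induct)
    case empty
    have "box r c (\<lambda>q. {0}) = {0\<^sub>m r c}" unfolding box_def by (auto intro!: eq_matI)
    then show ?case using mdim_zero by simp
  next
    case (insert p I)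
    obtain i j where p: "p = (i, j)" by (cases p)
    have ij: "(i, j) \<notin> I" "i < r" "j < c" using insert p by auto
    have "mdim r c (box r c (\<lambda>q. if q \<in> insert p I then A q else {0})) =
        mdim r c (box r c (\<lambda>q. if q \<in> I then A q else {0})) + mdim r c (single r c (i, j) ` A (i, j))"
      unfolding p box_insert(1)[of A, OF A ij]
      by (rule vectorspace.dim_direct_sum[OF mat_vs mat_fd])
        (use box_insert(2)[of A, OF A ij] ij in \<open>auto intro!: msub_box sub single_space A simp: module_mat_simps\<close>)
    then show ?case using insert single_space(2)[OF A ij(2,3)] p by simp
  qed
  from this[of "{..<r} \<times> {..<c}"]
  have "mdim r c (box r c (\<lambda>q. if q \<in> {..<r} \<times> {..<c} then A q else {0})) =
      (\<Sum>p\<in>{..<r} \<times> {..<c}. ddim (A p))" by simp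
  also have "box r c (\<lambda>q. if q \<in> {..<r} \<times> {..<c} then A q else {0}) = box r c A"
    by (rule box_cong) simp
  finally show ?thesis .
qed

lemma mdim_carrier: "mdim r c (carrier_mat r c) = r * c * degF"
proof -
  have "carrier_mat r c = box r c (\<lambda>_. UNIV)" unfolding box_def by auto
  then show ?thesis using mdim_box[of "\<lambda>_. UNIV" r c, OF dsub_UNIV] by (simp add: ddim_UNIV)
qed

lemma mdim_full: "vectorspace.dim K (module_mat TYPE('a) r c) = r * c * degF"
  using mdim_carrier[of r c] by (simp add: module_mat_def)

lemmas mdim_mono = vectorspace.subspace_dim_mono[OF mat_vs mat_fd]
lemmas mdim_eq = vectorspace.subspace_dim_eq[OF mat_vs mat_fd]
lemmas ddim_mono = vectorspace.subspace_dim_mono[OF ring_vs ring_fd]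
lemmas ddim_eq = vectorspace.subspace_dim_eq[OF ring_vs ring_fd]

lemma mdim_disjoint_le:
  "msub r c S \<Longrightarrow> msub r c T \<Longrightarrow> S \<inter> T = {0\<^sub>m r c} \<Longrightarrow> mdim r c S + mdim r c T \<le> r * c * degF"
  using vectorspace.dim_disjoint_le[OF mat_vs mat_fd, of S r c T] by (simp add: module_mat_simps mdim_full)

lemma msub_complement:
  assumes "msub r c S"
  obtains T where "msub r c T" "S \<inter> T = {0\<^sub>m r c}" "mdim r c S + mdim r c T = r * c * degF"
  using vectorspace.complement_exists[OF mat_vs mat_fd assms] mdim_full by (auto simp: module_mat_simps)

lemma madjoin_def: "vectorspace.adjoin K (module_mat TYPE('a) r c) S v = {s + k \<cdot>\<^sub>m v | s k. s \<in> S \<and> k \<in> F}"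
  unfolding vectorspace.adjoin_def[OF mat_vs] by (simp add: module_mat_simps)

lemma msub_adjoin:
  assumes "msub r c S" "v \<in> carrier_mat r c" "v \<notin> S"
  shows "msub r c {s + k \<cdot>\<^sub>m v | s k. s \<in> S \<and> k \<in> F}"
    "mdim r c {s + k \<cdot>\<^sub>m v | s k. s \<in> S \<and> k \<in> F} = Suc (mdim r c S)"
  using vectorspace.subspace_adjoin[OF mat_vs mat_fd assms(1), of v]
    vectorspace.dim_adjoin[OF mat_vs mat_fd assms(1), of v] assms
  by (simp_all add: module_mat_simps madjoin_def)

lemma mdim_pos:
  assumes "msub r c S" "0 < mdim r c S"
  obtains v where "v \<in> S" "v \<noteq> 0\<^sub>m r c"
  using vectorspace.dim_subspace_pos[OF mat_vs mat_fd assms] by (auto simp: module_mat_simps)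

lemma ddim_pos:
  assumes "dsub S" "0 < ddim S"
  obtains v where "v \<in> S" "v \<noteq> 0"
  using vectorspace.dim_subspace_pos[OF ring_vs ring_fd assms] by auto

lemma mat_rank_nullity:
  assumes "msub r c S" "\<And>v. v \<in> S \<Longrightarrow> f v \<in> carrier_mat r' c'"
    "\<And>v w. v \<in> S \<Longrightarrow> w \<in> S \<Longrightarrow> f (v + w) = f v + f w"
    "\<And>k v. k \<in> F \<Longrightarrow> v \<in> S \<Longrightarrow> f (k \<cdot>\<^sub>m v) = k \<cdot>\<^sub>m f v"
  shows "mdim r c S = mdim r' c' (f ` S) + mdim r c {v \<in> S. f v = 0\<^sub>m r' c'}"
    "msub r' c' (f ` S)" "msub r c {v \<in> S. f v = 0\<^sub>m r' c'}"
  using subspace_rank_nullity(1-3)[OF mat_vs mat_fd mat_vs assms(1), of f r' c'] assms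
  by (simp_all add: module_mat_simps)

lemma mat_ring_rank_nullity:
  assumes "msub r c S" "\<And>v w. v \<in> S \<Longrightarrow> w \<in> S \<Longrightarrow> f (v + w) = f v + f w"
    "\<And>k v. k \<in> F \<Longrightarrow> v \<in> S \<Longrightarrow> f (k \<cdot>\<^sub>m v) = k * f v"
  shows "mdim r c S = ddim (f ` S) + mdim r c {v \<in> S. f v = 0}"
    "dsub (f ` S)" "msub r c {v \<in> S. f v = 0}"
  using subspace_rank_nullity(1-3)[OF mat_vs mat_fd ring_vs assms(1), of f] assms
  by (simp_all add: module_mat_simps)

lemma ring_rank_nullity:
  assumes "dsub S" "\<And>v w. v \<in> S \<Longrightarrow> w \<in> S \<Longrightarrow> f (v + w) = f v + f w"
    "\<And>k v. k \<in> F \<Longrightarrow> v \<in> S \<Longrightarrow> f (k * v) = k * f v"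
  shows "ddim S = ddim (f ` S) + ddim {v \<in> S. f v = 0}" "dsub (f ` S)" "dsub {v \<in> S. f v = 0}"
  using subspace_rank_nullity(1-3)[OF ring_vs ring_fd ring_vs assms(1), of f] assms
  by simp_all

lemma dadjoin_def: "vectorspace.adjoin K (ring_module :: ('a, 'a) module) S v = {s + k * v | s k. s \<in> S \<and> k \<in> F}"
  unfolding vectorspace.adjoin_def[OF ring_vs] by simp

lemma dsub_adjoin:
  assumes "dsub S" "v \<notin> S"
  shows "dsub {s + k * v | s k. s \<in> S \<and> k \<in> F}"
    "ddim {s + k * v | s k. s \<in> S \<and> k \<in> F} = Suc (ddim S)"
  using vectorspace.subspace_adjoin[OF ring_vs ring_fd assms(1), of v]
    vectorspace.dim_adjoin[OF ring_vs ring_fd assms(1), of v] assms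
  by (simp_all add: dadjoin_def)

lemma ddim_direct_sum:
  assumes "dsub S" "dsub T" "S \<inter> T = {0}"
  shows "dsub {s + t | s t. s \<in> S \<and> t \<in> T}" "ddim {s + t | s t. s \<in> S \<and> t \<in> T} = ddim S + ddim T"
proof -
  interpret vectorspace K "ring_module :: ('a, 'a) module" by (rule ring_vs)
  have eq: "subspace_sum S T = {s + t | s t. s \<in> S \<and> t \<in> T}"
    unfolding set_eq_iff in_subspace_sum by auto
  show "dsub {s + t | s t. s \<in> S \<and> t \<in> T}" "ddim {s + t | s t. s \<in> S \<and> t \<in> T} = ddim S + ddim T"
    using sum_is_subspace[OF assms(1,2)] dim_direct_sum[OF ring_fd assms(1,2)] assms(3)
    unfolding eq by simp_all
qed

section \<open>Hyperplanes avoiding 1 and their linear forms\<close>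

definition hyper :: "'a set \<Rightarrow> bool" where
  "hyper H \<longleftrightarrow> dsub H \<and> Suc (ddim H) = degF \<and> 1 \<notin> H"

lemma hyper_iff: "hyper H \<longleftrightarrow> linear_hyperplane F H \<and> 1 \<notin> H"
  unfolding hyper_def linear_hyperplane_def by auto

text \<open>A hyperplane avoiding 1 is a complement of \<open>F\<close>: adjoining 1 reaches the
  full dimension, and two different coefficients would put a nonzero scalar, hence 1, into
  \<open>H\<close>.\<close>

lemma hyper_decompose:
  assumes "hyper H"
  shows "\<exists>!c. c \<in> F \<and> x - c \<in> H"
proof -
  have H: "dsub H" "1 \<notin> H" "Suc (ddim H) = degF" using assms hyper_def by auto
  have "{s + k * 1 | s k. s \<in> H \<and> k \<in> F} = UNIV"
    using ddim_eq[OF dsub_adjoin(1)[OF H(1,2)] dsub_UNIV] dsub_adjoin(2)[OF H(1,2)] H(3) ddim_UNIV by simp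
  then obtain s k where sk: "s \<in> H" "k \<in> F" "x = s + k * 1" by blast
  have "c = k" if c: "c \<in> F" "x - c \<in> H" for c
  proof (rule ccontr)
    assume "c \<noteq> k"
    have "(x - c) - s \<in> H" using dsub_diff[OF H(1)] c sk by blast
    then have "k - c \<in> H" using sk by simp
    moreover have "inverse (k - c) \<in> F" using c sk F_diff F_inverse by blast
    ultimately have "inverse (k - c) * (k - c) \<in> H" using H(1) unfolding dsub_iff by blast
    then show False using \<open>c \<noteq> k\<close> H(2) by simp
  qed
  then show ?thesis using sk by (intro ex1I[of _ k]) auto
qed

text \<open>The \<open>F\<close>-linear form with kernel \<open>H\<close> and value 1 at 1, that is,
  the projection of \<open>D\<close> onto \<open>F\<close> along \<open>H\<close>.\<close>

definition coef :: "'a set \<Rightarrow> 'a \<Rightarrow> 'a" where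
  "coef H x = (THE c. c \<in> F \<and> x - c \<in> H)"

lemma coef: assumes "hyper H" shows "coef H x \<in> F" "x - coef H x \<in> H"
  using theI'[OF hyper_decompose[OF assms, of x]] unfolding coef_def by auto

lemma coef_eqI: assumes "hyper H" "c \<in> F" "x - c \<in> H" shows "coef H x = c"
  using coef[OF assms(1), of x] hyper_decompose[OF assms(1), of x] assms by blast

lemma coef_add: assumes "hyper H" shows "coef H (x + y) = coef H x + coef H y"
proof (rule coef_eqI[OF assms])
  have "(x - coef H x) + (y - coef H y) \<in> H"
    using coef[OF assms] assms unfolding hyper_def dsub_iff by blast
  then show "x + y - (coef H x + coef H y) \<in> H" by (simp add: algebra_simps)
qed (intro F_add coef assms)

lemma coef_scale: assumes "hyper H" "k \<in> F" shows "coef H (k * x) = k * coef H x"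
proof (rule coef_eqI[OF assms(1)])
  have "k * (x - coef H x) \<in> H"
    using coef[OF assms(1)] assms unfolding hyper_def dsub_iff by blast
  then show "k * x - (k * coef H x) \<in> H" by (simp add: algebra_simps)
qed (intro F_mult coef assms)

lemma coef_zero_iff: assumes "hyper H" shows "coef H x = 0 \<longleftrightarrow> x \<in> H"
proof
  show "coef H x = 0 \<Longrightarrow> x \<in> H" using coef(2)[OF assms, of x] by simp
  show "x \<in> H \<Longrightarrow> coef H x = 0" using coef_eqI[OF assms F_zero, of x] by simp
qed

lemma coef_F: assumes "hyper H" "c \<in> F" shows "coef H c = c"
proof (rule coef_eqI[OF assms])
  show "c - c \<in> H" using assms(1) unfolding hyper_def dsub_iff by simp
qed

lemma coef_diff: "hyper H \<Longrightarrow> coef H (x - y) = coef H x - coef H y"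
  using coef_add[of H "x - y" y] by (simp add: algebra_simps)

end

section \<open>Quadratic algebras\<close>

lemma field_class_ringI:
  assumes "\<And>x y :: 'a :: division_ring. x * y = y * x"
  shows "field (class_ring :: 'a ring)"
proof -
  interpret ring "class_ring :: 'a ring" by (rule class_ring.ring_axioms)
  have cring: "cring (class_ring :: 'a ring)"
    by unfold_locales (simp add: assms)
  moreover have "Units (class_ring :: 'a ring) = UNIV - {0}"
  proof -
    have "x \<in> Units (class_ring :: 'a ring)" if "x \<noteq> 0" for x :: 'a
      unfolding Units_def using that by (auto intro!: exI[of _ "inverse x"])
    moreover have "0 \<notin> Units (class_ring :: 'a ring)" unfolding Units_def by simp
    ultimately show ?thesis by auto
  qed
  ultimately show ?thesis using cring.cring_fieldI[OF cring] by simp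
qed

context central_division
begin

lemma dsub_F: "dsub F" and ddim_F: "ddim F = 1"
proof -
  have "{s + k * 1 | s k. s \<in> {0} \<and> k \<in> F} = F" by auto
  then show "dsub F" "ddim F = 1" using dsub_adjoin[OF dsub_zero, of 1] ddim_zero by simp_all
qed

lemma degree_eq_one: "F = UNIV \<Longrightarrow> degF = 1"
  using ddim_F ddim_UNIV by simp

lemma F_cancel: assumes "a \<in> F" "a \<noteq> 0" "a * x \<in> F" shows "x \<in> F"
proof -
  have "inverse a * (a * x) \<in> F" using assms F_mult F_inverse by blast
  then show ?thesis using assms(2) by (simp flip: mult.assoc)
qed

text \<open>The \<open>F\<close>-span of 1 and \<open>x\<close>: a plane when \<open>x\<close> is
  outside \<open>F\<close>, and the field generated by \<open>x\<close> when moreover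
  \<open>x * x\<close> belongs to it.\<close>

definition line :: "'a \<Rightarrow> 'a set" where
  "line x = {a + b * x | a b. a \<in> F \<and> b \<in> F}"

lemma line_sub: assumes "x \<notin> F" shows "dsub (line x)" "ddim (line x) = 2"
  using dsub_adjoin[OF dsub_F assms] ddim_F unfolding line_def by simp_all

lemma line_contains: "F \<subseteq> line x" "x \<in> line x"
proof -
  have "a = a + 0 * x" for a by simp
  then show "F \<subseteq> line x" unfolding line_def using F_zero by blast
  have "x = 0 + 1 * x" by simp
  then show "x \<in> line x" unfolding line_def using F_zero F_one by blast
qed

lemma line_mult:
  assumes x: "x * x \<in> line x" and u: "u \<in> line x" and v: "v \<in> line x"
  shows "u * v \<in> line x"
proof -
  obtain p t where p: "p \<in> F" "t \<in> F" "x * x = p + t * x" using x unfolding line_def by auto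
  obtain a b where a: "a \<in> F" "b \<in> F" "u = a + b * x" using u unfolding line_def by auto
  obtain c e where c: "c \<in> F" "e \<in> F" "v = c + e * x" using v unfolding line_def by auto
  have "b * x * (e * x) = b * e * (x * x)" using F_comm[OF c(2)] by (metis mult.assoc)
  moreover have "b * x * c = b * c * x" using F_comm[OF c(1)] by (metis mult.assoc)
  ultimately have "u * v = (a * c + b * e * p) + (a * e + b * c + b * e * t) * x"
    unfolding a c by (simp add: algebra_simps p(3))
  then show ?thesis unfolding line_def using a c p by (blast intro: F_add F_mult)
qed

lemma line_commutes: assumes "u \<in> line x" "v \<in> line x" shows "u * v = v * u"
proof -
  obtain a b where a: "a \<in> F" "b \<in> F" "u = a + b * x" using assms unfolding line_def by auto
  obtain c e where c: "c \<in> F" "e \<in> F" "v = c + e * x" using assms unfolding line_def by auto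
  have "b * x * (e * x) = b * e * (x * x)" using F_comm[OF c(2)] by (metis mult.assoc)
  moreover have "e * x * (b * x) = b * e * (x * x)" using F_comm[OF a(2)] by (metis mult.assoc)
  ultimately have "b * x * (e * x) = e * x * (b * x)" by simp
  moreover have "b * x * c = c * (b * x)" "a * c = c * a" "a * (e * x) = e * x * a"
    using F_comm[OF c(1), of "b * x"] F_comm[OF a(1), of c] F_comm[OF a(1), of "e * x"] by simp_all
  ultimately show ?thesis unfolding a c by (simp add: algebra_simps)
qed

lemma line_unique:
  assumes "x \<notin> F" "a \<in> F" "b \<in> F" "c \<in> F" "e \<in> F" "a + b * x = c + e * x"
  shows "a = c" "b = e"
proof -
  have "(b - e) * x = c - a" using assms(6) by (simp add: algebra_simps)
  then have "(b - e) * x \<in> F" using assms F_diff by simp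
  then show "b = e" using F_cancel[of "b - e" x] assms F_diff by auto
  then show "a = c" using assms(6) by simp
qed

text \<open>The minimal polynomial of \<open>y\<close> is \<open>X\<^sup>2 + b X + c\<close>, and
  \<open>(2 X + b)\<^sup>2 - 4 (X\<^sup>2 + b X + c) = b\<^sup>2 - 4 c = (2 y + b)\<^sup>2\<close> does not vanish.\<close>

lemma separable_extension_of_line:
  assumes x: "x \<notin> F" "line x = UNIV" "x * x = t * x + p" "t \<in> F" "p \<in> F" "x + x \<noteq> t"
  shows "separable_field_extension F"
proof -
  have comm: "u * v = v * u" for u v :: 'a using line_commutes[of u x v] x(2) by simp
  have fld: "field (class_ring :: 'a ring)" using field_class_ringI comm by blast
  let ?R = "class_ring :: 'a ring"
  have R: "ring ?R" by (rule class_ring.ring_axioms)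
  have dom: "domain ?R" using fld field.axioms(1) by blast
  note [simp] = class_ring_simps
  note [simp] = ring.eval.simps[OF R] ring.normalize.simps[OF R] ring.poly_add.simps[OF R]
    ring.poly_mult.simps[OF R]
  have sF: "subfield F ?R" using central central_subfield_def by blast
  have srF: "subring F ?R" using sF subfieldE(1) by blast
  have poly: "q \<in> carrier (univ_poly ?R F) \<longleftrightarrow> q = [] \<or> (set q \<subseteq> F \<and> hd q \<noteq> 0)" for q
    unfolding univ_poly_carrier[symmetric] polynomial_def by simp
  note pm = univ_poly_mult univ_poly_add univ_poly_one
  have alg_sep: "ring.algebraic ?R F y \<and> separable_poly F (ring.Irr ?R F y)" for y
  proof -
    obtain a e where ab: "a \<in> F" "e \<in> F" "y = a + e * x" using x(2) unfolding line_def by blast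
    \<comment> \<open>Every \<open>y\<close> is quadratic over \<open>F\<close>: outside
      \<open>F\<close>, its span with 1 already has the dimension of
      \<open>line x = UNIV\<close>.\<close>
    have "y * y \<in> line y"
    proof (cases "y \<in> F")
      case True
      then show ?thesis using F_mult[of y y] line_contains[of y] by blast
    next
      case False
      have "line y = UNIV" using ddim_eq[OF line_sub(1)[OF False] dsub_UNIV]
        line_sub(2)[OF False] line_sub(2)[OF x(1)] x(2) by simp
      then show ?thesis by simp
    qed
    then obtain q s where qs: "q \<in> F" "s \<in> F" "y * y = q + s * y" unfolding line_def by blast
    have P: "[1, - s, - q] \<in> carrier (univ_poly ?R F)" unfolding poly using qs F_uminus by simp
    have Pe: "ring.eval ?R [1, - s, - q] y = 0" using qs(3) by (simp add: algebra_simps power2_eq_square)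
    have alg: "ring.algebraic ?R F y" using ring.algebraicI[OF R P, of y] Pe by (simp add: over_def)
    have alg': "(ring.algebraic ?R over F) y" using alg by (simp add: over_def)
    define r where "r = ring.Irr ?R F y"
    have r: "r \<in> carrier (univ_poly ?R F)" "lead_coeff r = 1" "ring.eval ?R r y = 0" "r \<noteq> []"
      unfolding r_def using domain.IrrE[OF dom sF _ alg'] domain.pirreducibleE(1)[OF dom srF] by simp_all
    have "Polynomial_Divisibility.pdivides ?R r [1, - s, - q]"
      unfolding r_def using domain.Irr_minimal[OF dom sF _ alg' P] Pe by simp
    then have "degree r \<le> 2"
      using domain.pdivides_imp_degree_le[OF dom srF r(1) P] by simp
    moreover have "degree r \<le> 1" if "y \<in> F"
    proof -
      have Q: "[1, - y] \<in> carrier (univ_poly ?R F)" unfolding poly using that F_uminus by simp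
      have "Polynomial_Divisibility.pdivides ?R r [1, - y]"
        unfolding r_def using domain.Irr_minimal[OF dom sF _ alg' Q] by simp
      then show ?thesis using domain.pdivides_imp_degree_le[OF dom srF r(1) Q] by simp
    qed
    ultimately consider "r = [1]" | b where "r = [1, b]" | b c where "r = [1, b, c]" "y \<notin> F"
      using r(2,4) by (cases r; cases "tl r"; cases "tl (tl r)") force+
    then have "separable_poly F r"
    proof cases
      case 1
      then show ?thesis using r(3) by simp
    next
      case (2 b)
      then have "poly_deriv r = [1]" unfolding poly_deriv_def by simp
      then show ?thesis unfolding separable_poly_def Let_def
        by (intro bexI[of _ "[]"] bexI[of _ "[1]"]) (simp_all add: poly pm)
    next
      case (3 b c)
      have bc: "b \<in> F" "c \<in> F" using r(1) 3 unfolding poly by auto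
      have ev: "y * y + b * y + c = 0" using r(3) 3 by (simp add: algebra_simps power2_eq_square)
      \<comment> \<open>The derivative does not vanish at \<open>y\<close>. In characteristic 2 it
        could do so only for \<open>b = 0\<close>; then \<open>y * y\<close> lies in
        \<open>F\<close>, and its coefficient \<open>e * e * t\<close> at \<open>x\<close> forces
        \<open>t = 0\<close>, against \<open>x + x \<noteq> t\<close>. Otherwise 2 is invertible and
        \<open>y\<close> would lie in \<open>F\<close>.\<close>
      have nz: "y + y + b \<noteq> 0"
      proof
        assume 0: "y + y + b = 0"
        show False
        proof (cases "(2 :: 'a) = 0")
          case True
          have two: "z + z = 0" for z :: 'a using True by (metis mult_2 mult_zero_left)
          have "b = 0" using 0 two by simp
          then have "y * y = - c" using ev by (simp add: eq_neg_iff_add_eq_0)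
          then have yF: "y * y \<in> F" using bc F_uminus by simp
          have "y * y = a * a + (a * (e * x) + a * (e * x)) + e * e * (x * x)"
          proof -
            have "e * x * (e * x) = e * e * (x * x)" by (metis comm mult.assoc)
            then show ?thesis unfolding ab(3) using comm[of "e * x" a]
              by (simp add: distrib_left distrib_right add.assoc)
          qed
          then have "y * y = (a * a + e * e * p) + (e * e * t) * x"
            using two[of "a * (e * x)"] x(3) by (simp add: algebra_simps)
          then have "(e * e * t) * x = y * y - (a * a + e * e * p)" by simp
          also have "\<dots> \<in> F" by (rule F_diff[OF yF F_add[OF F_mult[OF ab(1) ab(1)] F_mult[OF F_mult[OF ab(2) ab(2)] x(5)]]])
          finally have "e * e * t = 0" using F_cancel[of "e * e * t" x] x ab F_mult by blast
          moreover have "e \<noteq> 0" using 3(2) ab by auto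
          ultimately have "t = 0" by simp
          then show False using x(6) two by simp
        next
          case False
          have "2 * y = - b" using 0 by (simp add: mult_2 eq_neg_iff_add_eq_0)
          then have "2 * y \<in> F" using bc F_uminus by simp
          then show False using F_cancel[of 2 y] False 3 F_add[OF F_one F_one] by simp
        qed
      qed
      define dl where "dl = (y + y + b) * (y + y + b)"
      have "(4 :: 'a) = 1 + 1 + 1 + 1" by simp
      then have four: "z * 4 = z + z + z + z" and fourL: "4 * z = z + z + z + z" for z :: 'a
        by (simp_all only: distrib_left distrib_right mult_1_right mult_1_left)
      have "dl = (y * y + b * y + c) * 4 + (b * b - c * 4)"
        unfolding dl_def using comm[of y b] by (simp add: four algebra_simps)
      then have dl: "dl = b * b - c * 4" using ev by simp
      have dl0: "dl \<noteq> 0" using nz dl_def by simp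
      have F4: "(2 :: 'a) \<in> F" "(4 :: 'a) \<in> F"
        using F_add[OF F_one F_one] F_add[OF F_add[OF F_one F_one] F_add[OF F_one F_one]] by simp_all
      define w where "w = inverse dl"
      have w: "w \<in> F" "w \<noteq> 0" "w * dl = 1"
        unfolding w_def using dl dl0 bc F4 by (auto intro!: F_inverse F_diff F_mult)
      show ?thesis
      proof (cases "(2 :: 'a) = 0")
        case True
        \<comment> \<open>In characteristic 2 the derivative is the nonzero constant
          \<open>b\<close>, which alone generates the unit ideal.\<close>
        then have "b \<noteq> 0" using nz by (metis add_0 mult_2 mult_zero_left)
        then have "poly_deriv r = [b]" unfolding poly_deriv_def 3(1) using True by simp
        then show ?thesis unfolding separable_poly_def Let_def using \<open>b \<noteq> 0\<close> bc
          by (intro bexI[of _ "[]"] bexI[of _ "[inverse b]"]) (simp_all add: poly pm F_inverse)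
      next
        case False
        have four0: "(4 :: 'a) \<noteq> 0"
        proof
          assume "(4 :: 'a) = 0"
          moreover have "(2 :: 'a) * 2 = 4" by simp
          ultimately have "(2 :: 'a) * 2 = 0" by metis
          then show False using False by (metis mult_eq_0_iff)
        qed
        have pd: "poly_deriv r = [2, b]" unfolding poly_deriv_def 3(1) using False by simp
        have "4 * c = c * 4" by (simp only: four fourL)
        \<comment> \<open>These are the coefficients of 1, \<open>X^2\<close> and \<open>X\<close>,
          in this order, of the combination
          \<open>- 4 w r + (2 w X + w b) (2 X + b)\<close>.\<close>
        then have "w * (- 4) * c + w * b * b = w * dl" unfolding dl by (simp add: algebra_simps)
        moreover have "w * (- 4) + w * 2 * 2 = 0" by (simp add: mult.assoc)
        moreover have "w * (- 4) * b + (w * 2 * b + w * b * 2) = 0"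
          by (simp add: four fourL mult_2 mult_2_right algebra_simps)
        ultimately have e1: "w * (- 4) + w * 2 * 2 = 0" "w * (- 4) * b + (w * 2 * b + w * b * 2) = 0"
          "w * (- 4) * c + w * b * b = 1" using w(3) by simp_all
        show ?thesis unfolding separable_poly_def Let_def pd
        proof (intro bexI)
          show "[w * 2, w * b] \<in> carrier (univ_poly ?R F)" "[w * (- 4)] \<in> carrier (univ_poly ?R F)"
            using w bc F4 False four0 by (auto simp: poly intro: F_mult F_uminus)
          show "[w * (- 4)] \<otimes>\<^bsub>univ_poly ?R F\<^esub> r \<oplus>\<^bsub>univ_poly ?R F\<^esub>
              [w * 2, w * b] \<otimes>\<^bsub>univ_poly ?R F\<^esub> [2, b] = \<one>\<^bsub>univ_poly ?R F\<^esub>"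
            unfolding 3(1) using e1 w False four0 by (cases "b = 0") (simp_all add: pm)
        qed
      qed
    qed
    then show ?thesis using alg r_def by simp
  qed
  then show ?thesis unfolding separable_field_extension_def using fld by blast
qed

text \<open>A subalgebra \<open>E\<close> of largest dimension among those whose dimension is a
  power of two is everything: for \<open>a\<close> outside \<open>E\<close>, the sum of
  \<open>E\<close> and \<open>E a\<close> is direct and, as \<open>a * a\<close> is in
  \<open>F\<close>, again a subalgebra, of twice the dimension.\<close>

lemma degree_power_of_two:
  assumes comm: "\<And>x y :: 'a. x * y = y * x" and sq: "\<And>x. x * x \<in> F"
  shows "\<exists>m. degF = 2 ^ m"
proof -
  define P where "P E \<longleftrightarrow> dsub E \<and> 1 \<in> E \<and> (\<forall>u\<in>E. \<forall>v\<in>E. u * v \<in> E) \<and> (\<exists>m. ddim E = 2 ^ m)" for E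
  have "P F" unfolding P_def using dsub_F ddim_F F_mult by (auto intro: exI[of _ 0])
  moreover have "ddim E \<le> degF" if "P E" for E
    using ddim_mono[of E UNIV] that dsub_UNIV ddim_UNIV unfolding P_def by simp
  ultimately obtain E where E: "P E" and max: "\<And>E'. P E' \<Longrightarrow> ddim E' \<le> ddim E"
    using ex_has_greatest_nat[of P F ddim "Suc degF"] by (metis less_Suc_eq_le)
  have E': "dsub E" "1 \<in> E" "\<And>u v. u \<in> E \<Longrightarrow> v \<in> E \<Longrightarrow> u * v \<in> E" using E unfolding P_def by auto
  obtain m where m: "ddim E = 2 ^ m" using E unfolding P_def by auto
  have cl: "u + v \<in> E" if "u \<in> E" "v \<in> E" for u v using E'(1) that unfolding dsub_iff by blast
  have clF: "c * v \<in> E" if "c \<in> F" "v \<in> E" for c v using E'(1) that unfolding dsub_iff by blast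
  have "E = UNIV"
  proof (rule ccontr)
    assume "E \<noteq> UNIV"
    then obtain a where a: "a \<notin> E" by blast
    have rn: "ddim E = ddim ((\<lambda>x. x * a) ` E) + ddim {v \<in> E. v * a = 0}" "dsub ((\<lambda>x. x * a) ` E)"
      using ring_rank_nullity(1,2)[OF E'(1), of "\<lambda>x. x * a"] by (simp_all add: distrib_right mult.assoc)
    have "a \<noteq> 0" using a E'(1) unfolding dsub_iff by auto
    then have "{v \<in> E. v * a = 0} = {0}" using E'(1) unfolding dsub_iff by auto
    then have dE: "ddim ((\<lambda>x. x * a) ` E) = ddim E" using rn(1) ddim_zero by simp
    have "x = 0" if "x \<in> E" "x = e * a" "e \<in> E" for x e
    proof (rule ccontr)
      assume "x \<noteq> 0"
      then have e0: "e \<noteq> 0" using that by auto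
      \<comment> \<open>Inverses come from squares: \<open>e * e\<close> is a scalar, so
        \<open>inverse e\<close> is a scalar multiple of \<open>e\<close>, and \<open>e * a\<close>
        in \<open>E\<close> would give \<open>a\<close> in \<open>E\<close>.\<close>
      have "inverse (e * e) \<in> F" using sq F_inverse by blast
      then have "inverse (e * e) * (e * x) \<in> E" using that E'(3) clF by blast
      moreover have "inverse (e * e) * (e * x) = a" 
        unfolding that(2) using left_inverse[of "e * e"] e0 by (metis mult.assoc mult.left_neutral mult_eq_0_iff)
      ultimately show False using a by simp
    qed
    then have "E \<inter> (\<lambda>x. x * a) ` E \<subseteq> {0}" by blast
    moreover have "0 \<in> E \<inter> (\<lambda>x. x * a) ` E" using E'(1) rn(2) unfolding dsub_iff by blast
    ultimately have int: "E \<inter> (\<lambda>x. x * a) ` E = {0}" by blast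
    define E2 where "E2 = {s + t | s t. s \<in> E \<and> t \<in> (\<lambda>x. x * a) ` E}"
    note ds = ddim_direct_sum[OF E'(1) rn(2) int, folded E2_def]
    have "P E2" unfolding P_def
    proof (intro conjI ballI)
      show "dsub E2" by (rule ds)
      have "1 = 1 + 0 * a" by simp
      moreover have "0 \<in> E" using E'(1) unfolding dsub_iff by blast
      ultimately show "1 \<in> E2" unfolding E2_def using E'(2) by blast
      show "\<exists>m. ddim E2 = 2 ^ m" using ds(2) dE m by (intro exI[of _ "Suc m"]) simp
      fix u v assume "u \<in> E2" "v \<in> E2"
      then obtain s t s' t' where st: "s \<in> E" "t \<in> E" "s' \<in> E" "t' \<in> E" "u = s + t * a" "v = s' + t' * a"
        unfolding E2_def by auto
      have "t * a * (t' * a) = (a * a) * (t * t')" "s * (t' * a) = s * t' * a" "t * a * s' = t * s' * a"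
        by (metis comm mult.assoc)+
      then have "u * v = (s * s' + (a * a) * (t * t')) + (s * t' + t * s') * a"
        unfolding st(5,6) by (simp add: distrib_left distrib_right add_ac)
      moreover have "s * s' + (a * a) * (t * t') \<in> E" "s * t' + t * s' \<in> E"
        using st E'(3) cl clF sq by simp_all
      ultimately show "u * v \<in> E2" unfolding E2_def by blast
    qed
    then have "ddim E2 \<le> ddim E" by (rule max)
    then show False using ds(2) dE m by simp
  qed
  then show ?thesis using m ddim_UNIV by auto
qed

text \<open>If \<open>T x = 2 x\<close> throughout and \<open>d > 1\<close>, the characteristic is
  2, \<open>T\<close> vanishes and \<open>D\<close> is commutative with all squares in
  \<open>F\<close>. Otherwise some \<open>x\<close> has a conjugate
  \<open>\<sigma> = T x - x\<close> different from \<open>x\<close>, the centralizer of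
  \<open>x\<close> is \<open>line x\<close>, and \<open>D\<close> is either \<open>line x\<close> or
  the sum of \<open>line x\<close> and the space of all \<open>y\<close> with
  \<open>x y = y \<sigma>\<close>, which makes it a quaternion algebra.\<close>

lemma quadratic_typeI:
  fixes T :: "'a \<Rightarrow> 'a"
  assumes Tadd: "\<And>x y. T (x + y) = T x + T y" and TF: "\<And>x. T x \<in> F"
    and quad: "\<And>x. x * x - T x * x \<in> F"
  shows "quadratic_type F"
proof (cases "degF = 1")
  case True
  then show ?thesis unfolding quadratic_type_def by simp
next
  case deg1: False
  then obtain e where e: "e \<notin> F" using degree_eq_one by blast
  have polar: "x * y + y * x - T x * y - T y * x \<in> F" for x y
  proof -
    have "x * y + y * x - T x * y - T y * x =
        ((x + y) * (x + y) - T (x + y) * (x + y)) - (x * x - T x * x) - (y * y - T y * y)"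
      by (simp add: Tadd algebra_simps)
    also have "\<dots> \<in> F" by (intro F_diff quad)
    finally show ?thesis .
  qed
  show ?thesis
  proof (cases "\<forall>x. x + x = T x")
    case True
    have two: "(2 :: 'a) = 0"
    proof (rule ccontr)
      assume "(2 :: 'a) \<noteq> 0"
      moreover have "2 * e = T e" using True by (metis mult_2)
      then have "2 * e \<in> F" using TF by simp
      ultimately show False using e F_cancel[of 2 e] F_add[OF F_one F_one] by simp
    qed
    have dbl: "x + x = 0" for x :: 'a using two by (metis mult_2 mult_zero_left)
    have sq: "x * x \<in> F" for x using quad[of x] True dbl by (metis diff_zero mult_zero_left)
    have comm: "x * y = y * x" for x y :: 'a
    proof (rule ccontr)
      assume ne: "x * y \<noteq> y * x"
      define l where "l = x * y + y * x"
      have T0: "T z = 0" for z using True dbl by metis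
      have lF: "l \<in> F" unfolding l_def using polar[of x y] T0 by simp
      have l0: "l \<noteq> 0" unfolding l_def using ne dbl by (metis add_right_cancel)
      \<comment> \<open>Here \<open>l\<close> is a nonzero scalar. Polarizing at \<open>x\<close>
        and \<open>x * y\<close> gives \<open>x * l\<close> in \<open>F\<close>, so that
        \<open>x\<close> is in \<open>F\<close> and commutes with \<open>y\<close> after
        all.\<close>
      have "x * (x * y) + (x * y) * x = x * l" unfolding l_def by (simp add: distrib_left mult.assoc)
      then have "x * l \<in> F" using polar[of x "x * y"] T0 by simp
      then have "x \<in> F" using F_cancel[of l x] l0 lF F_comm[OF lF] by simp
      then show False using ne F_comm by blast
    qed
    obtain m where m: "degF = 2 ^ m" using degree_power_of_two[OF comm sq] by blast
    then have "m \<ge> 1" using deg1 by (cases m) auto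
    moreover have "CHAR('a) = 2" 
    proof (rule CHAR_eqI)
      fix k assume k: "of_nat k = (0 :: 'a)"
      show "2 dvd k"
      proof (rule ccontr)
        assume "\<not> 2 dvd k"
        then obtain j where "k = 2 * j + 1" by (elim oddE)
        then have "of_nat k = 2 * of_nat j + (1 :: 'a)" by simp
        then show False using k two by simp
      qed
    qed (use two in simp)
    ultimately show ?thesis unfolding quadratic_type_def
      using m field_class_ringI[OF comm] sq by (auto simp: power2_eq_square)
  next
    case False
    then obtain x where x: "x + x \<noteq> T x" by blast
    \<comment> \<open>The difference of \<open>x\<close> and its conjugate \<open>T x - x\<close>.
      Its square is the discriminant, a scalar, so that its inverse again lies in
      \<open>line x\<close>.\<close>
    define \<delta> where "\<delta> = x + x - T x"
    have \<delta>0: "\<delta> \<noteq> 0" using x \<delta>_def by simp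
    have xF: "x \<notin> F"
    proof
      assume xF: "x \<in> F"
      have "\<delta> * e - T e * x \<in> F"
        using polar[of x e] F_comm[OF xF, of e] by (simp add: \<delta>_def algebra_simps)
      then have "\<delta> * e - T e * x + T e * x \<in> F" using TF F_mult F_add xF by blast
      then have "\<delta> * e \<in> F" by simp
      moreover have "\<delta> \<in> F" unfolding \<delta>_def using xF TF F_add F_diff by blast
      ultimately show False using F_cancel e \<delta>0 by blast
    qed
    obtain q where q: "q \<in> F" "x * x = q + T x * x"
      using quad[of x] by (metis diff_add_cancel)
    have xx: "x * x \<in> line x" unfolding line_def using q TF by blast
    have lsub: "dsub (line x)" "ddim (line x) = 2" using line_sub[OF xF] by auto
    have lineF: "c \<in> line x" if "c \<in> F" for c using that line_contains by blast
    have ladd: "u + v \<in> line x" if "u \<in> line x" "v \<in> line x" for u v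
      using lsub(1) that unfolding dsub_iff by blast
    have lmul: "u * v \<in> line x" if "u \<in> line x" "v \<in> line x" for u v
      using line_mult[OF xx that] .
    have xl: "x \<in> line x" by (rule line_contains)
    have \<delta>l: "\<delta> \<in> line x" unfolding \<delta>_def using xl TF lineF ladd dsub_diff[OF lsub(1)] by blast
    define \<epsilon> where "\<epsilon> = inverse \<delta>"
    have \<epsilon>: "\<epsilon> * \<delta> = 1" "\<delta> * \<epsilon> = 1" using \<delta>0 by (simp_all add: \<epsilon>_def)
    have \<epsilon>l: "\<epsilon> \<in> line x"
    proof -
      have "\<delta> * \<delta> = 4 * q + T x * T x"
      proof -
        have "(4 :: 'a) = 1 + 1 + 1 + 1" by simp
        then have four: "4 * z = z + z + z + z" for z :: 'a by (simp only: distrib_right mult_1_left)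
        have "\<delta> * \<delta> = 4 * (x * x) - 4 * (T x * x) + T x * T x"
          unfolding \<delta>_def using F_comm[OF TF, of x x] by (simp add: four algebra_simps)
        then show ?thesis unfolding q(2) by (simp add: algebra_simps)
      qed
      moreover have "(4 :: 'a) \<in> F" using F_add[OF F_add[OF F_one F_one] F_add[OF F_one F_one]] by simp
      ultimately have "\<delta> * \<delta> \<in> F" using q TF F_add F_mult by simp
      then have "inverse (\<delta> * \<delta>) * \<delta> \<in> line x" using lmul \<delta>l lineF F_inverse by blast
      then show ?thesis using \<delta>0 by (simp add: \<epsilon>_def nonzero_inverse_mult_distrib mult.assoc)
    qed
    have cent: "y \<in> line x \<longleftrightarrow> x * y = y * x" for y
    proof
      assume "x * y = y * x"
      then have "\<delta> * y - T y * x \<in> F" using polar[of x y] by (simp add: \<delta>_def algebra_simps)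
      then have "(\<delta> * y - T y * x) + T y * x \<in> line x" using ladd lineF lmul xl TF by blast
      then have "\<epsilon> * (\<delta> * y) \<in> line x" using lmul \<epsilon>l by simp
      then show "y \<in> line x" using \<epsilon> by (simp flip: mult.assoc)
    qed (use line_commutes[OF xl] in blast)
    show ?thesis
    proof (cases "line x = UNIV")
      case True
      have "degF = 2" using lsub(2) True ddim_UNIV by simp
      moreover have "separable_field_extension F"
        using separable_extension_of_line[OF xF True _ TF q(1), of x] q(2) x by (simp add: add.commute)
      ultimately show ?thesis unfolding quadratic_type_def by simp
    next
      case False
      then obtain z where z: "x * z \<noteq> z * x" using cent by blast
      define \<sigma> where "\<sigma> = T x - x"
      have \<sigma>l: "\<sigma> \<in> line x" unfolding \<sigma>_def using dsub_diff[OF lsub(1)] lineF TF xl by blast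
      have x\<sigma>: "x - \<sigma> = \<delta>" unfolding \<sigma>_def \<delta>_def by simp
      have Tc: "T x * w = w * T x" for w by (rule F_comm[OF TF])
      have xq: "x * x - T x * x = q" using q by simp
      have qc: "q * w = w * q" for w by (rule F_comm[OF q(1)])
      \<comment> \<open>Left multiplication by \<open>x\<close> is a root of
        \<open>X^2 - T x X - q\<close>, which factors into \<open>X\<close> minus right
        multiplication by \<open>x\<close> and \<open>X\<close> minus right multiplication by
        \<open>\<sigma>\<close>. So \<open>x w - w x\<close> is killed by the second factor and, in
        \<open>plus\<close>, \<open>x w - w \<sigma>\<close> by the first.\<close>
      have minus: "x * (x * w - w * x) = (x * w - w * x) * \<sigma>" for w
      proof -
        have "x * (x * w - w * x) - (x * w - w * x) * \<sigma> = (x * x - T x * x) * w - w * (x * x - T x * x)"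
          unfolding \<sigma>_def using Tc[of "x * w"] Tc[of "w * x"] Tc[of w] Tc[of x]
          by (simp add: algebra_simps)
        then show ?thesis unfolding xq using qc[of w] by simp
      qed
      have plus: "x * (x * w - w * \<sigma>) = (x * w - w * \<sigma>) * x" for w
      proof -
        have "x * (x * w - w * \<sigma>) - (x * w - w * \<sigma>) * x = (x * x - T x * x) * w - w * (x * x - T x * x)"
          unfolding \<sigma>_def using Tc[of "x * w"] Tc[of "w * x"] Tc[of w] Tc[of x]
          by (simp add: algebra_simps)
        then show ?thesis unfolding xq using qc[of w] by simp
      qed
      define y0 where "y0 = x * z - z * x"
      have y0: "y0 \<noteq> 0" "x * y0 = y0 * \<sigma>" unfolding y0_def using z minus by simp_all
      have inv0: "inverse y0 * x = \<sigma> * inverse y0"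
        using y0 by (metis (no_types, lifting) mult.assoc mult.left_neutral mult.right_neutral left_inverse right_inverse)
      have rn: "ddim (line x) = ddim ((\<lambda>y. y * y0) ` line x) + ddim {v \<in> line x. v * y0 = 0}"
        "dsub ((\<lambda>y. y * y0) ` line x)"
        using ring_rank_nullity(1,2)[OF lsub(1), of "\<lambda>y. y * y0"] by (simp_all add: distrib_right mult.assoc)
      have "{v \<in> line x. v * y0 = 0} = {0}" using lsub(1) y0 unfolding dsub_iff by auto
      then have d2: "ddim ((\<lambda>y. y * y0) ` line x) = 2" using rn(1) lsub(2) ddim_zero by simp
      have anti: "y \<in> (\<lambda>y. y * y0) ` line x \<longleftrightarrow> x * y = y * \<sigma>" for y
      proof
        assume "y \<in> (\<lambda>y. y * y0) ` line x"
        then obtain w where w: "x * w = w * x" "y = w * y0" using cent by blast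
        then show "x * y = y * \<sigma>" using y0(2) by (metis mult.assoc)
      next
        assume y: "x * y = y * \<sigma>"
        have "x * (y * inverse y0) = (y * inverse y0) * x" using y inv0 by (metis mult.assoc)
        then have "y * inverse y0 \<in> line x" using cent by blast
        moreover have "y = y * inverse y0 * y0" using y0 by (simp add: mult.assoc)
        ultimately show "y \<in> (\<lambda>y. y * y0) ` line x" by blast
      qed
      have zero: "y = 0" if "x * y = y * x" "x * y = y * \<sigma>" for y
      proof -
        have "y * \<delta> = y * x - y * \<sigma>" unfolding x\<sigma>[symmetric] by (rule right_diff_distrib)
        then have "y * \<delta> = 0" using that by (metis diff_self)
        then show ?thesis using \<delta>0 by simp
      qed
      have "y = 0" if "y \<in> line x" "y \<in> (\<lambda>y. y * y0) ` line x" for y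
        using that anti[of y] cent[of y] zero[of y] by metis
      moreover have "0 \<in> line x" "0 \<in> (\<lambda>y. y * y0) ` line x" using lsub(1) rn(2) unfolding dsub_iff by blast+
      ultimately have int: "line x \<inter> (\<lambda>y. y * y0) ` line x = {0}" by blast
      have all: "{s + t | s t. s \<in> line x \<and> t \<in> (\<lambda>y. y * y0) ` line x} = UNIV"
      proof -
        \<comment> \<open>As \<open>x - \<sigma> = \<delta>\<close>, the elements
          \<open>x w - w \<sigma>\<close> and \<open>x w - w x\<close> differ by
          \<open>w * \<delta>\<close>; dividing by \<open>\<delta>\<close> splits \<open>w\<close>
          into a part commuting with \<open>x\<close> and a part that carries \<open>x\<close> to
          \<open>\<sigma>\<close>.\<close>
        have "\<exists>s t. s \<in> line x \<and> t \<in> (\<lambda>y. y * y0) ` line x \<and> w = s + t" for w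
        proof (intro exI conjI)
          have ec: "x * \<epsilon> = \<epsilon> * x" "\<sigma> * \<epsilon> = \<epsilon> * \<sigma>" using line_commutes xl \<epsilon>l \<sigma>l by blast+
          show "(x * w - w * \<sigma>) * \<epsilon> \<in> line x" using lmul[OF _ \<epsilon>l] cent plus by blast
          have "x * ((x * w - w * x) * \<epsilon>) = (x * w - w * x) * \<sigma> * \<epsilon>"
            unfolding minus[symmetric] by (rule mult.assoc[symmetric])
          also have "\<dots> = (x * w - w * x) * \<epsilon> * \<sigma>" unfolding mult.assoc ec(2) ..
          finally have "x * ((x * w - w * x) * \<epsilon>) = (x * w - w * x) * \<epsilon> * \<sigma>" .
          then have "- ((x * w - w * x) * \<epsilon>) \<in> (\<lambda>y. y * y0) ` line x"
            unfolding anti by (simp add: mult.assoc)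
          then show "- ((x * w - w * x) * \<epsilon>) \<in> (\<lambda>y. y * y0) ` line x" .
          have "(x * w - w * \<sigma>) - (x * w - w * x) = w * \<delta>" by (simp add: right_diff_distrib flip: x\<sigma>)
          then have "((x * w - w * \<sigma>) - (x * w - w * x)) * \<epsilon> = w" using \<epsilon> by (simp add: mult.assoc)
          then show "w = (x * w - w * \<sigma>) * \<epsilon> + - ((x * w - w * x) * \<epsilon>)"
            by (simp add: left_diff_distrib)
        qed
        then have "w \<in> {s + t | s t. s \<in> line x \<and> t \<in> (\<lambda>y. y * y0) ` line x}" for w
          unfolding mem_Collect_eq by metis
        then show ?thesis by (intro UNIV_eq_I[symmetric])
      qed
      have deg4: "degF = 4"
        using ddim_direct_sum(2)[OF lsub(1) rn(2) int] d2 lsub(2) ddim_UNIV unfolding all by simp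
      have cF: "c \<in> F" if c: "\<forall>w. c * w = w * c" for c
      proof -
        have "c \<in> line x" using cent c by simp
        then obtain a b where ab: "a \<in> F" "b \<in> F" "c = a + b * x" unfolding line_def by blast
        have "b = 0"
        proof (rule ccontr)
          assume b: "b \<noteq> 0"
          have "(b * x) * z = z * (b * x)"
            using c[rule_format, of z] F_comm[OF ab(1), of z] unfolding ab(3) by (simp add: distrib_left distrib_right)
          then have "b * (x * z) = b * (z * x)" using F_comm[OF ab(2), of z] by (metis mult.assoc)
          then show False using b z by simp
        qed
        then show ?thesis using ab by simp
      qed
      have "ring_center = F" unfolding ring_center_def using cF F_comm by auto
      moreover have "I = {0} \<or> I = UNIV" if I: "ideal I (class_ring :: 'a ring)" for I
      proof (cases "I = {0}")
        case False
        have "0 \<in> I" using additive_subgroup.zero_closed[OF ideal.axioms(1)[OF I]] by simp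
        then obtain a where a: "a \<in> I" "a \<noteq> 0" using False by blast
        have "inverse a * a \<in> I" using ideal.I_l_closed[OF I a(1), of "inverse a"] by simp
        then show ?thesis using ideal.one_imp_carrier[OF I] a by simp
      qed simp
      ultimately show ?thesis unfolding quadratic_type_def quaternion_algebra_def using deg4 by blast
    qed
  qed
qed

text \<open>The plane \<open>D = F + F x\<close> is commutative and \<open>a + b x\<close> has trace
  \<open>2 a + b t\<close>, where \<open>x * x = p + t x\<close>. Separable and inseparable planes
  are treated alike by \<open>quadratic_typeI\<close>; the latter fall under the clause on
  squares.\<close>

lemma quadratic_type_degree_two:
  assumes "degF = 2"
  shows "quadratic_type F"
proof -
  have "F \<noteq> UNIV" using degree_eq_one assms by auto
  then obtain x where x: "x \<notin> F" by blast
  have l: "line x = UNIV"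
    using ddim_eq[OF line_sub(1)[OF x] dsub_UNIV] line_sub(2)[OF x] assms ddim_UNIV by simp
  have "\<forall>y. \<exists>a b. a \<in> F \<and> b \<in> F \<and> y = a + b * x" using l unfolding line_def by blast
  then obtain A B where AB: "\<And>y. A y \<in> F" "\<And>y. B y \<in> F" "\<And>y. y = A y + B y * x" by metis
  have add: "A (y + z) = A y + A z" "B (y + z) = B y + B z" for y z
  proof -
    have "A (y + z) + B (y + z) * x = (A y + A z) + (B y + B z) * x"
      using AB(3)[of y] AB(3)[of z] AB(3)[of "y + z"]
      by (simp add: distrib_right add_ac)
    then show "A (y + z) = A y + A z" "B (y + z) = B y + B z"
      using line_unique[OF x AB(1,2)] AB F_add by metis+
  qed
  define t p where "t = B (x * x)" and "p = A (x * x)"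
  have xx: "x * x = p + t * x" and tp: "t \<in> F" "p \<in> F" using AB unfolding t_def p_def by blast+
  show ?thesis
  proof (rule quadratic_typeI[of "\<lambda>y. A y + A y + B y * t"])
    fix y z
    show "A (y + z) + A (y + z) + B (y + z) * t = A y + A y + B y * t + (A z + A z + B z * t)"
      by (simp add: add algebra_simps)
    show "A y + A y + B y * t \<in> F" using AB tp by (intro F_add F_mult)
    define a b where "a = A y" and "b = B y"
    have ab: "a \<in> F" "b \<in> F" "y = a + b * x" using AB unfolding a_def b_def by auto
    have "y * y - (a + a + b * t) * y = - (a * a) + b * b * p - b * t * a"
    proof -
      have "b * x * (b * x) = b * b * (x * x)" "b * x * a = a * b * x"
        using F_comm[OF ab(2), of x] F_comm[OF ab(1), of "b * x"] by (metis mult.assoc)+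
      moreover have "b * t * b = b * b * t" using F_comm[OF ab(2), of t] by (metis mult.assoc)
      ultimately show ?thesis unfolding ab(3)
        by (simp add: distrib_left distrib_right xx mult.assoc[symmetric])
    qed
    also have "\<dots> \<in> F" using ab tp by (intro F_add F_mult F_diff F_uminus)
    finally show "y * y - (A y + A y + B y * t) * y \<in> F" unfolding a_def b_def .
  qed
qed

section \<open>Isotropic maps and eigenvalues\<close>

text \<open>The map \<open>s\<close> below plays the role of a conjugation: \<open>s e * e\<close> always lies in \<open>F\<close>.\<close>

lemma isotropic_map_zero:
  fixes r :: "'a \<Rightarrow> 'a"
  assumes H: "hyper H" and H': "hyper H'"
    and r_add: "\<And>x y. r (x + y) = r x + r y" and r_scale: "\<And>k x. k \<in> F \<Longrightarrow> r (k * x) = k * r x"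
    and iso: "\<And>k e. k \<in> H' \<Longrightarrow> r (k * e) * e \<in> H"
    and nq: "\<not> quadratic_type F"
  shows "r x = 0"
proof (rule ccontr)
  assume rx: "r x \<noteq> 0"
  define q where "q e = coef H (r e * e)" for e
  define s where "s e = q e * inverse e" for e
  have qF: "q e \<in> F" for e unfolding q_def by (rule coef(1)[OF H])
  have r0: "r 0 = 0" using r_add[of 0 0] by simp
  have coef0: "coef H 0 = 0" "coef H' 0 = 0" using coef_F[OF H F_zero] coef_F[OF H' F_zero] by auto
  have one: "coef H 1 = 1" "coef H' 1 = 1" using coef_F[OF H F_one] coef_F[OF H' F_one] by auto
  \<comment> \<open>The hypothesis puts \<open>r c * e\<close> into \<open>H\<close> when
    \<open>c\<close> is in \<open>H' e\<close>, so the form \<open>coef H (r c * e)\<close> sees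
    only the \<open>F\<close>-part of \<open>c * inverse e\<close>, and \<open>s e\<close>
    represents it. By \<open>nondeg\<close> the representing element is unique, whence
    \<open>s\<close> is linear although its definition divides by \<open>e\<close>.\<close>
  have bil: "coef H' (c * s e) = coef H (r c * e)" for c e
  proof (cases "e = 0")
    case True
    then show ?thesis by (simp add: s_def q_def r0 coef0)
  next
    case False
    define u l where "u = c * inverse e" and "l = coef H' u"
    have l: "l \<in> F" "u - l \<in> H'" unfolding l_def by (rule coef[OF H'])+
    have ue: "u * e = c" unfolding u_def using False by (simp add: mult.assoc)
    have "r ((u - l) * e) = r c - l * r e"
      using r_add[of "(u - l) * e" "l * e"] r_scale[OF l(1), of e] ue by (simp add: left_diff_distrib)
    then have "r c * e - l * (r e * e) \<in> H" using iso[OF l(2), of e] by (simp add: left_diff_distrib mult.assoc)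
    then have "coef H (r c * e - l * (r e * e)) = 0" using coef_zero_iff[OF H] by blast
    then have "coef H (r c * e) = l * q e"
      unfolding q_def coef_diff[OF H] coef_scale[OF H l(1)] by simp
    moreover have "coef H' (c * s e) = q e * l"
    proof -
      have "c * s e = q e * u" unfolding s_def u_def using F_comm[OF qF[of e], of c] by (metis mult.assoc)
      then show ?thesis using coef_scale[OF H' qF[of e]] by (simp add: l_def)
    qed
    ultimately show ?thesis using F_comm[OF l(1)] by simp
  qed
  have nondeg: "w = 0" if "\<And>c. coef H' (c * w) = 0" for w
    using that[of "inverse w"] one by (cases "w = 0") simp_all
  have s_add: "s (e + e') = s e + s e'" for e e'
  proof -
    have "coef H' (c * (s (e + e') - s e - s e')) = 0" for c
    proof -
      have "c * (s (e + e') - s e - s e') = c * s (e + e') - c * s e - c * s e'"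
        by (simp add: right_diff_distrib)
      then have "coef H' (c * (s (e + e') - s e - s e')) =
          coef H (r c * (e + e')) - coef H (r c * e) - coef H (r c * e')"
        by (simp only: coef_diff[OF H'] bil)
      then show ?thesis by (simp add: distrib_left coef_add[OF H])
    qed
    then have "s (e + e') - s e - s e' = 0" by (rule nondeg)
    then show ?thesis by (simp add: algebra_simps)
  qed
  have s_scale: "s (k * e) = k * s e" if k: "k \<in> F" for k e
  proof -
    have "coef H' (c * (s (k * e) - k * s e)) = 0" for c
    proof -
      have "c * (s (k * e) - k * s e) = c * s (k * e) - k * (c * s e)"
        using F_comm[OF k, of c] by (simp add: right_diff_distrib) (metis mult.assoc)
      then have "coef H' (c * (s (k * e) - k * s e)) = coef H (r c * (k * e)) - k * coef H (r c * e)"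
        by (simp only: coef_diff[OF H'] coef_scale[OF H' k] bil)
      moreover have "r c * (k * e) = k * (r c * e)" using F_comm[OF k, of "r c"] by (metis mult.assoc)
      ultimately show ?thesis using coef_scale[OF H k] by simp
    qed
    then have "s (k * e) - k * s e = 0" by (rule nondeg)
    then show ?thesis by simp
  qed
  have q0: "q 0 = 0" unfolding q_def by (simp add: coef0)
  have sq: "s e * e = q e" for e unfolding s_def using q0 by (cases "e = 0") (simp_all add: mult.assoc)
  obtain e' where e': "q e' \<noteq> 0"
  proof -
    have "coef H' (x * s (inverse (r x))) = 1" unfolding bil using rx one by simp
    then have "s (inverse (r x)) \<noteq> 0" using coef0 by auto
    then show ?thesis using that[of "inverse (r x)"] unfolding s_def by auto
  qed
  \<comment> \<open>If \<open>s e = 0\<close>, then \<open>s\<close> has the same value at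
    \<open>e'\<close> and \<open>e' + e\<close>. Comparing the values of \<open>q\<close> makes
    \<open>s e' * e\<close> a scalar, so \<open>e\<close> is a scalar multiple of \<open>e'\<close>;
    homogeneity and \<open>s e' \<noteq> 0\<close> force the factor to vanish.\<close>
  have inj: "e = 0" if "s e = 0" for e
  proof -
    define l m where "l = inverse (q e')" and "m = q (e' + e) - q e'"
    have lm: "l \<in> F" "m \<in> F" unfolding l_def m_def using qF by (auto intro: F_inverse F_diff)
    have "q e' + s e' * e = q (e' + e)"
      using sq[of "e' + e"] sq[of e'] that by (simp add: s_add distrib_left)
    then have "s e' * e = m" unfolding m_def by (metis add_diff_cancel_left')
    then have "q e' * (inverse e' * e) = m" unfolding s_def by (simp add: mult.assoc)
    then have "l * (q e' * (inverse e' * e)) = l * m" by simp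
    then have "inverse e' * e = l * m" unfolding l_def using e' by (simp flip: mult.assoc)
    moreover have "e' \<noteq> 0" using e' q0 by auto
    ultimately have "e = e' * (l * m)" by (metis mult.assoc mult_1_left right_inverse)
    then have ee: "e = l * m * e'" using F_comm[OF F_mult[OF lm], of e'] by simp
    then have "l * m * s e' = 0" using s_scale[OF F_mult[OF lm], of e'] that by simp
    moreover have "s e' \<noteq> 0" using sq[of e'] e' by auto
    ultimately show "e = 0" using ee by simp
  qed
  have s1: "s 1 \<noteq> 0" "s 1 \<in> F" using inj[of 1] qF[of 1] unfolding s_def by auto
  define k where "k = inverse (s 1)"
  have k: "k \<in> F" "k * s 1 = 1" unfolding k_def using s1 F_inverse by auto
  have "quadratic_type F"
  \<comment> \<open>With \<open>k = inverse (s 1)\<close>, the element \<open>k * s x\<close> is the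
    conjugate of \<open>x\<close> and \<open>k * q x\<close> its norm. That the trace
    \<open>k * s x + x\<close> lies in \<open>F\<close> is the polarization of \<open>q\<close> at
    \<open>x\<close> and 1.\<close>
  proof (rule quadratic_typeI[of "\<lambda>x. k * s x + x"])
    fix x y
    show "k * s (x + y) + (x + y) = k * s x + x + (k * s y + y)"
      by (simp add: s_add distrib_left algebra_simps)
    have "s x + s 1 * x = q (x + 1) - q x - q 1"
      unfolding sq[symmetric] by (simp add: s_add algebra_simps)
    then have "s x + s 1 * x \<in> F" using qF F_diff by simp
    then have "k * (s x + s 1 * x) \<in> F" using k F_mult by blast
    then show "k * s x + x \<in> F" using k(2) by (simp add: distrib_left flip: mult.assoc)
    have "x * x - (k * s x + x) * x = - (k * q x)"
      unfolding sq[symmetric] by (simp add: algebra_simps)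
    then show "x * x - (k * s x + x) * x \<in> F" using k qF F_mult F_uminus by simp
  qed
  then show False using nq by simp
qed

lemma msub_closed:
  assumes "msub r c S"
  shows "\<And>v. v \<in> S \<Longrightarrow> v \<in> carrier_mat r c" "0\<^sub>m r c \<in> S" "\<And>v w. v \<in> S \<Longrightarrow> w \<in> S \<Longrightarrow> v + w \<in> S"
    "\<And>k v. k \<in> F \<Longrightarrow> v \<in> S \<Longrightarrow> k \<cdot>\<^sub>m v \<in> S"
  using assms unfolding msub_iff by blast+

text \<open>Eigenvectors for distinct eigenvalues are independent, for a partially defined operator
  given by its graph \<open>R\<close>.\<close>

lemma card_eigenvalues_le:
  assumes U: "msub r c U" and E: "finite E" "E \<subseteq> F"
    and add: "\<And>x x' y y'. R x x' \<Longrightarrow> R y y' \<Longrightarrow> R (x + y) (x' + y')"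
    and scale: "\<And>k x x'. k \<in> F \<Longrightarrow> R x x' \<Longrightarrow> R (k \<cdot>\<^sub>m x) (k \<cdot>\<^sub>m x')"
    and zero: "\<And>x'. R (0\<^sub>m r c) x' \<Longrightarrow> x' \<in> U \<Longrightarrow> x' = 0\<^sub>m r c"
    and eigen: "\<And>\<theta>. \<theta> \<in> E \<Longrightarrow> \<exists>w\<in>U. w \<noteq> 0\<^sub>m r c \<and> R w (\<theta> \<cdot>\<^sub>m w)"
  shows "card E \<le> mdim r c U"
proof -
  note Uc = msub_closed[OF U]
  \<comment> \<open>\<open>Z\<close> is spanned by one eigenvector for each element of
    \<open>E\<close>. The induction needs that \<open>R\<close> relates its vectors to vectors in it
    and that it contains no eigenvectors for other scalars.\<close>
  have "\<exists>Z. msub r c Z \<and> Z \<subseteq> U \<and> mdim r c Z = card E \<and> (\<forall>z\<in>Z. \<exists>z'\<in>Z. R z z') \<and>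
      (\<forall>\<theta>\<in>F - E. \<forall>z\<in>Z. R z (\<theta> \<cdot>\<^sub>m z) \<longrightarrow> z = 0\<^sub>m r c)" if "R (0\<^sub>m r c) (0\<^sub>m r c)"
    using E eigen
  proof (induction E rule: finite_induct)
    case empty
    show ?case using msub_zero mdim_zero Uc(2) that by (intro exI[of _ "{0\<^sub>m r c}"]) auto
  next
    case (insert s E)
    then obtain Z where Z: "msub r c Z" "Z \<subseteq> U" "mdim r c Z = card E" "\<And>z. z \<in> Z \<Longrightarrow> \<exists>z'\<in>Z. R z z'"
      "\<And>\<theta> z. \<theta> \<in> F - E \<Longrightarrow> z \<in> Z \<Longrightarrow> R z (\<theta> \<cdot>\<^sub>m z) \<Longrightarrow> z = 0\<^sub>m r c"
      by (metis insertCI insert_subset)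
    note Zc = msub_closed[OF Z(1)]
    obtain w where w: "w \<in> U" "w \<noteq> 0\<^sub>m r c" "R w (s \<cdot>\<^sub>m w)" using insert.prems by blast
    have sF: "s \<in> F" using insert.prems by blast
    have wc: "w \<in> carrier_mat r c" using w Uc by blast
    have wZ: "w \<notin> Z" using Z(5)[of s w] w insert sF by blast
    define Z2 where "Z2 = {z + k \<cdot>\<^sub>m w | z k. z \<in> Z \<and> k \<in> F}"
    note Z2 = msub_adjoin[OF Z(1) wc wZ, folded Z2_def]
    show ?case
    proof (intro exI[of _ Z2] conjI ballI impI)
      show "msub r c Z2" by (rule Z2)
      show "mdim r c Z2 = card (insert s E)" using Z2(2) Z(3) insert by simp
      show "Z2 \<subseteq> U" unfolding Z2_def using Z(2) w Uc(3,4) by blast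
    next
      fix v assume "v \<in> Z2"
      then obtain z k where v: "z \<in> Z" "k \<in> F" "v = z + k \<cdot>\<^sub>m w" unfolding Z2_def by blast
      obtain z' where z': "z' \<in> Z" "R z z'" using Z(4) v by blast
      have "R v (z' + k \<cdot>\<^sub>m (s \<cdot>\<^sub>m w))" unfolding v(3) using add[OF z'(2) scale[OF v(2) w(3)]] .
      also have "k \<cdot>\<^sub>m (s \<cdot>\<^sub>m w) = (k * s) \<cdot>\<^sub>m w" by (intro eq_matI) (auto simp: mult.assoc)
      finally show "\<exists>z'\<in>Z2. R v z'" unfolding Z2_def using z' v sF F_mult by blast
    next
      fix \<theta> v assume \<theta>: "\<theta> \<in> F - insert s E" and "v \<in> Z2" and Rv: "R v (\<theta> \<cdot>\<^sub>m v)"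
      then obtain z k where v: "z \<in> Z" "k \<in> F" "v = z + k \<cdot>\<^sub>m w" unfolding Z2_def by blast
      obtain z' where z': "z' \<in> Z" "R z z'" using Z(4) v by blast
      have zc: "z \<in> carrier_mat r c" "z' \<in> carrier_mat r c" using v z' Zc by auto
      have m1: "- 1 \<in> F" using F_uminus[OF F_one] .
      \<comment> \<open>The difference of two \<open>R\<close>-images of \<open>v\<close>, hence an
        image of 0, which \<open>zero\<close> makes 0. Expanded, this reads
        \<open>k (s - \<theta>) w = \<theta> z - z'\<close>, and for \<open>k \<noteq> 0\<close> it
        would put \<open>w\<close> into \<open>Z\<close>.\<close>
      define d where "d = (z' + k \<cdot>\<^sub>m (s \<cdot>\<^sub>m w)) + (- 1) \<cdot>\<^sub>m (\<theta> \<cdot>\<^sub>m v)"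
      have "R (v + (- 1) \<cdot>\<^sub>m v) d" unfolding d_def
        using add[OF add[OF z'(2) scale[OF v(2) w(3)]] scale[OF m1 Rv]] unfolding v(3) .
      moreover have "v + (- 1) \<cdot>\<^sub>m v = 0\<^sub>m r c" unfolding v(3) using zc wc by (intro eq_matI) auto
      moreover have "d \<in> U" unfolding d_def v(3)
        using v z' Z(2) w(1) sF \<theta> m1 by (intro Uc) auto
      ultimately have d0: "d = 0\<^sub>m r c" using zero by simp
      have k0: "k = 0"
      proof (rule ccontr)
        assume k0: "k \<noteq> 0"
        define a where "a = inverse (k * (s - \<theta>))"
        have aF: "a \<in> F" unfolding a_def using v sF \<theta> by (auto intro!: F_inverse F_mult F_diff)
        have "s - \<theta> \<noteq> 0" using \<theta> by auto
        then have a: "a * (k * (s - \<theta>)) = 1" unfolding a_def using k0 by (intro left_inverse) simp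
        have "w $$ (i, j) = (a \<cdot>\<^sub>m (\<theta> \<cdot>\<^sub>m z + (- 1) \<cdot>\<^sub>m z')) $$ (i, j)" if ij: "i < r" "j < c" for i j
        proof -
          have "d $$ (i, j) = 0" using d0 ij by simp
          then have "k * (s - \<theta>) * w $$ (i, j) = \<theta> * z $$ (i, j) - z' $$ (i, j)"
            unfolding d_def v(3) using zc wc ij F_comm[of \<theta> k] \<theta>
            by (simp add: algebra_simps) (metis mult.assoc)
          then have "a * (k * (s - \<theta>) * w $$ (i, j)) = a * (\<theta> * z $$ (i, j) - z' $$ (i, j))" by simp
          then show ?thesis using a zc ij by (simp flip: mult.assoc)
        qed
        then have "w = a \<cdot>\<^sub>m (\<theta> \<cdot>\<^sub>m z + (- 1) \<cdot>\<^sub>m z')" using wc zc by (intro eq_matI) auto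
        moreover have "a \<cdot>\<^sub>m (\<theta> \<cdot>\<^sub>m z + (- 1) \<cdot>\<^sub>m z') \<in> Z" using aF \<theta> v z' m1 by (intro Zc) auto
        ultimately show False using wZ by simp
      qed
      then have "v = z" unfolding v(3) using zc wc by (intro eq_matI) auto
      then show "v = 0\<^sub>m r c" using Z(5)[of \<theta> z] \<theta> v(1) Rv by blast
    qed
  qed
  moreover have "E \<noteq> {} \<Longrightarrow> R (0\<^sub>m r c) (0\<^sub>m r c)"
  proof -
    assume "E \<noteq> {}"
    then obtain \<theta> w where w: "w \<in> U" "R w (\<theta> \<cdot>\<^sub>m w)" using eigen by blast
    have "R (0 \<cdot>\<^sub>m w) (0 \<cdot>\<^sub>m (\<theta> \<cdot>\<^sub>m w))" by (rule scale[OF F_zero w(2)])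
    moreover have "0 \<cdot>\<^sub>m w = 0\<^sub>m r c" "0 \<cdot>\<^sub>m (\<theta> \<cdot>\<^sub>m w) = 0\<^sub>m r c" using Uc(1)[OF w(1)] by (auto intro!: eq_matI)
    ultimately show ?thesis by simp
  qed
  ultimately show ?thesis using mdim_mono[OF _ U] by (cases "E = {}") (auto, metis)
qed

end

section \<open>Rank-one matrices in a space of matrices\<close>

text \<open>The expansion of a product entry into a scalar product competes with this rule, hence
  the frequent removal of \<open>index_mult_mat(1)\<close> below.\<close>

lemma outer_index [simp]:
  fixes x :: "'a :: semiring_0 mat"
  assumes "dim_col x = 1" "dim_row v = 1" "i < dim_row x" "j < dim_col v"
  shows "(x * v) $$ (i, j) = x $$ (i, 0) * v $$ (0, j)"
  using assms by (simp add: scalar_prod_def)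

lemma smult_mat_mult:
  fixes v :: "'a :: semiring_0 mat"
  assumes "v \<in> carrier_mat r n" "M \<in> carrier_mat n m"
  shows "(k \<cdot>\<^sub>m v) * M = k \<cdot>\<^sub>m (v * M)"
  using assms by (intro eq_matI) (auto simp: scalar_prod_def sum_distrib_left mult.assoc)

context central_division
begin

lemma mult_smult_F:
  assumes "A \<in> carrier_mat n m" "B \<in> carrier_mat m l" "k \<in> F"
  shows "A * (k \<cdot>\<^sub>m B) = k \<cdot>\<^sub>m (A * B)"
proof -
  have "a * (k * b) = k * (a * b)" for a b using F_comm[OF assms(3), of a] by (metis mult.assoc)
  then show ?thesis using assms by (intro eq_matI) (auto simp: scalar_prod_def sum_distrib_left)
qed

text \<open>The space \<open>L(x)\<close> of the overview. It is only an \<open>F\<close>-space: a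
  factor from \<open>D\<close> in front of \<open>v\<close> ends up in the middle of
  \<open>x * v\<close>.\<close>

definition rank_one_rows :: "nat \<Rightarrow> 'a mat set \<Rightarrow> 'a mat \<Rightarrow> 'a mat set" where
  "rank_one_rows n V x = {v \<in> carrier_mat 1 n. x * v \<in> V}"

lemma msub_rank_one_rows:
  assumes "msub n n V" "x \<in> carrier_mat n 1"
  shows "msub 1 n (rank_one_rows n V x)"
  unfolding msub_iff
proof (intro conjI ballI)
  note V = msub_closed[OF assms(1)]
  show "rank_one_rows n V x \<subseteq> carrier_mat 1 n" unfolding rank_one_rows_def by auto
  have "x * 0\<^sub>m 1 n = 0\<^sub>m n n" using assms(2) by (intro right_mult_zero_mat) auto
  then show "0\<^sub>m 1 n \<in> rank_one_rows n V x" unfolding rank_one_rows_def using V(2) by simp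
next
  note V = msub_closed[OF assms(1)]
  fix v w assume vw: "v \<in> rank_one_rows n V x" "w \<in> rank_one_rows n V x"
  then have "x * (v + w) = x * v + x * w"
    using assms(2) unfolding rank_one_rows_def by (intro mult_add_distrib_mat) auto
  then show "v + w \<in> rank_one_rows n V x" using vw V(3) unfolding rank_one_rows_def by auto
next
  note V = msub_closed[OF assms(1)]
  fix k v assume k: "k \<in> F" "v \<in> rank_one_rows n V x"
  then have "x * (k \<cdot>\<^sub>m v) = k \<cdot>\<^sub>m (x * v)"
    using assms(2) unfolding rank_one_rows_def by (intro mult_smult_F) auto
  then show "k \<cdot>\<^sub>m v \<in> rank_one_rows n V x" using k V(4) unfolding rank_one_rows_def by auto
qed

text \<open>The maps \<open>v \<mapsto> x v\<close> modulo \<open>V\<close> form a space of operators in which \<open>x\<close> has maximal rank, so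
  that every operator of this space maps the kernel of \<open>x\<close> into its range.\<close>

lemma max_rank_kernel_into_range:
  assumes V: "msub n n V" and x: "x \<in> carrier_mat n 1" and y: "y \<in> carrier_mat n 1"
    and min: "\<And>z. z \<in> carrier_mat n 1 \<Longrightarrow> mdim 1 n (rank_one_rows n V x) \<le> mdim 1 n (rank_one_rows n V z)"
    and two: "2 \<le> mdim 1 n (rank_one_rows n V x)"
    and big: "infinite F \<or> n * degF \<le> card F"
    and v0: "v0 \<in> rank_one_rows n V x"
  shows "\<exists>w\<in>carrier_mat 1 n. y * v0 + x * w \<in> V"
proof (rule ccontr)
  assume contra: "\<not> ?thesis"
  note Vc = msub_closed[OF V]
  note carrier_matD[OF x, simp] carrier_matD[OF y, simp]
  let ?L = "rank_one_rows n V x"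
  have L: "msub 1 n ?L" by (rule msub_rank_one_rows[OF V x])
  \<comment> \<open>On the complement \<open>U\<close> of the kernel \<open>?L\<close>, the map
    \<open>u \<mapsto> x u\<close> is injective modulo \<open>V\<close>.\<close>
  obtain U where U: "msub 1 n U" "?L \<inter> U = {0\<^sub>m 1 n}" "mdim 1 n ?L + mdim 1 n U = 1 * n * degF"
    using msub_complement[OF L] by blast
  note Uc = msub_closed[OF U(1)]
  have v0c: "v0 \<in> carrier_mat 1 n" and xv0: "x * v0 \<in> V" using v0 unfolding rank_one_rows_def by auto
  note carrier_matD[OF v0c, simp]
  have v0n: "v0 \<noteq> 0\<^sub>m 1 n"
  proof
    assume "v0 = 0\<^sub>m 1 n"
    then have "y * v0 + x * 0\<^sub>m 1 n = 0\<^sub>m n n" using x y by (auto intro!: eq_matI simp: scalar_prod_def)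
    then show False using contra Vc(2) by (metis zero_carrier_mat)
  qed
  then have v0U: "v0 \<notin> U" using U(2) v0 by auto
  define U' where "U' = {s + k \<cdot>\<^sub>m v0 | s k. s \<in> U \<and> k \<in> F}"
  note U' = msub_adjoin[OF U(1) v0c v0U, folded U'_def]
  \<comment> \<open>Two maps from \<open>U' = U + F v0\<close> to the matrices modulo
    \<open>V\<close> are compared: \<open>A\<close> sends \<open>u + k v0\<close> to
    \<open>x u + k y v0\<close>, and \<open>B\<close> sends it to \<open>y u\<close>. The
    contradiction hypothesis makes \<open>A\<close> injective, and \<open>R\<close> is the graph of
    the inverse of \<open>A\<close> after \<open>B\<close>.\<close>
  define R where "R v w \<longleftrightarrow> (\<exists>u\<in>U. \<exists>k\<in>F. \<exists>u'\<in>U. \<exists>k'\<in>F. v = u + k \<cdot>\<^sub>m v0 \<and> w = u' + k' \<cdot>\<^sub>m v0 \<and>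
      y * u - x * u' - k' \<cdot>\<^sub>m (y * v0) \<in> V)" for v w
  have lift: "y * u - x * u' - k' \<cdot>\<^sub>m (y * v0) =
      mat n n (\<lambda>(i, j). y $$ (i, 0) * u $$ (0, j) - x $$ (i, 0) * u' $$ (0, j) - k' * (y $$ (i, 0) * v0 $$ (0, j)))"
    if "u \<in> U" "u' \<in> U" for u u' k'
  proof -
    note carrier_matD[OF x, simp] carrier_matD[OF y, simp] carrier_matD[OF v0c, simp]
      carrier_matD[OF Uc(1)[OF that(1)], simp] carrier_matD[OF Uc(1)[OF that(2)], simp]
    show ?thesis by (intro eq_matI) (simp_all del: index_mult_mat(1))
  qed
  have zero_of: "k = 0 \<and> u = 0\<^sub>m 1 n" if "u \<in> U" "k \<in> F" "0\<^sub>m 1 n = u + k \<cdot>\<^sub>m v0" for u k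
  proof -
    have uc: "u \<in> carrier_mat 1 n" using that Uc by blast
    have e: "u $$ (0, j) + k * v0 $$ (0, j) = 0" if "j < n" for j
      using arg_cong[OF \<open>0\<^sub>m 1 n = u + k \<cdot>\<^sub>m v0\<close>, of "\<lambda>M. M $$ (0, j)"] uc v0c that by simp
    have "k = 0"
    proof (rule ccontr)
      assume k: "k \<noteq> 0"
      have "v0 $$ (0, j) = (- inverse k) * u $$ (0, j)" if "j < n" for j
      proof -
        have "inverse k * (k * v0 $$ (0, j)) = inverse k * (- u $$ (0, j))"
          using e[OF that] by (metis add.commute eq_neg_iff_add_eq_0)
        then show ?thesis using k by (simp flip: mult.assoc)
      qed
      then have "v0 = (- inverse k) \<cdot>\<^sub>m u" using uc v0c by (intro eq_matI) auto
      moreover have "(- inverse k) \<cdot>\<^sub>m u \<in> U" using that F_uminus F_inverse Uc(4) by blast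
      ultimately show False using v0U by simp
    qed
    then show ?thesis using e uc by (auto intro!: eq_matI)
  qed
  have small: "card E \<le> mdim 1 n U'" if E: "finite E" "E \<subseteq> F" for E
  proof (rule card_eigenvalues_le[OF U'(1) E, of R])
    fix a a' b b' assume "R a a'" "R b b'"
    then obtain u k u' k' s l s' l' where
      a: "u \<in> U" "k \<in> F" "u' \<in> U" "k' \<in> F" "a = u + k \<cdot>\<^sub>m v0" "a' = u' + k' \<cdot>\<^sub>m v0"
        "y * u - x * u' - k' \<cdot>\<^sub>m (y * v0) \<in> V" and
      b: "s \<in> U" "l \<in> F" "s' \<in> U" "l' \<in> F" "b = s + l \<cdot>\<^sub>m v0" "b' = s' + l' \<cdot>\<^sub>m v0"
        "y * s - x * s' - l' \<cdot>\<^sub>m (y * v0) \<in> V"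
      unfolding R_def by blast
    have c: "u \<in> carrier_mat 1 n" "u' \<in> carrier_mat 1 n" "s \<in> carrier_mat 1 n" "s' \<in> carrier_mat 1 n"
      using a b Uc(1) by auto
    have us: "u + s \<in> U" "u' + s' \<in> U" using a b Uc(3) by auto
    have "y * (u + s) - x * (u' + s') - (k' + l') \<cdot>\<^sub>m (y * v0) =
        (y * u - x * u' - k' \<cdot>\<^sub>m (y * v0)) + (y * s - x * s' - l' \<cdot>\<^sub>m (y * v0))"
      unfolding lift[OF a(1,3)] lift[OF b(1,3)] lift[OF us] using c
      by (intro eq_matI) (auto simp: algebra_simps)
    then have "y * (u + s) - x * (u' + s') - (k' + l') \<cdot>\<^sub>m (y * v0) \<in> V" using Vc(3)[OF a(7) b(7)] by simp
    moreover have "a + b = (u + s) + (k + l) \<cdot>\<^sub>m v0" "a' + b' = (u' + s') + (k' + l') \<cdot>\<^sub>m v0"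
      unfolding a(5,6) b(5,6) using c v0c by (auto intro!: eq_matI simp: algebra_simps)
    ultimately show "R (a + b) (a' + b')" unfolding R_def using us a b F_add by metis
  next
    fix c a a' assume cF: "c \<in> F" and "R a a'"
    then obtain u k u' k' where
      a: "u \<in> U" "k \<in> F" "u' \<in> U" "k' \<in> F" "a = u + k \<cdot>\<^sub>m v0" "a' = u' + k' \<cdot>\<^sub>m v0"
        "y * u - x * u' - k' \<cdot>\<^sub>m (y * v0) \<in> V"
      unfolding R_def by blast
    have uc: "u \<in> carrier_mat 1 n" "u' \<in> carrier_mat 1 n" using a Uc(1) by auto
    have us: "c \<cdot>\<^sub>m u \<in> U" "c \<cdot>\<^sub>m u' \<in> U" using a cF Uc(4) by auto
    have pull: "p * (c * q) = c * (p * q)" for p q using F_comm[OF cF, of p] by (metis mult.assoc)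
    have "y * (c \<cdot>\<^sub>m u) - x * (c \<cdot>\<^sub>m u') - (c * k') \<cdot>\<^sub>m (y * v0) = c \<cdot>\<^sub>m (y * u - x * u' - k' \<cdot>\<^sub>m (y * v0))"
      unfolding lift[OF a(1,3)] lift[OF us] using uc
      by (intro eq_matI) (auto simp: right_diff_distrib pull mult.assoc)
    then have "y * (c \<cdot>\<^sub>m u) - x * (c \<cdot>\<^sub>m u') - (c * k') \<cdot>\<^sub>m (y * v0) \<in> V" using Vc(4)[OF cF a(7)] by simp
    moreover have "c \<cdot>\<^sub>m a = c \<cdot>\<^sub>m u + (c * k) \<cdot>\<^sub>m v0" "c \<cdot>\<^sub>m a' = c \<cdot>\<^sub>m u' + (c * k') \<cdot>\<^sub>m v0"
      unfolding a(5,6) using uc v0c by (auto intro!: eq_matI simp: distrib_left mult.assoc)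
    ultimately show "R (c \<cdot>\<^sub>m a) (c \<cdot>\<^sub>m a')" unfolding R_def using us a cF F_mult by metis
  next
    fix a' assume "R (0\<^sub>m 1 n) a'"
    then obtain u k u' k' where
      a: "u \<in> U" "k \<in> F" "u' \<in> U" "k' \<in> F" "0\<^sub>m 1 n = u + k \<cdot>\<^sub>m v0" "a' = u' + k' \<cdot>\<^sub>m v0"
        "y * u - x * u' - k' \<cdot>\<^sub>m (y * v0) \<in> V"
      unfolding R_def by blast
    have uc: "u' \<in> carrier_mat 1 n" using a Uc(1) by auto
    have u0: "u = 0\<^sub>m 1 n" using zero_of[OF a(1,2,5)] by blast
    \<comment> \<open>A nonzero \<open>k'\<close> could be divided out and would give
      \<open>y v0 + x w\<close> in \<open>V\<close> for
      \<open>w = inverse k' \<cdot>\<^sub>m u'\<close>, the excluded situation.\<close>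
    have k'0: "k' = 0"
    proof (rule ccontr)
      assume k': "k' \<noteq> 0"
      define c where "c = - inverse k'"
      have c: "c \<in> F" "c * k' = - 1" unfolding c_def using a k' F_uminus F_inverse by auto
      have pull: "p * (inverse k' * q) = inverse k' * (p * q)" for p q
        using F_comm[OF F_inverse[OF a(4)], of p] by (metis mult.assoc)
      have ck: "c * (0 - p - k' * q) = inverse k' * p + q" for p q
        unfolding c_def using k' by (simp add: right_diff_distrib flip: mult.assoc)
      have "y * v0 + x * (inverse k' \<cdot>\<^sub>m u') = c \<cdot>\<^sub>m (y * u - x * u' - k' \<cdot>\<^sub>m (y * v0))"
        unfolding lift[OF a(1,3)] u0 using carrier_matD[OF uc]
        by (intro eq_matI) (simp_all del: index_mult_mat(1) diff_0 add: pull ck add.commute)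
      then have "y * v0 + x * (inverse k' \<cdot>\<^sub>m u') \<in> V" using Vc(4)[OF c(1) a(7)] by simp
      then show False using contra uc by (metis smult_carrier_mat)
    qed
    have "(- 1) \<cdot>\<^sub>m (y * u - x * u' - k' \<cdot>\<^sub>m (y * v0)) = x * u'"
      unfolding lift[OF a(1,3)] u0 k'0 using uc x y v0c
      by (intro eq_matI) (auto simp del: index_mult_mat(1))
    then have "x * u' \<in> V" using Vc(4)[OF F_uminus[OF F_one] a(7)] by simp
    then have "u' \<in> ?L" unfolding rank_one_rows_def using uc by simp
    then have "u' = 0\<^sub>m 1 n" using a U(2) by blast
    then show "a' = 0\<^sub>m 1 n" unfolding a(6) k'0 using v0c by (auto intro!: eq_matI)
  next
    fix \<theta> assume "\<theta> \<in> E"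
    then have \<theta>: "\<theta> \<in> F" using E by blast
    show "\<exists>w\<in>U'. w \<noteq> 0\<^sub>m 1 n \<and> R w (\<theta> \<cdot>\<^sub>m w)"
    \<comment> \<open>For the eigenvalue 0, \<open>v0\<close> will do, since \<open>B\<close> kills
      it. Otherwise let \<open>t = - inverse \<theta>\<close>: by minimality at \<open>x\<close>,
      the space \<open>L(x + t y)\<close> is too large to avoid \<open>U'\<close>, and a common
      vector \<open>u + k v0\<close> yields the eigenvector \<open>u + t k v0\<close>, because
      \<open>x v0\<close> is in \<open>V\<close>.\<close>
    proof (cases "\<theta> = 0")
      case True
      have "v0 = 0\<^sub>m 1 n + 1 \<cdot>\<^sub>m v0" "0 \<cdot>\<^sub>m v0 = 0\<^sub>m 1 n + 0 \<cdot>\<^sub>m v0" using v0c by (auto intro!: eq_matI)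
      moreover have "y * 0\<^sub>m 1 n - x * 0\<^sub>m 1 n - 0 \<cdot>\<^sub>m (y * v0) \<in> V"
      proof -
        have "y * 0\<^sub>m 1 n - x * 0\<^sub>m 1 n - 0 \<cdot>\<^sub>m (y * v0) = 0\<^sub>m n n"
          unfolding lift[OF Uc(2) Uc(2)] by (intro eq_matI) auto
        then show ?thesis using Vc(2) by simp
      qed
      ultimately have "v0 \<in> U'" "R v0 (\<theta> \<cdot>\<^sub>m v0)"
        unfolding U'_def R_def True using Uc(2) F_zero F_one by blast+
      then show ?thesis using v0n by blast
    next
      case False
      define t where "t = - inverse \<theta>"
      have t: "t \<in> F" "t * \<theta> = - 1" "\<theta> * t = - 1" unfolding t_def using \<theta> False F_uminus F_inverse by auto
      have t0: "t \<noteq> 0" using t by auto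
      let ?z = "x + t \<cdot>\<^sub>m y"
      have z: "?z \<in> carrier_mat n 1" using x y by auto
      have "mdim 1 n (rank_one_rows n V ?z) + mdim 1 n U' > 1 * n * degF"
        using min[OF z] U(3) U'(2) by linarith
      then have "rank_one_rows n V ?z \<inter> U' \<noteq> {0\<^sub>m 1 n}"
        using mdim_disjoint_le[OF msub_rank_one_rows[OF V z] U'(1)] by auto
      moreover have "0\<^sub>m 1 n \<in> rank_one_rows n V ?z \<inter> U'"
        using msub_closed(2)[OF msub_rank_one_rows[OF V z]] msub_closed(2)[OF U'(1)] by blast
      ultimately obtain w where w: "w \<in> U'" "?z * w \<in> V" "w \<noteq> 0\<^sub>m 1 n"
        unfolding rank_one_rows_def by blast
      then obtain u k where uk: "u \<in> U" "k \<in> F" "w = u + k \<cdot>\<^sub>m v0" unfolding U'_def by blast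
      have uc: "u \<in> carrier_mat 1 n" using uk Uc by blast
      define w' where "w' = u + (t * k) \<cdot>\<^sub>m v0"
      have "w' \<in> U'" unfolding w'_def U'_def using uk t F_mult by blast
      moreover have "w' \<noteq> 0\<^sub>m 1 n"
      proof
        assume "w' = 0\<^sub>m 1 n"
        then have "t * k = 0 \<and> u = 0\<^sub>m 1 n"
          using zero_of[OF uk(1) F_mult[OF t(1) uk(2)]] unfolding w'_def by simp
        then have "w = 0\<^sub>m 1 n" unfolding uk(3) using t0 v0c by (auto intro!: eq_matI)
        then show False using w by simp
      qed
      moreover have "R w' (\<theta> \<cdot>\<^sub>m w')" unfolding R_def
      proof (intro bexI conjI)
        have tt: "\<theta> * (t * q) = - q" for q using t(3) by (metis mult.assoc mult_minus1)
        have key: "p * a - q * (\<theta> * a) - \<theta> * (t * k) * (p * b) =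
            - \<theta> * ((q + t * p) * (a + k * b) + - k * (q * b))" for p q a b
        proof -
          have 1: "q * (\<theta> * a) = \<theta> * (q * a)" using F_comm[OF \<theta>, of q] by (metis mult.assoc)
          have 2: "z * (k * b) = k * (z * b)" for z using F_comm[OF uk(2), of z] by (metis mult.assoc)
          have "(q + t * p) * (a + k * b) + - k * (q * b) = q * a + t * (p * a) + t * (k * (p * b))"
            by (simp add: distrib_left distrib_right 2[of q] mult.assoc) (simp add: 2[of p])
          then have "- \<theta> * ((q + t * p) * (a + k * b) + - k * (q * b)) = - (\<theta> * (q * a)) + p * a + k * (p * b)"
            by (simp add: distrib_left tt)
          moreover have "\<theta> * (t * k) * (p * b) = - (k * (p * b))" by (simp add: tt mult.assoc)
          ultimately show ?thesis unfolding 1 by simp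
        qed
        have us: "\<theta> \<cdot>\<^sub>m u \<in> U" using uk \<theta> Uc(4) by blast
        define N where "N = (- \<theta>) \<cdot>\<^sub>m (?z * w + (- k) \<cdot>\<^sub>m (x * v0))"
        have "N \<in> V" unfolding N_def using w xv0 uk \<theta> F_uminus by (intro Vc) auto
        moreover have "y * u - x * (\<theta> \<cdot>\<^sub>m u) - (\<theta> * (t * k)) \<cdot>\<^sub>m (y * v0) = N"
          unfolding lift[OF uk(1) us] N_def uk(3) using carrier_matD[OF uc] key
          by (intro eq_matI) (simp_all del: index_mult_mat(1))
        ultimately show "y * u - x * (\<theta> \<cdot>\<^sub>m u) - (\<theta> * (t * k)) \<cdot>\<^sub>m (y * v0) \<in> V" by simp
        show "\<theta> \<cdot>\<^sub>m w' = \<theta> \<cdot>\<^sub>m u + (\<theta> * (t * k)) \<cdot>\<^sub>m v0"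
          unfolding w'_def using uc v0c by (intro eq_matI) (auto simp: distrib_left mult.assoc)
        show "w' = u + (t * k) \<cdot>\<^sub>m v0" by (rule w'_def)
        show "\<theta> \<cdot>\<^sub>m u \<in> U" by (rule us)
      qed (use uk t \<theta> F_mult in auto)
      ultimately show ?thesis by blast
    qed
  qed
  have "\<exists>E. finite E \<and> E \<subseteq> F \<and> card E = n * degF"
  proof (cases "finite F")
    case True
    then show ?thesis using big obtain_subset_with_card_n[of "n * degF" F] finite_subset by metis
  next
    case False
    then show ?thesis using infinite_arbitrarily_large by blast
  qed
  \<comment> \<open>\<open>U'\<close> has dimension \<open>n d - dim L(x) + 1\<close>, which is
    below \<open>n d\<close> as \<open>dim L(x) \<ge> 2\<close>, yet \<open>n d\<close> scalars are
    eigenvalues.\<close>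
  then show False using small U'(2) U(3) two by fastforce
qed

text \<open>Both sides matter: a fixed row refutes \<open>w x = 0\<close> in
  \<open>good_vector\<close>, while fixed columns keep 1 out of the hyperplanes.\<close>

definition nofix :: "nat \<Rightarrow> 'a mat set \<Rightarrow> bool" where
  "nofix n V \<longleftrightarrow> (\<forall>M\<in>V. (\<forall>v\<in>carrier_mat n 1. M * v = v \<longrightarrow> v = 0\<^sub>m n 1) \<and>
     (\<forall>w\<in>carrier_mat 1 n. w * M = w \<longrightarrow> w = 0\<^sub>m 1 n))"

lemma mat_1_1_eqI: "A \<in> carrier_mat 1 1 \<Longrightarrow> A $$ (0, 0) = 1 \<Longrightarrow> A = (1\<^sub>m 1 :: 'a mat)"
  by (intro eq_matI) auto

text \<open>Equality in the bound forces the minimal dimension to be at least 2, because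
  \<open>degF \<ge> 3\<close>, and there the maximal rank argument applies. In the remaining case
  the inequality is strict, and any row \<open>v0\<close> with \<open>v0 x = 1\<close> will
  do.\<close>

lemma good_vector:
  assumes V: "msub n n V" and nf: "nofix n V" and n: "n \<ge> 1" and deg: "degF \<ge> 3"
    and big: "infinite F \<or> n * degF \<le> card F"
  obtains x v0 where "x \<in> carrier_mat n 1" "v0 \<in> carrier_mat 1 n" "v0 * x = 1\<^sub>m 1"
    "Suc (mdim 1 n (rank_one_rows n V x)) \<le> degF"
    "Suc (mdim 1 n (rank_one_rows n V x)) = degF \<Longrightarrow>
       (\<forall>w\<in>rank_one_rows n V x. \<exists>h. w = h \<cdot>\<^sub>m v0) \<and>
       (\<forall>y\<in>carrier_mat n 1. \<exists>w\<in>carrier_mat 1 n. y * v0 + x * w \<in> V)"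
proof -
  have ex: "\<exists>x. x \<in> carrier_mat n 1 \<and> (\<forall>z. z \<in> carrier_mat n 1 \<longrightarrow>
      mdim 1 n (rank_one_rows n V x) \<le> mdim 1 n (rank_one_rows n V z))"
    by (rule ex_has_least_nat[of "\<lambda>x. x \<in> carrier_mat n 1" "0\<^sub>m n 1"]) simp
  then obtain x where x: "x \<in> carrier_mat n 1"
    and min: "\<And>z. z \<in> carrier_mat n 1 \<Longrightarrow> mdim 1 n (rank_one_rows n V x) \<le> mdim 1 n (rank_one_rows n V z)"
    by blast
  note [simp] = carrier_matD[OF x]
  let ?L = "rank_one_rows n V x"
  have L: "msub 1 n ?L" by (rule msub_rank_one_rows[OF V x])
  have Lc: "w \<in> carrier_mat 1 n" if "w \<in> ?L" for w using that unfolding rank_one_rows_def by blast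
  note Vc = msub_closed[OF V]
  show ?thesis
  proof (cases "2 \<le> mdim 1 n ?L")
    case False
    have "x \<noteq> 0\<^sub>m n 1"
    proof
      assume "x = 0\<^sub>m n 1"
      then have "x * w = 0\<^sub>m n n" if "w \<in> carrier_mat 1 n" for w using that by simp
      then have "?L = carrier_mat 1 n" unfolding rank_one_rows_def using Vc(2) by auto
      then have "mdim 1 n ?L = n * degF" using mdim_carrier[of 1 n] by simp
      moreover have "1 * 3 \<le> n * degF" using n deg by (rule mult_le_mono)
      ultimately show False using False by simp
    qed
    then obtain j where j: "j < n" "x $$ (j, 0) \<noteq> 0" using x by (auto simp: mat_eq_iff)
    define v0 where "v0 = single 1 n (0, j) (inverse (x $$ (j, 0)))"
    have v0c: "v0 \<in> carrier_mat 1 n" unfolding v0_def by (rule single_carrier)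
    have "(v0 * x) $$ (0, 0) = (\<Sum>k\<in>{0..<n}. (if k = j then inverse (x $$ (j, 0)) else 0) * x $$ (k, 0))"
      unfolding v0_def by (simp add: scalar_prod_def)
    also have "\<dots> = (\<Sum>k\<in>{0..<n}. if k = j then inverse (x $$ (j, 0)) * x $$ (j, 0) else 0)"
      by (intro sum.cong) auto
    also have "\<dots> = 1" using j by simp
    finally have "v0 * x = 1\<^sub>m 1"
      by (rule mat_1_1_eqI[OF mult_carrier_mat[OF v0c x]])
    then show ?thesis using that[of x v0] x v0c False deg by simp
  next
    case two: True
    \<comment> \<open>Unlike \<open>?L\<close>, the set \<open>Phi\<close> is closed under left
      multiplication by \<open>D\<close>, since a factor of the row can be moved into the column
      \<open>y\<close>. As \<open>w \<mapsto> w x\<close> is injective on it, it is at most a line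
      over \<open>D\<close>.\<close>
    define Phi where "Phi = {w \<in> carrier_mat 1 n. \<forall>y\<in>carrier_mat n 1. \<exists>u\<in>carrier_mat 1 n. y * w + x * u \<in> V}"
    have L_Phi: "w \<in> Phi" if "w \<in> ?L" for w
      unfolding Phi_def using Lc[OF that] max_rank_kernel_into_range[OF V x _ min two big that] by simp
    have Phi_smult: "h \<cdot>\<^sub>m w \<in> Phi" if w: "w \<in> Phi" for h w
    proof -
      have wc: "w \<in> carrier_mat 1 n" using w unfolding Phi_def by simp
      note [simp] = carrier_matD[OF wc]
      have "\<exists>u\<in>carrier_mat 1 n. y * (h \<cdot>\<^sub>m w) + x * u \<in> V" if y: "y \<in> carrier_mat n 1" for y
      proof -
        define y' where "y' = mat n 1 (\<lambda>(i, _). y $$ (i, 0) * h)"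
        have "y * (h \<cdot>\<^sub>m w) = y' * w" using wc y
          by (intro eq_matI) (auto simp: y'_def mult.assoc simp del: index_mult_mat(1))
        then show ?thesis using w unfolding Phi_def y'_def by simp
      qed
      then show ?thesis unfolding Phi_def using wc by simp
    qed
    have Phi_add: "w + w' \<in> Phi" if w: "w \<in> Phi" "w' \<in> Phi" for w w'
    proof -
      have wc: "w \<in> carrier_mat 1 n" "w' \<in> carrier_mat 1 n" using w unfolding Phi_def by auto
      have "\<exists>u\<in>carrier_mat 1 n. y * (w + w') + x * u \<in> V" if y: "y \<in> carrier_mat n 1" for y
      proof -
        obtain u u' where u: "u \<in> carrier_mat 1 n" "u' \<in> carrier_mat 1 n" "y * w + x * u \<in> V" "y * w' + x * u' \<in> V"
          using w y unfolding Phi_def by blast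
        have "y * (w + w') + x * (u + u') = (y * w + x * u) + (y * w' + x * u')"
          using wc x y u by (intro eq_matI) (auto simp: algebra_simps simp del: index_mult_mat(1))
        then show ?thesis using Vc(3)[OF u(3,4)] u by (metis add_carrier_mat)
      qed
      then show ?thesis unfolding Phi_def using wc by simp
    qed
    have Phi_inj: "w = 0\<^sub>m 1 n" if w: "w \<in> Phi" "(w * x) $$ (0, 0) = 0" for w
    proof (rule ccontr)
      assume nz: "w \<noteq> 0\<^sub>m 1 n"
      have wc: "w \<in> carrier_mat 1 n" using w unfolding Phi_def by simp
      then obtain j where j: "j < n" "w $$ (0, j) \<noteq> 0" using nz by (auto simp: mat_eq_iff)
      define y where "y = single n 1 (j, 0) (inverse (w $$ (0, j)))"
      have y: "y \<in> carrier_mat n 1" unfolding y_def by simp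
      have "(w * y) $$ (0, 0) = (\<Sum>k\<in>{0..<n}. w $$ (0, k) * (if k = j then inverse (w $$ (0, j)) else 0))"
        unfolding y_def using wc by (simp add: scalar_prod_def)
      also have "\<dots> = (\<Sum>k\<in>{0..<n}. if k = j then w $$ (0, j) * inverse (w $$ (0, j)) else 0)"
        by (intro sum.cong) auto
      also have "\<dots> = 1" using j by simp
      finally have wy: "w * y = 1\<^sub>m 1" by (rule mat_1_1_eqI[OF mult_carrier_mat[OF wc y]])
      have wx: "w * x = 0\<^sub>m 1 1"
      proof (rule eq_matI)
        fix i j assume "i < dim_row (0\<^sub>m 1 1 :: 'a mat)" "j < dim_col (0\<^sub>m 1 1 :: 'a mat)"
        then show "(w * x) $$ (i, j) = 0\<^sub>m 1 1 $$ (i, j)" using w(2) by (simp del: index_mult_mat(1))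
      qed (use carrier_matD[OF wc] in simp_all)
      obtain u where u: "u \<in> carrier_mat 1 n" "y * w + x * u \<in> V" using w y unfolding Phi_def by blast
      have "w * (y * w + x * u) = w * (y * w) + w * (x * u)"
        by (rule mult_add_distrib_mat[OF wc mult_carrier_mat[OF y wc] mult_carrier_mat[OF x u(1)]])
      also have "w * (y * w) = w"
        unfolding assoc_mult_mat[OF wc y wc, symmetric] wy by (rule left_mult_one_mat[OF wc])
      also have "w * (x * u) = 0\<^sub>m 1 n"
        unfolding assoc_mult_mat[OF wc x u(1), symmetric] wx by (rule left_mult_zero_mat[OF u(1)])
      also have "w + 0\<^sub>m 1 n = w" using wc by simp
      finally show False using nf u(2) wc nz unfolding nofix_def by blast
    qed
    define val where "val w = (w * x) $$ (0, 0)" for w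
    have val_add: "val (w + w') = val w + val w'" if "w \<in> carrier_mat 1 n" "w' \<in> carrier_mat 1 n" for w w'
    proof -
      have "(w + w') * x = w * x + w' * x" using that x by (intro add_mult_distrib_mat) auto
      then show ?thesis using that unfolding val_def by (simp del: index_mult_mat(1))
    qed
    have val_smult: "val (h \<cdot>\<^sub>m w) = h * val w" if "w \<in> carrier_mat 1 n" for w h
      unfolding val_def smult_mat_mult[OF that x] using that by (simp del: index_mult_mat(1))
    note rn = mat_ring_rank_nullity[OF L, of val]
    have rn1: "mdim 1 n ?L = ddim (val ` ?L) + mdim 1 n {v \<in> ?L. val v = 0}" and rn2: "dsub (val ` ?L)"
      using rn val_add val_smult Lc by auto
    have v00: "val (0\<^sub>m 1 n) = 0" unfolding val_def using x by simp
    have "{v \<in> ?L. val v = 0} = {0\<^sub>m 1 n}"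
      using Phi_inj L_Phi msub_closed(2)[OF L] v00 unfolding val_def by auto
    then have dimL: "mdim 1 n ?L = ddim (val ` ?L)" using rn1 mdim_zero by simp
    have "1 \<notin> val ` ?L"
    proof
      assume "1 \<in> val ` ?L"
      then obtain w where w: "w \<in> ?L" "val w = 1" by auto
      have wc: "w \<in> carrier_mat 1 n" and xw: "x * w \<in> V" using w unfolding rank_one_rows_def by auto
      have wx: "w * x = 1\<^sub>m 1"
        by (rule mat_1_1_eqI[OF mult_carrier_mat[OF wc x] w(2)[unfolded val_def]])
      have "x * w * x = x"
        unfolding assoc_mult_mat[OF x wc x] wx by (rule right_mult_one_mat[OF x])
      then have "x = 0\<^sub>m n 1" using nf xw x unfolding nofix_def by blast
      then have "w * x = 0\<^sub>m 1 1" using right_mult_zero_mat[OF wc] by simp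
      then show False using w(2) unfolding val_def by (simp del: index_mult_mat(1))
    qed
    then have "val ` ?L \<noteq> UNIV" by blast
    then have le: "Suc (mdim 1 n ?L) \<le> degF"
      using ddim_mono[OF rn2 dsub_UNIV] ddim_eq[OF rn2 dsub_UNIV] dimL ddim_UNIV by fastforce
    obtain w1 where w1: "w1 \<in> ?L" "w1 \<noteq> 0\<^sub>m 1 n" using mdim_pos[OF L] two by auto
    have w1v: "val w1 \<noteq> 0" using Phi_inj L_Phi w1 unfolding val_def by blast
    \<comment> \<open>The value of \<open>v0\<close> is 1, so it lies outside \<open>?L\<close>; it
      remains in \<open>Phi\<close>, and by injectivity each \<open>w\<close> is
      \<open>val w\<close> times \<open>v0\<close>.\<close>
    define v0 where "v0 = inverse (val w1) \<cdot>\<^sub>m w1"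
    have v0: "v0 \<in> Phi" "v0 \<in> carrier_mat 1 n" "val v0 = 1"
      unfolding v0_def using Phi_smult L_Phi w1 Lc val_smult w1v by auto
    have "v0 * x = 1\<^sub>m 1"
      by (rule mat_1_1_eqI[OF mult_carrier_mat[OF v0(2) x] v0(3)[unfolded val_def]])
    moreover have "\<exists>h. w = h \<cdot>\<^sub>m v0" if w: "w \<in> ?L" for w
    proof
      have wc: "w \<in> carrier_mat 1 n" using Lc[OF w] .
      have "w + (- val w) \<cdot>\<^sub>m v0 \<in> Phi" using w L_Phi v0 Phi_smult Phi_add by blast
      moreover have "val (w + (- val w) \<cdot>\<^sub>m v0) = 0" using val_add val_smult wc v0 by simp
      ultimately have 0: "w + (- val w) \<cdot>\<^sub>m v0 = 0\<^sub>m 1 n" using Phi_inj unfolding val_def by blast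
      have "w $$ (0, j) = val w * v0 $$ (0, j)" if "j < n" for j
        using arg_cong[OF 0, of "\<lambda>M. M $$ (0, j)"] that wc v0 by simp
      then show "w = val w \<cdot>\<^sub>m v0" using wc v0 by (intro eq_matI) auto
    qed
    moreover have "\<forall>y\<in>carrier_mat n 1. \<exists>w\<in>carrier_mat 1 n. y * v0 + x * w \<in> V"
      using v0(1) unfolding Phi_def by blast
    ultimately show ?thesis using that[of x v0] x v0 le by blast
  qed
qed

text \<open>The inverse is carried along explicitly, so that conjugations are composed by
  multiplying the pairs and undone by exchanging their members.\<close>

definition inv_pair :: "nat \<Rightarrow> 'a mat \<Rightarrow> 'a mat \<Rightarrow> bool" where
  "inv_pair n Q P \<longleftrightarrow> Q \<in> carrier_mat n n \<and> P \<in> carrier_mat n n \<and> Q * P = 1\<^sub>m n \<and> P * Q = 1\<^sub>m n"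

definition conj_set :: "'a mat \<Rightarrow> 'a mat \<Rightarrow> 'a mat set \<Rightarrow> 'a mat set" where
  "conj_set Q P V = (\<lambda>M. Q * M * P) ` V"

lemma similar_sets_iff: "similar_sets n S T \<longleftrightarrow> (\<exists>Q P. inv_pair n Q P \<and> T = conj_set Q P S)"
  unfolding similar_sets_def inv_pair_def conj_set_def inverts_mat_def by auto

lemma inv_pair_mult:
  assumes "inv_pair n Q P" "inv_pair n Q' P'"
  shows "inv_pair n (Q' * Q) (P * P')"
proof -
  have c: "Q \<in> carrier_mat n n" "P \<in> carrier_mat n n" "Q' \<in> carrier_mat n n" "P' \<in> carrier_mat n n"
    and e: "Q * P = 1\<^sub>m n" "P * Q = 1\<^sub>m n" "Q' * P' = 1\<^sub>m n" "P' * Q' = 1\<^sub>m n"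
    using assms unfolding inv_pair_def by auto
  have "Q' * Q * (P * P') = Q' * (Q * P * P')" using c by (simp add: assoc_mult_mat[of _ n n _ n _ n])
  moreover have "P * P' * (Q' * Q) = P * (P' * Q' * Q)" using c by (simp add: assoc_mult_mat[of _ n n _ n _ n])
  ultimately show ?thesis unfolding inv_pair_def using c e by simp
qed

lemma inv_pair_sym: "inv_pair n Q P \<Longrightarrow> inv_pair n P Q"
  unfolding inv_pair_def by auto

lemma inv_pair_one: "inv_pair n (1\<^sub>m n) (1\<^sub>m n)"
  unfolding inv_pair_def by auto

lemma conj_conj:
  assumes "inv_pair n Q P" "inv_pair n Q' P'" "V \<subseteq> carrier_mat n n"
  shows "conj_set Q' P' (conj_set Q P V) = conj_set (Q' * Q) (P * P') V"
proof -
  have c: "Q \<in> carrier_mat n n" "P \<in> carrier_mat n n" "Q' \<in> carrier_mat n n" "P' \<in> carrier_mat n n"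
    using assms unfolding inv_pair_def by auto
  have "Q' * (Q * M * P) * P' = Q' * Q * M * (P * P')" if "M \<in> V" for M
  proof -
    have "M \<in> carrier_mat n n" using that assms by auto
    then show ?thesis using c by (simp add: assoc_mult_mat[of _ n n _ n _ n])
  qed
  then show ?thesis unfolding conj_set_def image_image by (intro image_cong) auto
qed

lemma conj_one: "V \<subseteq> carrier_mat n n \<Longrightarrow> conj_set (1\<^sub>m n) (1\<^sub>m n) V = V"
proof -
  assume V: "V \<subseteq> carrier_mat n n"
  have "conj_set (1\<^sub>m n) (1\<^sub>m n) V = (\<lambda>M. M) ` V"
    unfolding conj_set_def
  proof (rule image_cong[OF refl])
    fix M assume "M \<in> V"
    then have "M \<in> carrier_mat n n" using V by blast
    then show "1\<^sub>m n * M * 1\<^sub>m n = M" by simp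
  qed
  then show ?thesis by simp
qed

lemma conj_cancel:
  assumes "inv_pair n Q P" "V \<subseteq> carrier_mat n n"
  shows "conj_set P Q (conj_set Q P V) = V"
proof -
  have "P * Q = 1\<^sub>m n" using assms(1) unfolding inv_pair_def by blast
  then show ?thesis
    using conj_conj[OF assms(1) inv_pair_sym[OF assms(1)] assms(2)] conj_one[OF assms(2)] by simp
qed

lemma cancel_conj:
  assumes "inv_pair n Q P" "M \<in> carrier_mat n n"
  shows "P * (Q * M * P) * Q = M"
proof -
  have c: "Q \<in> carrier_mat n n" "P \<in> carrier_mat n n" "P * Q = 1\<^sub>m n" using assms unfolding inv_pair_def by auto
  have "P * (Q * M * P) * Q = (P * Q) * M * (P * Q)" using c(1,2) assms(2)
    by (simp add: assoc_mult_mat[of _ n n _ n _ n])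
  then show ?thesis using c assms(2) by simp
qed

lemma conj_mem_iff:
  assumes "inv_pair n Q P" "V \<subseteq> carrier_mat n n" "M \<in> carrier_mat n n"
  shows "M \<in> conj_set Q P V \<longleftrightarrow> P * M * Q \<in> V"
proof
  assume "M \<in> conj_set Q P V"
  then show "P * M * Q \<in> V" using cancel_conj[OF assms(1)] assms(2) unfolding conj_set_def by auto
next
  assume "P * M * Q \<in> V"
  then show "M \<in> conj_set Q P V"
    using cancel_conj[OF inv_pair_sym[OF assms(1)] assms(3)] unfolding conj_set_def by (metis imageI)
qed

lemma similar_sets_sym:
  fixes S T :: "'a mat set"
  assumes "S \<subseteq> carrier_mat n n" "similar_sets n S T"
  shows "similar_sets n T S"
proof -
  obtain Q P where QP: "inv_pair n Q P" "T = conj_set Q P S" using assms(2) similar_sets_iff by blast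
  then have "S = conj_set P Q T" using conj_cancel[OF QP(1) assms(1)] by simp
  then show ?thesis using inv_pair_sym[OF QP(1)] similar_sets_iff by blast
qed

lemma conj_subspace:
  assumes Q: "inv_pair n Q P" and V: "msub n n V"
  shows "msub n n (conj_set Q P V)" "mdim n n (conj_set Q P V) = mdim n n V"
proof -
  note Vc = msub_closed[OF V]
  have c: "Q \<in> carrier_mat n n" "P \<in> carrier_mat n n" using Q unfolding inv_pair_def by auto
  have add: "Q * (v + w) * P = Q * v * P + Q * w * P" if "v \<in> V" "w \<in> V" for v w
    using c Vc(1)[OF that(1)] Vc(1)[OF that(2)]
    by (simp add: mult_add_distrib_mat[of _ n n _ n] add_mult_distrib_mat[of _ n n _ _ n])
  have scale: "Q * (k \<cdot>\<^sub>m v) * P = k \<cdot>\<^sub>m (Q * v * P)" if "k \<in> F" "v \<in> V" for k v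
    unfolding mult_smult_F[OF c(1) Vc(1)[OF that(2)] that(1)]
    by (rule smult_mat_mult[OF mult_carrier_mat[OF c(1) Vc(1)[OF that(2)]] c(2)])
  have cl: "Q * v * P \<in> carrier_mat n n" if "v \<in> V" for v
    by (rule mult_carrier_mat[OF mult_carrier_mat[OF c(1) Vc(1)[OF that]] c(2)])
  note rn = mat_rank_nullity[OF V, of "\<lambda>M. Q * M * P" n n, OF cl add scale]
  have ker: "{v \<in> V. Q * v * P = 0\<^sub>m n n} = {0\<^sub>m n n}"
  proof -
    have "v = 0\<^sub>m n n" if "v \<in> V" "Q * v * P = 0\<^sub>m n n" for v
      using cancel_conj[OF Q Vc(1)[OF that(1)]] that(2) c by simp
    then show ?thesis using Vc(2) c by auto
  qed
  show "msub n n (conj_set Q P V)" unfolding conj_set_def using rn(2) by simp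
  show "mdim n n (conj_set Q P V) = mdim n n V"
    unfolding conj_set_def using rn(1) ker mdim_zero by simp
qed

text \<open>If \<open>Q M P\<close> fixes the column \<open>v\<close>, then \<open>M\<close> fixes
  \<open>P v\<close>; if it fixes the row \<open>v\<close>, then \<open>M\<close> fixes
  \<open>v Q\<close>.\<close>

lemma conj_nofix:
  assumes Q: "inv_pair n Q P" and V: "V \<subseteq> carrier_mat n n" and nf: "nofix n V"
  shows "nofix n (conj_set Q P V)"
  unfolding nofix_def
proof (intro ballI conjI impI)
  have c: "Q \<in> carrier_mat n n" "P \<in> carrier_mat n n" "Q * P = 1\<^sub>m n" "P * Q = 1\<^sub>m n"
    using Q unfolding inv_pair_def by auto
  fix N v assume "N \<in> conj_set Q P V"
  then obtain M where M: "M \<in> V" "N = Q * M * P" unfolding conj_set_def by auto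
  then have Mc: "M \<in> carrier_mat n n" using V by auto
  {
    assume v: "v \<in> carrier_mat n 1" "N * v = v"
    have "M * (P * v) = P * Q * (M * (P * v))" using c Mc v(1) by simp
    also have "\<dots> = P * (N * v)" unfolding M(2) using c(1,2) Mc v(1)
      by (simp add: assoc_mult_mat[of _ n n _ n _ 1] assoc_mult_mat[of _ n n _ n _ n])
    finally have "P * v = 0\<^sub>m n 1" using nf M(1) c v unfolding nofix_def by auto
    then have "Q * (P * v) = 0\<^sub>m n 1" using c by simp
    then show "v = 0\<^sub>m n 1" using c v by (simp flip: assoc_mult_mat[of _ n n _ n _ 1])
  next
    assume v: "v \<in> carrier_mat 1 n" "v * N = v"
    have "v * Q * M = v * Q * M * (P * Q)" using c Mc v(1) by simp
    also have "\<dots> = (v * N) * Q" unfolding M(2) using c(1,2) Mc v(1)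
      by (simp add: assoc_mult_mat[of _ 1 n _ n _ n] assoc_mult_mat[of _ n n _ n _ n])
    finally have "v * Q = 0\<^sub>m 1 n" using nf M(1) c v unfolding nofix_def by auto
    then have "v * Q * P = 0\<^sub>m 1 n" using c by simp
    then show "v = 0\<^sub>m 1 n" using c v by (simp add: assoc_mult_mat[of _ 1 n _ n _ n])
  }
qed

section \<open>Normal form\<close>

definition ecol :: "nat \<Rightarrow> 'a mat" where
  "ecol m = mat (Suc m) 1 (\<lambda>(i, j). if i = m then 1 else 0)"

definition erow :: "nat \<Rightarrow> 'a mat" where
  "erow m = mat 1 (Suc m) (\<lambda>(i, j). if j = m then 1 else 0)"

lemma ecol_carrier [simp]: "ecol m \<in> carrier_mat (Suc m) 1"
  and erow_carrier [simp]: "erow m \<in> carrier_mat 1 (Suc m)"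
  and ecol_dim [simp]: "dim_row (ecol m) = Suc m" "dim_col (ecol m) = 1"
  and erow_dim [simp]: "dim_row (erow m) = 1" "dim_col (erow m) = Suc m"
  by (simp_all add: ecol_def erow_def)

lemma ecol_index [simp]: "i < Suc m \<Longrightarrow> ecol m $$ (i, 0) = (if i = m then 1 else 0)"
  and erow_index [simp]: "i < Suc m \<Longrightarrow> erow m $$ (0, i) = (if i = m then 1 else 0)"
  by (simp_all add: ecol_def erow_def)

lemma sum_delta_left: "m < (k :: nat) \<Longrightarrow> (\<Sum>i\<in>{0..<k}. (if i = m then c else 0) * f i) = c * (f m :: 'a)"
proof -
  assume "m < k"
  have "(\<Sum>i\<in>{0..<k}. (if i = m then c else 0) * f i) = (\<Sum>i\<in>{0..<k}. if i = m then c * f m else 0)"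
    by (intro sum.cong) auto
  then show ?thesis using \<open>m < k\<close> by simp
qed

lemma sum_delta_right: "m < (k :: nat) \<Longrightarrow> (\<Sum>i\<in>{0..<k}. f i * (if i = m then c else 0)) = f m * (c :: 'a)"
proof -
  assume "m < k"
  have "(\<Sum>i\<in>{0..<k}. f i * (if i = m then c else 0)) = (\<Sum>i\<in>{0..<k}. if i = m then f m * c else 0)"
    by (intro sum.cong) auto
  then show ?thesis using \<open>m < k\<close> by simp
qed

lemma erow_mult_index:
  assumes "A \<in> carrier_mat (Suc m) c" "j < c"
  shows "(erow m * A) $$ (0, j) = A $$ (m, j)"
proof -
  have "(erow m * A) $$ (0, j) = (\<Sum>i\<in>{0..<Suc m}. (if i = m then 1 else 0) * A $$ (i, j))"
    using carrier_matD[OF assms(1)] assms(2) by (simp add: scalar_prod_def)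
  then show ?thesis using sum_delta_left[of m "Suc m" 1 "\<lambda>i. A $$ (i, j)"] by simp
qed

lemma mat_1_1_mult:
  fixes A B :: "'a mat"
  assumes "A \<in> carrier_mat 1 1" "B \<in> carrier_mat 1 n"
  shows "A * B = A $$ (0, 0) \<cdot>\<^sub>m B"
  using assms by (intro eq_matI) (auto simp: scalar_prod_def)

text \<open>The Sherman-Morrison formula: \<open>1 - u k v\<close> inverts \<open>1 + u v\<close>
  for \<open>k = inverse (1 + v u)\<close>. Over a noncommutative \<open>D\<close> the scalar has to
  stay between \<open>u\<close> and \<open>v\<close>.\<close>

lemma rank_one_update_inverse:
  assumes u: "u \<in> carrier_mat n 1" and v: "v \<in> carrier_mat 1 n" and nz: "1 + (v * u) $$ (0, 0) \<noteq> 0"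
  shows "\<exists>Q. inv_pair n Q (1\<^sub>m n + u * v)"
proof -
  define c where "c = (v * u) $$ (0, 0)"
  define k where "k = inverse (1 + c)"
  have k: "(1 + c) * k = 1" "k * (1 + c) = 1" unfolding k_def using nz c_def by simp_all
  define A where "A = u * v"
  define B where "B = u * (k \<cdot>\<^sub>m v)"
  have kv: "k \<cdot>\<^sub>m v \<in> carrier_mat 1 n" using v by simp
  have cA: "A \<in> carrier_mat n n" "B \<in> carrier_mat n n" unfolding A_def B_def using u v kv by auto
  note dims = carrier_matD[OF u] carrier_matD[OF v] carrier_matD[OF cA(1)] carrier_matD[OF cA(2)]
  have vu: "v * u \<in> carrier_mat 1 1" using u v by simp
  have prod: "(u * w) * (u * w') = u * ((w * u) $$ (0, 0) \<cdot>\<^sub>m w')"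
    if w: "w \<in> carrier_mat 1 n" "w' \<in> carrier_mat 1 n" for w w'
  proof -
    have "(u * w) * (u * w') = u * (w * (u * w'))"
      by (rule assoc_mult_mat[OF u w(1) mult_carrier_mat[OF u w(2)]])
    also have "w * (u * w') = (w * u) * w'" by (rule assoc_mult_mat[OF w(1) u w(2), symmetric])
    also have "\<dots> = (w * u) $$ (0, 0) \<cdot>\<^sub>m w'" by (rule mat_1_1_mult[OF mult_carrier_mat[OF w(1) u] w(2)])
    finally show ?thesis .
  qed
  have AB: "A * B = u * (c \<cdot>\<^sub>m (k \<cdot>\<^sub>m v))" unfolding A_def B_def c_def by (rule prod[OF v kv])
  have "((k \<cdot>\<^sub>m v) * u) $$ (0, 0) = k * c"
    unfolding c_def smult_mat_mult[OF v u] using carrier_matD[OF vu] by (simp del: index_mult_mat(1))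
  then have BA: "B * A = u * ((k * c) \<cdot>\<^sub>m v)" unfolding A_def B_def using prod[OF kv v] by simp
  have one: "(1\<^sub>m n :: 'a mat) \<in> carrier_mat n n" by simp
  have s1: "(1\<^sub>m n + A) * (1\<^sub>m n - B) = (1\<^sub>m n - B) + (A - A * B)"
    using add_mult_distrib_mat[OF one cA(1) minus_carrier_mat[OF cA(2)], of "1\<^sub>m n"]
      left_mult_one_mat[OF minus_carrier_mat[OF cA(2)], of "1\<^sub>m n"]
      mult_minus_distrib_mat[OF cA(1) one cA(2)] right_mult_one_mat[OF cA(1)] by simp
  have s2: "(1\<^sub>m n - B) * (1\<^sub>m n + A) = (1\<^sub>m n - B) + (A - B * A)"
  proof -
    have m: "1\<^sub>m n - B \<in> carrier_mat n n" by (rule minus_carrier_mat[OF cA(2)])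
    show ?thesis
      using mult_add_distrib_mat[OF m one cA(1)] right_mult_one_mat[OF m]
        minus_mult_distrib_mat[OF one cA(2) cA(1)] left_mult_one_mat[OF cA(1)] by simp
  qed
  have "(1\<^sub>m n + A) * (1\<^sub>m n - B) = 1\<^sub>m n"
    unfolding s1 AB
  proof (rule eq_matI)
    fix i j assume "i < dim_row (1\<^sub>m n :: 'a mat)" "j < dim_col (1\<^sub>m n :: 'a mat)"
    then have ij: "i < n" "j < n" by simp_all
    have "v $$ (0, j) = (1 + c) * k * v $$ (0, j)" using k by simp
    then have "v $$ (0, j) = k * v $$ (0, j) + c * (k * v $$ (0, j))" by (simp add: distrib_right mult.assoc)
    then have "u $$ (i, 0) * v $$ (0, j) = u $$ (i, 0) * (k * v $$ (0, j)) + u $$ (i, 0) * (c * (k * v $$ (0, j)))"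
      by (metis distrib_left)
    then show "(1\<^sub>m n - B + (A - u * (c \<cdot>\<^sub>m (k \<cdot>\<^sub>m v)))) $$ (i, j) = 1\<^sub>m n $$ (i, j)"
      using ij dims unfolding A_def B_def by (simp del: index_mult_mat(1) add: algebra_simps)
  qed (use dims in simp_all)
  moreover have "(1\<^sub>m n - B) * (1\<^sub>m n + A) = 1\<^sub>m n"
    unfolding s2 BA
  proof (rule eq_matI)
    fix i j assume "i < dim_row (1\<^sub>m n :: 'a mat)" "j < dim_col (1\<^sub>m n :: 'a mat)"
    then have ij: "i < n" "j < n" by simp_all
    have "v $$ (0, j) = k * (1 + c) * v $$ (0, j)" using k by simp
    then have "v $$ (0, j) = k * v $$ (0, j) + k * c * v $$ (0, j)" by (simp add: distrib_right distrib_left)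
    then have "u $$ (i, 0) * v $$ (0, j) = u $$ (i, 0) * (k * v $$ (0, j)) + u $$ (i, 0) * (k * c * v $$ (0, j))"
      by (metis distrib_left)
    then show "(1\<^sub>m n - B + (A - u * ((k * c) \<cdot>\<^sub>m v))) $$ (i, j) = 1\<^sub>m n $$ (i, j)"
      using ij dims unfolding A_def B_def by (simp del: index_mult_mat(1) add: algebra_simps)
  qed (use dims in simp_all)
  ultimately show ?thesis unfolding inv_pair_def using cA minus_carrier_mat[OF cA(2), of "1\<^sub>m n"]
    by (intro exI[of _ "1\<^sub>m n - B"]) (simp add: A_def)
qed

lemma rank_one_update_mult:
  fixes u v x :: "'a mat"
  assumes u: "u \<in> carrier_mat n 1" and v: "v \<in> carrier_mat 1 n" and x: "x \<in> carrier_mat n 1"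
    and vx: "(v * x) $$ (0, 0) = 1"
  shows "(1\<^sub>m n + u * v) * x = x + u"
proof -
  have "v * x = 1\<^sub>m 1" by (rule mat_1_1_eqI[OF mult_carrier_mat[OF v x] vx])
  then have "u * v * x = u" using assoc_mult_mat[OF u v x] right_mult_one_mat[OF u] by simp
  then show ?thesis
    using add_mult_distrib_mat[OF one_carrier_mat mult_carrier_mat[OF u v] x] left_mult_one_mat[OF x] by simp
qed

text \<open>Rank-one updates of the identity suffice: one makes the last entry of \<open>x\<close>
  nonzero, one takes \<open>x\<close> to the last basis column, and one fixes that column while
  turning the row into the last basis row.\<close>

lemma change_of_basis:
  assumes x: "x \<in> carrier_mat (Suc m) 1" and v0: "v0 \<in> carrier_mat 1 (Suc m)" and v0x: "v0 * x = 1\<^sub>m 1"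
  obtains Q P where "inv_pair (Suc m) Q P" "Q * x = ecol m" "v0 * P = erow m"
proof -
  let ?n = "Suc m"
  \<comment> \<open>The update \<open>1 + (z - ecol m) * erow m\<close> sends \<open>ecol m\<close>
    to \<open>z\<close>; it is invertible because \<open>1 + erow m * (z - ecol m)\<close> is the
    last entry of \<open>z\<close>.\<close>
  have step: "\<exists>Q P. inv_pair ?n Q P \<and> Q * z = ecol m" if z: "z \<in> carrier_mat ?n 1" "z $$ (m, 0) \<noteq> 0" for z
  proof -
    define u where "u = z - ecol m"
    have u: "u \<in> carrier_mat ?n 1" unfolding u_def by (rule minus_carrier_mat[OF ecol_carrier])
    have "(erow m * u) $$ (0, 0) = z $$ (m, 0) - 1"
      using erow_mult_index[OF u, of 0] z unfolding u_def by simp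
    then obtain Q where Q: "inv_pair ?n Q (1\<^sub>m ?n + u * erow m)"
      using rank_one_update_inverse[OF u erow_carrier] z(2) by auto
    have "(1\<^sub>m ?n + u * erow m) * ecol m = ecol m + u"
      by (rule rank_one_update_mult[OF u erow_carrier ecol_carrier])
        (simp add: erow_mult_index[OF ecol_carrier] del: index_mult_mat(1))
    also have "\<dots> = z" unfolding u_def using z by (intro eq_matI) auto
    finally have "z = (1\<^sub>m ?n + u * erow m) * ecol m" ..
    moreover have Qc: "Q \<in> carrier_mat ?n ?n" "1\<^sub>m ?n + u * erow m \<in> carrier_mat ?n ?n"
      "Q * (1\<^sub>m ?n + u * erow m) = 1\<^sub>m ?n" using Q unfolding inv_pair_def by blast+
    moreover have "Q * ((1\<^sub>m ?n + u * erow m) * ecol m) = ecol m"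
      unfolding assoc_mult_mat[OF Qc(1,2) ecol_carrier, symmetric] Qc(3) by (rule left_mult_one_mat[OF ecol_carrier])
    ultimately have "Q * z = ecol m" by metis
    then show ?thesis using Q by blast
  qed
  have "\<exists>Q P. inv_pair ?n Q P \<and> Q * x = ecol m"
  proof (cases "x $$ (m, 0) = 0")
    case False
    then show ?thesis using step[OF x] by blast
  next
    case True
    have "x \<noteq> 0\<^sub>m ?n 1"
    proof
      assume "x = 0\<^sub>m ?n 1"
      then have "(0\<^sub>m 1 1 :: 'a mat) = 1\<^sub>m 1" using v0x right_mult_zero_mat[OF v0] by simp
      then have "(0\<^sub>m 1 1 :: 'a mat) $$ (0, 0) = 1\<^sub>m 1 $$ (0, 0)" by simp
      then show False by simp
    qed
    then obtain j where j: "j < ?n" "x $$ (j, 0) \<noteq> 0" using x by (auto simp: mat_eq_iff)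
    then have jm: "j \<noteq> m" using True by auto
    \<comment> \<open>Chosen with \<open>v x = 1\<close> and \<open>v * ecol m = 0\<close>, so that
      \<open>1 + ecol m * v\<close> is invertible and adds \<open>ecol m\<close> to
      \<open>x\<close>.\<close>
    define v where "v = single 1 ?n (0, j) (inverse (x $$ (j, 0)))"
    have v: "v \<in> carrier_mat 1 ?n" unfolding v_def by simp
    have vz: "(v * z) $$ (0, 0) = inverse (x $$ (j, 0)) * z $$ (j, 0)" if z: "z \<in> carrier_mat ?n 1" for z
    proof -
      have "(v * z) $$ (0, 0) = (\<Sum>k\<in>{0..<?n}. (if k = j then inverse (x $$ (j, 0)) else 0) * z $$ (k, 0))"
        unfolding v_def using carrier_matD[OF z] by (simp add: scalar_prod_def)
      then show ?thesis using sum_delta_left[OF j(1), of _ "\<lambda>k. z $$ (k, 0)"] by simp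
    qed
    have "(v * ecol m) $$ (0, 0) = 0" using vz[OF ecol_carrier] jm j by simp
    then obtain R where R: "inv_pair ?n R (1\<^sub>m ?n + ecol m * v)"
      using rank_one_update_inverse[OF ecol_carrier v] by auto
    let ?T = "1\<^sub>m ?n + ecol m * v"
    have T: "?T * x = x + ecol m" by (rule rank_one_update_mult[OF ecol_carrier v x]) (use vz[OF x] j in simp)
    have "(?T * x) $$ (m, 0) \<noteq> 0" unfolding T using x True by simp
    moreover have Tx: "?T * x \<in> carrier_mat ?n 1" unfolding T by (rule add_carrier_mat[OF ecol_carrier])
    ultimately obtain Q P where QP: "inv_pair ?n Q P" "Q * (?T * x) = ecol m" using step by blast
    have "inv_pair ?n (Q * ?T) (R * P)" by (rule inv_pair_mult[OF inv_pair_sym[OF R] QP(1)])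
    moreover have "Q * ?T * x = ecol m"
    proof -
      have "Q \<in> carrier_mat ?n ?n" "?T \<in> carrier_mat ?n ?n" using QP R unfolding inv_pair_def by blast+
      from assoc_mult_mat[OF this x] show ?thesis unfolding QP(2) .
    qed
    ultimately show ?thesis by blast
  qed
  then obtain Q P where QP: "inv_pair ?n Q P" "Q * x = ecol m" by blast
  have c: "Q \<in> carrier_mat ?n ?n" "P \<in> carrier_mat ?n ?n" "P * Q = 1\<^sub>m ?n" using QP unfolding inv_pair_def by auto
  have "P * (Q * x) = x" unfolding assoc_mult_mat[OF c(2,1) x, symmetric] c(3) by (rule left_mult_one_mat[OF x])
  then have Pe: "P * ecol m = x" using QP by simp
  define v1 where "v1 = v0 * P"
  have v1: "v1 \<in> carrier_mat 1 ?n" unfolding v1_def by (rule mult_carrier_mat[OF v0 c(2)])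
  have v1e: "v1 * ecol m = 1\<^sub>m 1" unfolding v1_def assoc_mult_mat[OF v0 c(2) ecol_carrier] Pe v0x ..
  \<comment> \<open>Both rows have product 1 with \<open>ecol m\<close>, so \<open>v\<close> kills
    it: the update \<open>1 + ecol m * v\<close> fixes that column and takes \<open>v1\<close> to
    \<open>v1 + v = erow m\<close>.\<close>
  define v where "v = erow m - v1"
  have v: "v \<in> carrier_mat 1 ?n" unfolding v_def by (rule minus_carrier_mat[OF v1])
  have "v * ecol m = erow m * ecol m - v1 * ecol m"
    unfolding v_def by (rule minus_mult_distrib_mat[OF erow_carrier v1 ecol_carrier])
  also have "erow m * ecol m = 1\<^sub>m 1"
    by (rule mat_1_1_eqI[OF mult_carrier_mat[OF erow_carrier ecol_carrier]])
      (simp add: erow_mult_index[OF ecol_carrier] del: index_mult_mat(1))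
  finally have ve: "v * ecol m = 0\<^sub>m 1 1" unfolding v1e by (auto intro!: eq_matI)
  then obtain R where R: "inv_pair ?n R (1\<^sub>m ?n + ecol m * v)"
    using rank_one_update_inverse[OF ecol_carrier v] by auto
  let ?T = "1\<^sub>m ?n + ecol m * v"
  have ev: "ecol m * v \<in> carrier_mat ?n ?n" by (rule mult_carrier_mat[OF ecol_carrier v])
  have Rc: "R \<in> carrier_mat ?n ?n" "?T \<in> carrier_mat ?n ?n" "R * ?T = 1\<^sub>m ?n" using R unfolding inv_pair_def by auto
  have Te: "?T * ecol m = ecol m"
    using add_mult_distrib_mat[OF one_carrier_mat ev ecol_carrier] left_mult_one_mat[OF ecol_carrier]
      assoc_mult_mat[OF ecol_carrier v ecol_carrier] ve right_mult_zero_mat[OF ecol_carrier]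
      right_add_zero_mat[OF ecol_carrier] by simp
  have "R * (?T * ecol m) = ecol m"
    unfolding assoc_mult_mat[OF Rc(1,2) ecol_carrier, symmetric] Rc(3) by (rule left_mult_one_mat[OF ecol_carrier])
  then have Re: "R * ecol m = ecol m" unfolding Te .
  have "v1 * ?T = v1 * 1\<^sub>m ?n + v1 * (ecol m * v)" by (rule mult_add_distrib_mat[OF v1 one_carrier_mat ev])
  also have "v1 * (ecol m * v) = v"
    unfolding assoc_mult_mat[OF v1 ecol_carrier v, symmetric] v1e by (rule left_mult_one_mat[OF v])
  also have "v1 * 1\<^sub>m ?n + v = erow m" unfolding v_def using v1 by (auto intro!: eq_matI)
  finally have vT: "v1 * ?T = erow m" .
  show ?thesis
  proof (rule that)
    show "inv_pair ?n (R * Q) (P * ?T)" by (rule inv_pair_mult[OF QP(1) R])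
    show "R * Q * x = ecol m" unfolding assoc_mult_mat[OF Rc(1) c(1) x] QP(2) by (rule Re)
    show "v0 * (P * ?T) = erow m"
      unfolding assoc_mult_mat[OF v0 c(2) Rc(2), symmetric] using vT by (simp only: v1_def)
  qed
qed

text \<open>The pair \<open>x\<close>, \<open>v0\<close> of \<open>good_vector\<close> is moved to
  the last basis column and row. Rows transform by \<open>w \<mapsto> w P\<close>, which identifies
  \<open>L(x)\<close> with its counterpart for the conjugated space.\<close>

lemma normal_form:
  assumes V: "msub (Suc m) (Suc m) V" and nf: "nofix (Suc m) V" and deg: "degF \<ge> 3"
    and big: "infinite F \<or> Suc m * degF \<le> card F"
  obtains Q P where "inv_pair (Suc m) Q P"
    "Suc (mdim 1 (Suc m) (rank_one_rows (Suc m) (conj_set Q P V) (ecol m))) \<le> degF"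
    "Suc (mdim 1 (Suc m) (rank_one_rows (Suc m) (conj_set Q P V) (ecol m))) = degF \<Longrightarrow>
       (\<forall>w\<in>rank_one_rows (Suc m) (conj_set Q P V) (ecol m). \<exists>h. w = h \<cdot>\<^sub>m erow m) \<and>
       (\<forall>y\<in>carrier_mat (Suc m) 1. \<exists>w\<in>carrier_mat 1 (Suc m). y * erow m + ecol m * w \<in> conj_set Q P V)"
proof -
  let ?n = "Suc m"
  obtain x v0 where x: "x \<in> carrier_mat ?n 1" and v0: "v0 \<in> carrier_mat 1 ?n" and v0x: "v0 * x = 1\<^sub>m 1"
    and le: "Suc (mdim 1 ?n (rank_one_rows ?n V x)) \<le> degF"
    and eq: "Suc (mdim 1 ?n (rank_one_rows ?n V x)) = degF \<Longrightarrow>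
       (\<forall>w\<in>rank_one_rows ?n V x. \<exists>h. w = h \<cdot>\<^sub>m v0) \<and>
       (\<forall>y\<in>carrier_mat ?n 1. \<exists>w\<in>carrier_mat 1 ?n. y * v0 + x * w \<in> V)"
    using good_vector[OF V nf _ deg big] by auto
  obtain Q P where QP: "inv_pair ?n Q P" and Qx: "Q * x = ecol m" and vP: "v0 * P = erow m"
    using change_of_basis[OF x v0 v0x] by blast
  have c: "Q \<in> carrier_mat ?n ?n" "P \<in> carrier_mat ?n ?n" "P * Q = 1\<^sub>m ?n" "Q * P = 1\<^sub>m ?n"
    using QP unfolding inv_pair_def by auto
  have "P * (Q * x) = x" unfolding assoc_mult_mat[OF c(2,1) x, symmetric] c(3) by (rule left_mult_one_mat[OF x])
  then have Pe: "P * ecol m = x" using Qx by simp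
  have Vc: "V \<subseteq> carrier_mat ?n ?n" using V msub_iff by simp
  let ?L = "rank_one_rows ?n V x"
  let ?L1 = "rank_one_rows ?n (conj_set Q P V) (ecol m)"
  have L: "msub 1 ?n ?L" by (rule msub_rank_one_rows[OF V x])
  have Lc: "w \<in> carrier_mat 1 ?n" if "w \<in> ?L" for w using that unfolding rank_one_rows_def by blast
  have mem: "w \<in> ?L1 \<longleftrightarrow> w * Q \<in> ?L" if w: "w \<in> carrier_mat 1 ?n" for w
  proof -
    have ew: "ecol m * w \<in> carrier_mat ?n ?n" by (rule mult_carrier_mat[OF ecol_carrier w])
    have "P * (ecol m * w) * Q = x * (w * Q)"
      unfolding assoc_mult_mat[OF c(2) ecol_carrier w, symmetric] Pe by (rule assoc_mult_mat[OF x w c(1)])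
    then show ?thesis unfolding rank_one_rows_def
      using conj_mem_iff[OF QP Vc ew] w mult_carrier_mat[OF w c(1)] by simp
  qed
  have wQP: "w * Q * P = w" if w: "w \<in> carrier_mat 1 ?n" for w
    unfolding assoc_mult_mat[OF w c(1,2)] c(4) by (rule right_mult_one_mat[OF w])
  have wPQ: "w * P * Q = w" if w: "w \<in> carrier_mat 1 ?n" for w
    unfolding assoc_mult_mat[OF w c(2,1)] c(3) by (rule right_mult_one_mat[OF w])
  have img: "?L1 = (\<lambda>w. w * P) ` ?L"
  proof
    show "(\<lambda>w. w * P) ` ?L \<subseteq> ?L1"
      using mem wPQ Lc mult_carrier_mat[OF _ c(2)] by auto
    show "?L1 \<subseteq> (\<lambda>w. w * P) ` ?L"
    proof
      fix w assume w: "w \<in> ?L1"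
      then have wc: "w \<in> carrier_mat 1 ?n" unfolding rank_one_rows_def by blast
      show "w \<in> (\<lambda>w. w * P) ` ?L" using mem[OF wc] w wQP[OF wc] by (intro image_eqI[of _ _ "w * Q"]) simp_all
    qed
  qed
  have dim: "mdim 1 ?n ?L1 = mdim 1 ?n ?L"
  proof -
    have a: "w * P \<in> carrier_mat 1 ?n" if "w \<in> ?L" for w by (rule mult_carrier_mat[OF Lc[OF that] c(2)])
    have b: "(w + w') * P = w * P + w' * P" if "w \<in> ?L" "w' \<in> ?L" for w w'
      by (rule add_mult_distrib_mat[OF Lc[OF that(1)] Lc[OF that(2)] c(2)])
    have d: "(k \<cdot>\<^sub>m w) * P = k \<cdot>\<^sub>m (w * P)" if "k \<in> F" "w \<in> ?L" for k w
      by (rule smult_mat_mult[OF Lc[OF that(2)] c(2)])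
    have "w = 0\<^sub>m 1 ?n" if "w \<in> ?L" "w * P = 0\<^sub>m 1 ?n" for w
      using wPQ[OF Lc[OF that(1)]] that(2) left_mult_zero_mat[OF c(1)] by simp
    then have "{w \<in> ?L. w * P = 0\<^sub>m 1 ?n} = {0\<^sub>m 1 ?n}"
      using msub_closed(2)[OF L] left_mult_zero_mat[OF c(2)] by auto
    then show ?thesis unfolding img using mat_rank_nullity(1)[OF L, of "\<lambda>w. w * P" 1 ?n, OF a b d] mdim_zero by simp
  qed
  show ?thesis
  proof (rule that[OF QP])
    show "Suc (mdim 1 ?n ?L1) \<le> degF" unfolding dim by (rule le)
    assume "Suc (mdim 1 ?n ?L1) = degF"
    then have E: "\<And>w. w \<in> ?L \<Longrightarrow> \<exists>h. w = h \<cdot>\<^sub>m v0"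
      "\<And>y. y \<in> carrier_mat ?n 1 \<Longrightarrow> \<exists>w\<in>carrier_mat 1 ?n. y * v0 + x * w \<in> V"
      using eq unfolding dim by blast+
    show "(\<forall>w\<in>?L1. \<exists>h. w = h \<cdot>\<^sub>m erow m) \<and>
       (\<forall>y\<in>carrier_mat ?n 1. \<exists>w\<in>carrier_mat 1 ?n. y * erow m + ecol m * w \<in> conj_set Q P V)"
    proof (intro conjI ballI)
      fix w assume "w \<in> ?L1"
      then obtain u where u: "u \<in> ?L" "w = u * P" unfolding img by blast
      obtain h where "u = h \<cdot>\<^sub>m v0" using E(1)[OF u(1)] by blast
      then have "w = h \<cdot>\<^sub>m erow m" using u(2) smult_mat_mult[OF v0 c(2)] vP by simp
      then show "\<exists>h. w = h \<cdot>\<^sub>m erow m" by blast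
    next
      fix y :: "'a mat" assume y: "y \<in> carrier_mat ?n 1"
      have Py: "P * y \<in> carrier_mat ?n 1" by (rule mult_carrier_mat[OF c(2) y])
      obtain w where w: "w \<in> carrier_mat 1 ?n" "P * y * v0 + x * w \<in> V" using E(2)[OF Py] by blast
      have ye: "y * erow m \<in> carrier_mat ?n ?n" by (rule mult_carrier_mat[OF y erow_carrier])
      have wP: "w * P \<in> carrier_mat 1 ?n" by (rule mult_carrier_mat[OF w(1) c(2)])
      have ew: "ecol m * (w * P) \<in> carrier_mat ?n ?n" by (rule mult_carrier_mat[OF ecol_carrier wP])
      have "P * (y * erow m + ecol m * (w * P)) * Q = P * (y * erow m) * Q + P * (ecol m * (w * P)) * Q"
        unfolding mult_add_distrib_mat[OF c(2) ye ew]
        by (rule add_mult_distrib_mat[OF mult_carrier_mat[OF c(2) ye] mult_carrier_mat[OF c(2) ew] c(1)])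
      also have "P * (y * erow m) * Q = P * y * (erow m * Q)"
        unfolding assoc_mult_mat[OF c(2) y erow_carrier, symmetric]
        by (rule assoc_mult_mat[OF Py erow_carrier c(1)])
      also have "erow m * Q = v0" unfolding vP[symmetric] by (rule wPQ[OF v0])
      also have "P * (ecol m * (w * P)) * Q = x * w"
        unfolding assoc_mult_mat[OF c(2) ecol_carrier wP, symmetric] Pe assoc_mult_mat[OF x wP c(1)] wPQ[OF w(1)] ..
      finally have "P * (y * erow m + ecol m * (w * P)) * Q \<in> V" using w(2) by simp
      then show "\<exists>w\<in>carrier_mat 1 ?n. y * erow m + ecol m * w \<in> conj_set Q P V"
        using conj_mem_iff[OF QP Vc add_carrier_mat[OF ew]] wP by blast
    qed
  qed
qed

section \<open>Blocks relative to the last basis vector\<close>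

definition lead :: "nat \<Rightarrow> 'a mat \<Rightarrow> 'a mat" where
  "lead m M = mat m m (\<lambda>p. M $$ p)"

definition last_col :: "nat \<Rightarrow> 'a mat \<Rightarrow> 'a mat" where
  "last_col m M = mat m 1 (\<lambda>(i, j). M $$ (i, m))"

definition last_row :: "nat \<Rightarrow> 'a mat \<Rightarrow> 'a mat" where
  "last_row m M = mat 1 m (\<lambda>(i, j). M $$ (m, j))"

text \<open>With \<open>x = ecol m\<close>, these are the matrices \<open>M\<close> of
  \<open>V\<close> for which \<open>M x\<close> is a right multiple of \<open>x\<close>.\<close>

definition stable_part :: "nat \<Rightarrow> 'a mat set \<Rightarrow> 'a mat set" where
  "stable_part m V = {M \<in> V. last_col m M = 0\<^sub>m m 1}"

definition corner_part :: "nat \<Rightarrow> 'a mat set \<Rightarrow> 'a mat set" where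
  "corner_part m V = {M \<in> stable_part m V. lead m M = 0\<^sub>m m m}"

lemma lead_carrier [simp]: "lead m M \<in> carrier_mat m m"
  and last_col_carrier [simp]: "last_col m M \<in> carrier_mat m 1"
  and last_row_carrier [simp]: "last_row m M \<in> carrier_mat 1 m"
  by (simp_all add: lead_def last_col_def last_row_def)

lemma lead_index [simp]: "i < m \<Longrightarrow> j < m \<Longrightarrow> lead m M $$ (i, j) = M $$ (i, j)"
  and last_col_index [simp]: "i < m \<Longrightarrow> last_col m M $$ (i, 0) = M $$ (i, m)"
  by (simp_all add: lead_def last_col_def)

lemma last_col_zero_iff: "last_col m M = 0\<^sub>m m 1 \<longleftrightarrow> (\<forall>i<m. M $$ (i, m) = 0)"
  and last_row_zero_iff: "last_row m M = 0\<^sub>m 1 m \<longleftrightarrow> (\<forall>j<m. M $$ (m, j) = 0)"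
  and lead_zero_iff: "lead m M = 0\<^sub>m m m \<longleftrightarrow> (\<forall>i<m. \<forall>j<m. M $$ (i, j) = 0)"
  by (auto simp: mat_eq_iff last_col_def last_row_def lead_def)

lemma parts_add:
  assumes "M \<in> carrier_mat (Suc m) (Suc m)" "N \<in> carrier_mat (Suc m) (Suc m)"
  shows "lead m (M + N) = lead m M + lead m N" "last_col m (M + N) = last_col m M + last_col m N"
    "last_row m (M + N) = last_row m M + last_row m N"
  using carrier_matD[OF assms(1)] carrier_matD[OF assms(2)]
  by (auto intro!: eq_matI simp: lead_def last_col_def last_row_def)

lemma parts_smult:
  assumes "M \<in> carrier_mat (Suc m) (Suc m)"
  shows "lead m (k \<cdot>\<^sub>m M) = k \<cdot>\<^sub>m lead m M" "last_col m (k \<cdot>\<^sub>m M) = k \<cdot>\<^sub>m last_col m M"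
    "last_row m (k \<cdot>\<^sub>m M) = k \<cdot>\<^sub>m last_row m M"
  using carrier_matD[OF assms(1)] by (auto intro!: eq_matI simp: lead_def last_col_def last_row_def)

context
  fixes m :: nat and V :: "'a mat set"
  assumes V: "msub (Suc m) (Suc m) V"
begin

text \<open>Rank and nullity applied twice: to the last column, whose values fill at most
  \<open>m d\<close> dimensions, and to the leading block on the kernel of that map.\<close>

lemma stable_corner_subspaces:
  shows "msub (Suc m) (Suc m) (stable_part m V)" "msub m m (lead m ` stable_part m V)"
    "msub (Suc m) (Suc m) (corner_part m V)"
    and dim_split: "mdim (Suc m) (Suc m) V \<le>
      m * degF + mdim m m (lead m ` stable_part m V) + mdim (Suc m) (Suc m) (corner_part m V)"
proof -
  note Vc = msub_closed[OF V]
  have add: "lead m (v + w) = lead m v + lead m w" "last_col m (v + w) = last_col m v + last_col m w"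
    if "v \<in> V" "w \<in> V" for v w
    using parts_add[OF Vc(1)[OF that(1)] Vc(1)[OF that(2)]] by simp_all
  have smult: "lead m (k \<cdot>\<^sub>m v) = k \<cdot>\<^sub>m lead m v" "last_col m (k \<cdot>\<^sub>m v) = k \<cdot>\<^sub>m last_col m v"
    if "v \<in> V" for k v using parts_smult[OF Vc(1)[OF that]] by simp_all
  note rn1 = mat_rank_nullity[OF V, of "last_col m" m 1, OF last_col_carrier add(2) smult(2),
      folded stable_part_def]
  have st: "v \<in> V" if "v \<in> stable_part m V" for v using that unfolding stable_part_def by blast
  have rn1': "msub (Suc m) (Suc m) (stable_part m V)" by (rule rn1(3))
  note rn2 = mat_rank_nullity[OF rn1', of "lead m" m m, OF lead_carrier add(1)[OF st st] smult(1)[OF st],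
      folded corner_part_def]
  show "msub (Suc m) (Suc m) (stable_part m V)" by (rule rn1')
  show "msub m m (lead m ` stable_part m V)" by (rule rn2(2))
  show "msub (Suc m) (Suc m) (corner_part m V)" by (rule rn2(3))
  have "mdim m 1 (last_col m ` V) \<le> m * 1 * degF"
    using mdim_mono[OF rn1(2) msub_carrier] msub_closed(1)[OF rn1(2)] mdim_carrier[of m 1] by auto
  then show "mdim (Suc m) (Suc m) V \<le>
      m * degF + mdim m m (lead m ` stable_part m V) + mdim (Suc m) (Suc m) (corner_part m V)"
    using rn1(1) rn2(1) by simp
qed

lemma corner_part_row:
  assumes "M \<in> corner_part m V"
  obtains w where "w \<in> rank_one_rows (Suc m) V (ecol m)" "M = ecol m * w" "\<And>j. j \<le> m \<Longrightarrow> w $$ (0, j) = M $$ (m, j)"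
proof -
  define w where "w = mat 1 (Suc m) (\<lambda>(i, j). M $$ (m, j))"
  have M: "M \<in> V" "M \<in> carrier_mat (Suc m) (Suc m)"
    using assms msub_closed(1)[OF V] unfolding corner_part_def stable_part_def by auto
  have z: "M $$ (i, j) = 0" if "i < m" "j \<le> m" for i j
    using assms that unfolding corner_part_def stable_part_def last_col_zero_iff lead_zero_iff
    by (cases "j = m") auto
  have e: "M = ecol m * w"
  proof (rule eq_matI)
    fix i j assume "i < dim_row (ecol m * w)" "j < dim_col (ecol m * w)"
    then have "i \<le> m" "j \<le> m" by (auto simp: w_def)
    then show "M $$ (i, j) = (ecol m * w) $$ (i, j)"
      using z[of i j] by (cases "i = m") (simp_all add: w_def del: index_mult_mat(1))
  qed (use carrier_matD[OF M(2)] in \<open>simp_all add: w_def\<close>)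
  moreover have wc: "w \<in> carrier_mat 1 (Suc m)" unfolding w_def by simp
  moreover have wL: "w \<in> rank_one_rows (Suc m) V (ecol m)"
    unfolding rank_one_rows_def mem_Collect_eq e[symmetric] using M(1) wc by blast
  moreover have "w $$ (0, j) = M $$ (m, j)" if "j \<le> m" for j unfolding w_def using that by simp
  ultimately show ?thesis using that by blast
qed

text \<open>The map \<open>w \<mapsto> ecol m * w\<close> writes \<open>w\<close> into the last row
  of a zero matrix and takes \<open>L(ecol m)\<close> bijectively to
  \<open>corner_part m V\<close>.\<close>

lemma dim_corner_part:
  "mdim (Suc m) (Suc m) (corner_part m V) = mdim 1 (Suc m) (rank_one_rows (Suc m) V (ecol m))"
proof -
  let ?L = "rank_one_rows (Suc m) V (ecol m)"
  have L: "msub 1 (Suc m) ?L" by (rule msub_rank_one_rows[OF V ecol_carrier])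
  have Lc: "w \<in> carrier_mat 1 (Suc m)" if "w \<in> ?L" for w using that unfolding rank_one_rows_def by blast
  have a: "ecol m * w \<in> carrier_mat (Suc m) (Suc m)" if "w \<in> ?L" for w
    by (rule mult_carrier_mat[OF ecol_carrier Lc[OF that]])
  have b: "ecol m * (w + w') = ecol m * w + ecol m * w'" if "w \<in> ?L" "w' \<in> ?L" for w w'
    by (rule mult_add_distrib_mat[OF ecol_carrier Lc[OF that(1)] Lc[OF that(2)]])
  have c: "ecol m * (k \<cdot>\<^sub>m w) = k \<cdot>\<^sub>m (ecol m * w)" if "k \<in> F" "w \<in> ?L" for k w
    by (rule mult_smult_F[OF ecol_carrier Lc[OF that(2)] that(1)])
  have idx: "(ecol m * w) $$ (i, j) = (if i = m then w $$ (0, j) else 0)" if "w \<in> ?L" "i \<le> m" "j \<le> m" for w i j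
    using carrier_matD[OF Lc[OF that(1)]] that(2,3) by (simp del: index_mult_mat(1))
  have inj: "w = 0\<^sub>m 1 (Suc m)" if w: "w \<in> ?L" "ecol m * w = 0\<^sub>m (Suc m) (Suc m)" for w
  proof (rule eq_matI)
    fix i j assume "i < dim_row (0\<^sub>m 1 (Suc m) :: 'a mat)" "j < dim_col (0\<^sub>m 1 (Suc m) :: 'a mat)"
    then show "w $$ (i, j) = 0\<^sub>m 1 (Suc m) $$ (i, j)"
      using idx[OF w(1), of m j] unfolding w(2) by simp
  qed (use carrier_matD[OF Lc[OF w(1)]] in simp_all)
  have ker: "{w \<in> ?L. ecol m * w = 0\<^sub>m (Suc m) (Suc m)} = {0\<^sub>m 1 (Suc m)}"
  proof (rule equalityI)
    show "{w \<in> ?L. ecol m * w = 0\<^sub>m (Suc m) (Suc m)} \<subseteq> {0\<^sub>m 1 (Suc m)}" using inj by blast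
    have "ecol m * 0\<^sub>m 1 (Suc m) = 0\<^sub>m (Suc m) (Suc m)" by (rule right_mult_zero_mat[OF ecol_carrier])
    then show "{0\<^sub>m 1 (Suc m)} \<subseteq> {w \<in> ?L. ecol m * w = 0\<^sub>m (Suc m) (Suc m)}"
      using msub_closed(2)[OF L] by blast
  qed
  have "(\<lambda>w. ecol m * w) ` ?L = corner_part m V"
  proof
    show "corner_part m V \<subseteq> (\<lambda>w. ecol m * w) ` ?L" using corner_part_row by blast
    show "(\<lambda>w. ecol m * w) ` ?L \<subseteq> corner_part m V"
    proof
      fix M assume "M \<in> (\<lambda>w. ecol m * w) ` ?L"
      then obtain w where w: "w \<in> ?L" "M = ecol m * w" by blast
      then show "M \<in> corner_part m V"
        unfolding corner_part_def stable_part_def last_col_zero_iff lead_zero_iff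
        using idx[OF w(1)] unfolding rank_one_rows_def by auto
    qed
  qed
  then show ?thesis using mat_rank_nullity(1)[OF L, of "(*) (ecol m)" "Suc m" "Suc m", OF a b c] ker mdim_zero by simp
qed

lemma mult_col_index:
  assumes "M \<in> carrier_mat (Suc m) (Suc m)" "v \<in> carrier_mat (Suc m) 1" "i \<le> m"
  shows "(M * v) $$ (i, 0) = (\<Sum>j<m. M $$ (i, j) * v $$ (j, 0)) + M $$ (i, m) * v $$ (m, 0)"
  using carrier_matD[OF assms(1)] carrier_matD[OF assms(2)] assms(3)
  by (simp add: scalar_prod_def atLeast0LessThan)

lemma mult_row_index:
  assumes "M \<in> carrier_mat (Suc m) (Suc m)" "w \<in> carrier_mat 1 (Suc m)" "j \<le> m"
  shows "(w * M) $$ (0, j) = (\<Sum>i<m. w $$ (0, i) * M $$ (i, j)) + w $$ (0, m) * M $$ (m, j)"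
  using carrier_matD[OF assms(1)] carrier_matD[OF assms(2)] assms(3)
  by (simp add: scalar_prod_def atLeast0LessThan)

lemma
  fixes u v :: "'a mat"
  shows col_eqI: "u \<in> carrier_mat n 1 \<Longrightarrow> v \<in> carrier_mat n 1 \<Longrightarrow> (\<And>i. i < n \<Longrightarrow> u $$ (i, 0) = v $$ (i, 0)) \<Longrightarrow> u = v"
  and row_eqI: "u \<in> carrier_mat 1 n \<Longrightarrow> v \<in> carrier_mat 1 n \<Longrightarrow> (\<And>i. i < n \<Longrightarrow> u $$ (0, i) = v $$ (0, i)) \<Longrightarrow> u = v"
  by (auto intro!: eq_matI)

lemma nofix_no_fixed_column:
  assumes "nofix (Suc m) V" "M \<in> V" "\<And>i. i < m \<Longrightarrow> (\<Sum>j<m. M $$ (i, j) * e j) + M $$ (i, m) = e i"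
  shows "(\<Sum>j<m. M $$ (m, j) * e j) + M $$ (m, m) \<noteq> 1"
proof
  assume last: "(\<Sum>j<m. M $$ (m, j) * e j) + M $$ (m, m) = 1"
  have M: "M \<in> carrier_mat (Suc m) (Suc m)" using msub_closed(1)[OF V assms(2)] .
  define v where "v = mat (Suc m) 1 (\<lambda>(i, j). if i < m then e i else 1)"
  have v: "v \<in> carrier_mat (Suc m) 1" unfolding v_def by simp
  have vi: "v $$ (i, 0) = e i" if "i < m" for i unfolding v_def using that by simp
  have vm: "v $$ (m, 0) = 1" unfolding v_def by simp
  have "M * v = v"
  proof (rule col_eqI[OF mult_carrier_mat[OF M v] v])
    fix i assume "i < Suc m"
    then show "(M * v) $$ (i, 0) = v $$ (i, 0)"
      using mult_col_index[OF M v, of i] assms(3)[of i] last vi vm by (cases "i = m") simp_all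
  qed
  then have "v = 0\<^sub>m (Suc m) 1" using assms(1,2) v unfolding nofix_def by blast
  then show False using vm by simp
qed

text \<open>In \<open>[K 0; R b]\<close> a row fixed by \<open>K\<close> extends by 0. A column
  \<open>v\<close> fixed by \<open>K\<close> extends by \<open>z = inverse (1 - b) R v\<close>, and
  \<open>b \<noteq> 1\<close> because the last basis column is not fixed.\<close>

lemma lead_nofix:
  assumes nf: "nofix (Suc m) V"
  shows "nofix m (lead m ` stable_part m V)"
  unfolding nofix_def
proof (intro ballI conjI impI)
  fix K v assume "K \<in> lead m ` stable_part m V"
  then obtain M where M: "M \<in> V" "K = lead m M" "\<And>i. i < m \<Longrightarrow> M $$ (i, m) = 0"
    unfolding stable_part_def last_col_zero_iff by auto
  have Mc: "M \<in> carrier_mat (Suc m) (Suc m)" using msub_closed(1)[OF V M(1)] .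
  {
    assume v: "v \<in> carrier_mat m 1" "K * v = v"
    have Kv: "(\<Sum>j<m. M $$ (i, j) * v $$ (j, 0)) = v $$ (i, 0)" if "i < m" for i
    proof -
      have "(K * v) $$ (i, 0) = (\<Sum>j<m. M $$ (i, j) * v $$ (j, 0))"
        unfolding M(2) using carrier_matD[OF v(1)] that
        by (simp add: scalar_prod_def atLeast0LessThan lead_def)
      then show ?thesis using v(2) by simp
    qed
    define b where "b = M $$ (m, m)"
    have b: "1 - b \<noteq> 0"
      using nofix_no_fixed_column[OF nf M(1), of "\<lambda>_. 0"] M(3) by (simp add: b_def)
    define r where "r = (\<Sum>j<m. M $$ (m, j) * v $$ (j, 0))"
    define z where "z = inverse (1 - b) * r"
    have z: "r + b * z = z"
    proof -
      have "(1 - b) * z = r" unfolding z_def using b by (simp flip: mult.assoc)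
      then show ?thesis by (simp add: left_diff_distrib algebra_simps)
    qed
    define v' where "v' = mat (Suc m) 1 (\<lambda>(i, j). if i < m then v $$ (i, 0) else z)"
    have v': "v' \<in> carrier_mat (Suc m) 1" unfolding v'_def by simp
    have v'i: "v' $$ (i, 0) = v $$ (i, 0)" if "i < m" for i unfolding v'_def using that by simp
    have v'm: "v' $$ (m, 0) = z" unfolding v'_def by simp
    have "M * v' = v'"
    proof (rule col_eqI[OF mult_carrier_mat[OF Mc v'] v'])
      fix i assume "i < Suc m"
      then show "(M * v') $$ (i, 0) = v' $$ (i, 0)"
        using mult_col_index[OF Mc v', of i] Kv[of i] M(3)[of i] z v'i v'm
        by (cases "i = m") (simp_all add: r_def b_def)
    qed
    then have "v' = 0\<^sub>m (Suc m) 1" using nf M(1) v' unfolding nofix_def by blast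
    then show "v = 0\<^sub>m m 1" using v'i v(1) by (intro col_eqI) auto
  next
    assume w: "v \<in> carrier_mat 1 m" "v * K = v"
    have vK: "(\<Sum>i<m. v $$ (0, i) * M $$ (i, j)) = v $$ (0, j)" if "j < m" for j
    proof -
      have "(v * K) $$ (0, j) = (\<Sum>i<m. v $$ (0, i) * M $$ (i, j))"
        unfolding M(2) using carrier_matD[OF w(1)] that
        by (simp add: scalar_prod_def atLeast0LessThan lead_def)
      then show ?thesis using w(2) by simp
    qed
    define v' where "v' = mat 1 (Suc m) (\<lambda>(i, j). if j < m then v $$ (0, j) else 0)"
    have v': "v' \<in> carrier_mat 1 (Suc m)" unfolding v'_def by simp
    have v'i: "v' $$ (0, i) = v $$ (0, i)" if "i < m" for i unfolding v'_def using that by simp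
    have v'm: "v' $$ (0, m) = 0" unfolding v'_def by simp
    have "v' * M = v'"
    proof (rule row_eqI[OF mult_carrier_mat[OF v' Mc] v'])
      fix j assume "j < Suc m"
      then show "(v' * M) $$ (0, j) = v' $$ (0, j)"
        using mult_row_index[OF Mc v', of j] vK[of j] M(3) v'i v'm
        by (cases "j = m") simp_all
    qed
    then have "v' = 0\<^sub>m 1 (Suc m)" using nf M(1) v' unfolding nofix_def by blast
    then show "v = 0\<^sub>m 1 m" using v'i w(1) by (intro row_eqI) auto
  }
qed

end

section \<open>Optimal spaces\<close>

text \<open>The candidate for the last hyperplane: in the case of equality, this entry is the only
  one of a matrix of \<open>corner_part m V\<close> that can be nonzero.\<close>

definition corners :: "nat \<Rightarrow> 'a mat set \<Rightarrow> 'a set" where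
  "corners m V = (\<lambda>M. M $$ (m, m)) ` corner_part m V"

lemma joint_index:
  assumes "M \<in> joint n H"
  shows "M \<in> carrier_mat n n" "\<And>i j. i < n \<Longrightarrow> j < i \<Longrightarrow> M $$ (i, j) = 0" "\<And>i. i < n \<Longrightarrow> M $$ (i, i) \<in> H i"
  using assms unfolding joint_def upper_triangular_def by auto

lemma jointI:
  assumes "M \<in> carrier_mat n n" "\<And>i j. i < n \<Longrightarrow> j < i \<Longrightarrow> M $$ (i, j) = 0" "\<And>i. i < n \<Longrightarrow> M $$ (i, i) \<in> H i"
  shows "M \<in> joint n H"
  using assms unfolding joint_def upper_triangular_def by auto

lemma hyper_zero: "hyper H \<Longrightarrow> 0 \<in> H"
  unfolding hyper_def dsub_iff by blast

lemma affine_zero_avoiding_one: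
  assumes "\<And>s. s \<in> F \<Longrightarrow> a + s * b \<noteq> 1" "a \<in> F" "b \<in> F"
  shows "b = 0"
proof (rule ccontr)
  assume b: "b \<noteq> 0"
  have "(1 - a) * inverse b \<in> F" using assms F_diff F_mult F_inverse by simp
  from assms(1)[OF this] show False using b by (simp add: mult.assoc)
qed

text \<open>The column \<open>(E, 1)\<close> is never fixed by a matrix of \<open>V\<close>. With the last column
  \<open>E - K E\<close> this condition is affine in the leading block \<open>K\<close>, and quadratic in \<open>E\<close>.\<close>

lemma joint_structure:
  fixes m :: nat and V :: "'a mat set" and H' :: "nat \<Rightarrow> 'a set"
  assumes V: "msub (Suc m) (Suc m) V" and nf: "nofix (Suc m) V" and nq: "\<not> quadratic_type F"
    and deg: "degF \<ge> 2" and t: "t0 \<in> F" "t0 \<noteq> 0" "t0 \<noteq> 1"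
    and H: "hyper (corners m V)"
    and row0: "\<And>M. M \<in> corner_part m V \<Longrightarrow> last_row m M = 0\<^sub>m 1 m"
    and cols: "\<And>C. \<exists>M\<in>V. lead m M = 0\<^sub>m m m \<and> (\<forall>i<m. M $$ (i, m) = C i)"
    and ind: "lead m ` stable_part m V = joint m H'"
    and H': "\<And>i. i < m \<Longrightarrow> hyper (H' i)"
  shows "V = joint (Suc m) (H'(m := corners m V))"
proof -
  define HH where "HH = corners m V"
  note HH = H[folded HH_def]
  note Vc = msub_closed[OF V]
  have g0: "coef HH 0 = 0" using coef_F[OF HH F_zero] .
  have g1: "coef HH 1 = 1" using coef_F[OF HH F_one] .
  have gF: "coef HH x \<in> F" for x by (rule coef(1)[OF HH])
  note gadd = coef_add[OF HH] and gdiff = coef_diff[OF HH] and gsc = coef_scale[OF HH]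
  have nondeg: "x = 0" if "\<And>e. coef HH (x * e) = 0" for x
    using that[of "inverse x"] g1 by (cases "x = 0") simp_all
  have corner: "M \<in> corner_part m V \<longleftrightarrow> M \<in> V \<and> (\<forall>i<m. \<forall>j\<le>m. M $$ (i, j) = 0)" for M
    unfolding corner_part_def stable_part_def last_col_zero_iff lead_zero_iff
    by (auto simp: le_less)
  have corner_row: "M $$ (m, j) = 0" if "M \<in> corner_part m V" "j < m" for M j
    using row0[OF that(1)] that(2) unfolding last_row_zero_iff by blast
  have corner_mem: "coef HH (M $$ (m, m)) = 0" if "M \<in> corner_part m V" for M
    using coef_zero_iff[OF HH] that unfolding HH_def corners_def by blast
  have diffV: "M - N \<in> V" if "M \<in> V" "N \<in> V" for M N using msub_diff[OF V that] .
  have idx: "(M - N) $$ (i, j) = M $$ (i, j) - N $$ (i, j)" "(M + N) $$ (i, j) = M $$ (i, j) + N $$ (i, j)"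
      "(k \<cdot>\<^sub>m M) $$ (i, j) = k * M $$ (i, j)"
    if "M \<in> V" "N \<in> V" "i \<le> m" "j \<le> m" for M N i j k
    using carrier_matD[OF Vc(1)[OF that(1)]] carrier_matD[OF Vc(1)[OF that(2)]] that(3,4) by simp_all
  \<comment> \<open>The upper \<open>m\<close> rows determine the last one up to \<open>HH\<close>
    in the corner: the difference of two such matrices is in \<open>corner_part m V\<close>.\<close>
  have uniq: "(\<forall>j<m. M $$ (m, j) = N $$ (m, j)) \<and> coef HH (M $$ (m, m)) = coef HH (N $$ (m, m))"
    if MN: "M \<in> V" "N \<in> V" and e: "\<And>i j. i < m \<Longrightarrow> j \<le> m \<Longrightarrow> M $$ (i, j) = N $$ (i, j)" for M N
  proof -
    have "M - N \<in> corner_part m V" unfolding corner using diffV[OF MN] e idx(1)[OF MN] by simp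
    then show ?thesis using corner_row[of "M - N"] corner_mem[of "M - N"] idx(1)[OF MN] gdiff by simp
  qed
  \<comment> \<open>Only the last coordinate modulo \<open>HH\<close> matters: an excess in
    \<open>HH\<close> is removed by subtracting a matrix of \<open>corner_part m V\<close>, which
    leaves the other coordinates alone.\<close>
  have nofixed: "coef HH ((\<Sum>j<m. M $$ (m, j) * E j) + M $$ (m, m)) \<noteq> 1"
    if M: "M \<in> V" and fixed: "\<And>i. i < m \<Longrightarrow> (\<Sum>j<m. M $$ (i, j) * E j) + M $$ (i, m) = E i" for M E
  proof
    assume one: "coef HH ((\<Sum>j<m. M $$ (m, j) * E j) + M $$ (m, m)) = 1"
    define h where "h = (\<Sum>j<m. M $$ (m, j) * E j) + M $$ (m, m) - 1"
    have "coef HH h = 0" unfolding h_def using one gdiff g1 by simp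
    then have "h \<in> HH" using coef_zero_iff[OF HH] by blast
    then obtain Z where Z: "Z \<in> corner_part m V" "h = Z $$ (m, m)" unfolding HH_def corners_def by blast
    have ZV: "Z \<in> V" and Z0: "\<And>i j. i < m \<Longrightarrow> j \<le> m \<Longrightarrow> Z $$ (i, j) = 0" using Z corner by auto
    have "(\<Sum>j<m. (M - Z) $$ (m, j) * E j) + (M - Z) $$ (m, m) \<noteq> 1"
    proof (rule nofix_no_fixed_column[OF V nf diffV[OF M ZV]])
      fix i assume i: "i < m"
      have "(M - Z) $$ (i, j) = M $$ (i, j)" if "j \<le> m" for j
        using idx(1)[OF M ZV, of i j] Z0[OF i that] i that by simp
      then show "(\<Sum>j<m. (M - Z) $$ (i, j) * E j) + (M - Z) $$ (i, m) = E i" using fixed[OF i] by simp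
    qed
    moreover have "(M - Z) $$ (m, j) = M $$ (m, j)" if "j < m" for j
      using idx(1)[OF M ZV, of m j] corner_row[OF Z(1) that] that by simp
    ultimately show False using idx(1)[OF M ZV, of m m] by (simp add: Z(2)[symmetric] h_def)
  qed
  \<comment> \<open>\<open>N C\<close> and \<open>L K\<close> are arbitrary lifts of a last column
    and of a leading block. By \<open>uniq\<close>, \<open>rho\<close> is additive and both
    \<open>rho\<close> and \<open>alpha\<close> are homogeneous, although the lifts are chosen
    without regard to linearity.\<close>
  have "\<exists>N. \<forall>C. N C \<in> V \<and> lead m (N C) = 0\<^sub>m m m \<and> (\<forall>i<m. N C $$ (i, m) = C i)"
    using cols by (intro choice) blast
  then obtain N where N: "\<And>C. N C \<in> V" "\<And>C i j. i < m \<Longrightarrow> j < m \<Longrightarrow> N C $$ (i, j) = 0"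
    "\<And>C i. i < m \<Longrightarrow> N C $$ (i, m) = C i" unfolding lead_zero_iff by blast
  have "\<forall>K\<in>joint m H'. \<exists>M. M \<in> stable_part m V \<and> lead m M = K" unfolding ind[symmetric] by auto
  then obtain L where L': "\<And>K. K \<in> joint m H' \<Longrightarrow> L K \<in> stable_part m V \<and> lead m (L K) = K" by metis
  have L: "L K \<in> V" "\<And>i j. i < m \<Longrightarrow> j < m \<Longrightarrow> L K $$ (i, j) = K $$ (i, j)" "\<And>i. i < m \<Longrightarrow> L K $$ (i, m) = 0"
    if "K \<in> joint m H'" for K
  proof -
    show "L K \<in> V" "\<And>i. i < m \<Longrightarrow> L K $$ (i, m) = 0"
      using L'[OF that] unfolding stable_part_def last_col_zero_iff by auto
    show "L K $$ (i, j) = K $$ (i, j)" if "i < m" "j < m" for i j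
      using L'[OF \<open>K \<in> joint m H'\<close>] lead_index[OF that, of "L K"] by simp
  qed
  define rho where "rho C j = N C $$ (m, j)" for C j
  define alpha where "alpha C = coef HH (N C $$ (m, m))" for C
  have NE: "N C $$ (i, j) = (if j = m then C i else 0)" if "i < m" "j \<le> m" for C i j
    using N(2)[OF that(1), of j C] N(3)[OF that(1), of C] that(2) by (cases "j = m") auto
  have N_cong: "rho C j = rho C' j \<and> alpha C = alpha C'" if "\<And>i. i < m \<Longrightarrow> C i = C' i" "j < m" for C C' j
    using uniq[OF N(1)[of C] N(1)[of C']] NE that unfolding rho_def alpha_def by simp
  have alpha_cong: "alpha C = alpha C'" if "\<And>i. i < m \<Longrightarrow> C i = C' i" for C C'
    using uniq[OF N(1)[of C] N(1)[of C']] NE that unfolding alpha_def by simp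
  have rho_add: "rho (\<lambda>i. C i + C' i) j = rho C j + rho C' j" if "j < m" for C C' j
    using uniq[OF N(1)[of "\<lambda>i. C i + C' i"] Vc(3)[OF N(1)[of C] N(1)[of C']]] NE that idx(2)[OF N(1) N(1)]
    unfolding rho_def by simp
  have scale: "(j < m \<longrightarrow> rho (\<lambda>i. k * C i) j = k * rho C j) \<and> alpha (\<lambda>i. k * C i) = k * alpha C" if k: "k \<in> F" for k C j
    using uniq[OF N(1)[of "\<lambda>i. k * C i"] Vc(4)[OF k N(1)[of C]]] NE idx(3)[OF N(1) N(1)] gsc[OF k]
    unfolding rho_def alpha_def by simp
  define app where "app K E i = (\<Sum>j<m. K $$ (i, j) * E j)" for K :: "'a mat" and E i
  have app_scale: "app K (\<lambda>i. s * E i) i = s * app K E i" if "s \<in> F" for K E i s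
  proof -
    have "K $$ (i, j) * (s * E j) = s * (K $$ (i, j) * E j)" for j
      using F_comm[OF that, of "K $$ (i, j)"] by (metis mult.assoc)
    then show ?thesis unfolding app_def by (simp add: sum_distrib_left)
  qed
  have pair_scale: "(\<Sum>j<m. f j * (s * E j)) = s * (\<Sum>j<m. f j * E j)" if "s \<in> F" for f E and s :: 'a
  proof -
    have "f j * (s * E j) = s * (f j * E j)" for j using F_comm[OF that, of "f j"] by (metis mult.assoc)
    then show ?thesis by (simp add: sum_distrib_left)
  qed
  define kap where "kap K = coef HH (L K $$ (m, m))" for K
  \<comment> \<open>The matrix \<open>N E + s (L K - N (K E))\<close> has leading block
    \<open>s K\<close> and last column \<open>E - s K E\<close>, so its upper rows fix
    \<open>(E, 1)\<close>. In the last row this leaves a function affine in \<open>s\<close> that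
    avoids 1.\<close>
  have main: "coef HH (\<Sum>j<m. rho E j * E j) + alpha E \<noteq> 1 \<and>
      coef HH (\<Sum>j<m. L K $$ (m, j) * E j) - coef HH (\<Sum>j<m. rho (app K E) j * E j) + kap K - alpha (app K E) = 0"
    if K: "K \<in> joint m H'" for K E
  proof -
    define D where "D = L K - N (app K E)"
    have DV: "D \<in> V" unfolding D_def by (rule diffV[OF L(1)[OF K] N(1)])
    have Dij: "D $$ (i, j) = K $$ (i, j)" "D $$ (i, m) = - app K E i" if "i < m" "j < m" for i j
      unfolding D_def using idx(1)[OF L(1)[OF K] N(1)] L(2,3)[OF K] N(2,3) that by simp_all
    have Dm: "D $$ (m, j) = L K $$ (m, j) - N (app K E) $$ (m, j)" if "j \<le> m" for j
      unfolding D_def using idx(1)[OF L(1)[OF K] N(1)] that by simp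
    define a where "a = coef HH (\<Sum>j<m. rho E j * E j) + alpha E"
    define b where "b = coef HH (\<Sum>j<m. L K $$ (m, j) * E j) - coef HH (\<Sum>j<m. rho (app K E) j * E j) + kap K - alpha (app K E)"
    have ne: "a + s * b \<noteq> 1" if s: "s \<in> F" for s
    proof -
      define M where "M = N E + s \<cdot>\<^sub>m D"
      have sD: "s \<cdot>\<^sub>m D \<in> V" by (rule Vc(4)[OF s DV])
      have MV: "M \<in> V" unfolding M_def by (rule Vc(3)[OF N(1) sD])
      have Mij: "M $$ (i, j) = N E $$ (i, j) + s * D $$ (i, j)" if "i \<le> m" "j \<le> m" for i j
        unfolding M_def using idx(2)[OF N(1) sD that] idx(3)[OF DV DV that] by simp
      have "coef HH ((\<Sum>j<m. M $$ (m, j) * E j) + M $$ (m, m)) \<noteq> 1"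
      proof (rule nofixed[OF MV])
        fix i assume i: "i < m"
        have "(\<Sum>j<m. M $$ (i, j) * E j) = s * app K E i"
          unfolding app_def sum_distrib_left using i Mij Dij(1) N(2)
          by (intro sum.cong) (simp_all add: mult.assoc)
        moreover have "M $$ (i, m) = E i - s * app K E i" using Mij[of i m] i Dij(2)[OF i i] N(3)[OF i] by simp
        ultimately show "(\<Sum>j<m. M $$ (i, j) * E j) + M $$ (i, m) = E i" by simp
      qed
      moreover have "(\<Sum>j<m. M $$ (m, j) * E j) =
          (\<Sum>j<m. rho E j * E j) + s * ((\<Sum>j<m. L K $$ (m, j) * E j) - (\<Sum>j<m. rho (app K E) j * E j))"
        unfolding sum_distrib_left sum.distrib[symmetric] sum_subtractf[symmetric]
        using Mij Dm unfolding rho_def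
        by (intro sum.cong) (simp_all add: left_diff_distrib right_diff_distrib distrib_right mult.assoc)
      moreover have "M $$ (m, m) = N E $$ (m, m) + s * (L K $$ (m, m) - N (app K E) $$ (m, m))"
        using Mij[of m m] Dm[of m] by simp
      ultimately show ?thesis
        unfolding a_def b_def alpha_def kap_def
        by (simp add: gadd gdiff gsc[OF s] algebra_simps)
    qed
    have "a \<in> F" "b \<in> F" unfolding a_def b_def alpha_def kap_def using gF by (auto intro!: F_add F_diff)
    then have "b = 0" using affine_zero_avoiding_one ne by blast
    moreover have "a \<noteq> 1" using ne[OF F_zero] by simp
    ultimately show ?thesis unfolding a_def b_def by blast
  qed
  have split: "kap K = 0 \<and> coef HH (\<Sum>j<m. rho (app K E) j * E j) = 0 \<and>
      coef HH (\<Sum>j<m. L K $$ (m, j) * E j) = alpha (app K E)" if K: "K \<in> joint m H'" for K E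
  proof -
    define a b c where "a = coef HH (\<Sum>j<m. L K $$ (m, j) * E j)"
      and "b = coef HH (\<Sum>j<m. rho (app K E) j * E j)" and "c = alpha (app K E)"
    \<comment> \<open>Replacing \<open>E\<close> by \<open>s E\<close> separates the terms by their
      degree in \<open>s\<close>; the values 0, 1 and \<open>t0\<close> suffice for degree
      two.\<close>
    have poly: "s * a - s * (s * b) + kap K - s * c = 0" if s: "s \<in> F" for s
    proof -
      have "alpha (app K (\<lambda>i. s * E i)) = s * c" unfolding c_def app_scale[OF s, abs_def]
        using scale[OF s] by blast
      moreover have "coef HH (\<Sum>j<m. L K $$ (m, j) * (s * E j)) = s * a"
        unfolding a_def pair_scale[OF s] by (rule gsc[OF s])
      moreover have "coef HH (\<Sum>j<m. rho (app K (\<lambda>i. s * E i)) j * (s * E j)) = s * (s * b)"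
      proof -
        have "(\<Sum>j<m. rho (app K (\<lambda>i. s * E i)) j * (s * E j)) = s * (\<Sum>j<m. s * (rho (app K E) j * E j))"
          unfolding pair_scale[OF s] app_scale[OF s, abs_def] using scale[OF s, of _ "app K E"]
          by (intro arg_cong[of _ _ "(*) s"] sum.cong) (simp_all add: mult.assoc)
        then show ?thesis unfolding b_def sum_distrib_left[symmetric] by (simp add: gsc[OF s])
      qed
      ultimately show ?thesis using main[OF K, of "\<lambda>i. s * E i"] by simp
    qed
    have k: "kap K = 0" using poly[OF F_zero] by simp
    have 1: "a - c = b" using poly[OF F_one] k by (simp add: algebra_simps)
    have "t0 * (a - c) - t0 * (t0 * b) = 0" using poly[OF t(1)] k by (simp add: algebra_simps)
    then have "t0 * ((1 - t0) * b) = 0" unfolding 1 by (simp add: algebra_simps)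
    then have "b = 0" using t by simp
    then show ?thesis using k 1 unfolding a_def b_def c_def by simp
  qed
  define dlt where "dlt i c = (\<lambda>i'. if i' = i then c else (0 :: 'a))" for i :: nat and c
  have rho_at_add: "rho (dlt i (c + c')) l = rho (dlt i c) l + rho (dlt i c') l" if "l < m" for i c c' l
    using rho_add[OF that, of "dlt i c" "dlt i c'"] by (simp add: dlt_def if_distrib cong: if_cong)
  have rho_at_scale: "rho (dlt i (k * c)) l = k * rho (dlt i c) l" if "l < m" "k \<in> F" for i c k l
  proof -
    have "(\<lambda>i'. k * dlt i c i') = dlt i (k * c)" unfolding dlt_def by auto
    then show ?thesis using scale[OF that(2), of l "dlt i c"] that(1) by simp
  qed
  have diag: "coef HH (\<Sum>l<m. rho (dlt i (k * E i)) l * E l) = 0" if "i < m" "k \<in> H' i" for i k E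
  proof -
    have S: "single m m (i, i) k \<in> joint m H'"
      using that hyper_zero[OF H'] by (intro jointI) auto
    have "app (single m m (i, i) k) E i' = dlt i (k * E i) i'" if "i' < m" for i'
    proof -
      have "app (single m m (i, i) k) E i' = (\<Sum>j<m. if j = i then (if i' = i then k * E i else 0) else 0)"
        unfolding app_def using that \<open>i < m\<close> by (intro sum.cong) auto
      then show ?thesis using \<open>i < m\<close> by (simp add: dlt_def)
    qed
    then have "rho (app (single m m (i, i) k) E) l = rho (dlt i (k * E i)) l" if "l < m" for l
      using N_cong that by blast
    then show ?thesis using split[OF S, of E] by simp
  qed
  have sum_at: "(\<Sum>l<m. f l * dlt i e l) = f i * e" if "i < m" for f i and e :: 'a
  proof -
    have "(\<Sum>l<m. f l * dlt i e l) = (\<Sum>l<m. if l = i then f i * e else 0)"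
      by (intro sum.cong) (auto simp: dlt_def)
    then show ?thesis using that by simp
  qed
  \<comment> \<open>The diagonal part is an isotropic map, which vanishes outside quadratic type.
    Off the diagonal polarization is enough: the condition for \<open>E\<close> supported on
    \<open>i\<close> and \<open>l\<close>, minus that for its component at \<open>i\<close>, leaves
    a nondegenerate pairing.\<close>
  have rho_at: "rho (dlt i c) l = 0" if il: "i < m" "l < m" for i c l
  proof (cases "l = i")
    case True
    show ?thesis unfolding True
    proof (rule isotropic_map_zero[OF HH H'[OF il(1)], of "\<lambda>c. rho (dlt i c) i"])
      show "rho (dlt i (c + c')) i = rho (dlt i c) i + rho (dlt i c') i" for c c'
        by (rule rho_at_add[OF il(1)])
      show "rho (dlt i (k * c)) i = k * rho (dlt i c) i" if "k \<in> F" for k c by (rule rho_at_scale[OF il(1) that])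
      fix k e assume k: "k \<in> H' i"
      have "coef HH (rho (dlt i (k * e)) i * e) = 0"
        using diag[OF il(1) k, of "dlt i e"] sum_at[OF il(1), of "rho (dlt i (k * dlt i e i))" e]
        by (simp add: dlt_def)
      then show "rho (dlt i (k * e)) i * e \<in> HH" using coef_zero_iff[OF HH] by blast
    qed (rule nq)
  next
    case False
    have "0 < ddim (H' i)" "dsub (H' i)" using H'[OF il(1)] deg unfolding hyper_def by auto
    then obtain k where k: "k \<in> H' i" "k \<noteq> 0" using ddim_pos by blast
    show ?thesis
    proof (rule nondeg)
      fix e'
      \<comment> \<open>Any \<open>c\<close> has the form \<open>k * e\<close> for one nonzero
        \<open>k\<close> in \<open>H' i\<close>, which exists because
        \<open>degF \<ge> 2\<close>.\<close>
      define e where "e = inverse k * c"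
      have ke: "k * e = c" unfolding e_def using k by (simp flip: mult.assoc)
      define E where "E = (\<lambda>j. dlt i e j + dlt l e' j)"
      have Ei: "E i = e" unfolding E_def dlt_def using False by simp
      have "(\<Sum>j<m. rho (dlt i c) j * E j) = rho (dlt i c) i * e + rho (dlt i c) l * e'"
        unfolding E_def distrib_left sum.distrib sum_at[OF il(1)] sum_at[OF il(2)] ..
      moreover have "(\<Sum>j<m. rho (dlt i c) j * dlt i e j) = rho (dlt i c) i * e" by (rule sum_at[OF il(1)])
      moreover have "coef HH (\<Sum>j<m. rho (dlt i c) j * E j) = 0" using diag[OF il(1) k(1), of E] unfolding Ei ke .
      moreover have "coef HH (\<Sum>j<m. rho (dlt i c) j * dlt i e j) = 0"
        using diag[OF il(1) k(1), of "dlt i e"] ke by (simp add: dlt_def)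
      ultimately show "coef HH (rho (dlt i c) l * e') = 0" by (simp add: gadd)
    qed
  qed
  have rho0: "rho C l = 0" if l: "l < m" for C l
  proof -
    have "rho (\<lambda>i. if i < p then C i else 0) l = 0" if "p \<le> m" for p
      using that
    proof (induction p)
      case 0
      show ?case using scale[OF F_zero, of l C] l by simp
    next
      case (Suc p)
      have "(\<lambda>i. if i < Suc p then C i else 0) = (\<lambda>i. (if i < p then C i else 0) + dlt p (C p) i)"
        unfolding dlt_def by (auto simp: less_Suc_eq)
      then show ?case using rho_add[OF l] rho_at[of p l] Suc l by simp
    qed
    from this[of m] show ?thesis using N_cong[of "\<lambda>i. if i < m then C i else 0" C l] l by simp
  qed
  have zero_joint: "0\<^sub>m m m \<in> joint m H'" using hyper_zero[OF H'] by (intro jointI) auto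
  \<comment> \<open>With \<open>rho\<close> gone, \<open>main\<close> says that \<open>alpha\<close>
    avoids 1, and a homogeneous function avoiding 1 vanishes.\<close>
  have alpha0: "alpha C = 0" for C
  proof (rule ccontr)
    assume "alpha C \<noteq> 0"
    moreover have a: "inverse (alpha C) \<in> F" using gF F_inverse unfolding alpha_def by blast
    ultimately have "alpha (\<lambda>i. inverse (alpha C) * C i) = 1" using scale[OF a, of _ C] by simp
    then show False using main[OF zero_joint, of "\<lambda>i. inverse (alpha C) * C i"] rho0 g0 by simp
  qed
  have Lrow: "L K $$ (m, j) = 0" if K: "K \<in> joint m H'" and j: "j < m" for K j
  proof (rule nondeg)
    fix e
    have "coef HH (\<Sum>l<m. L K $$ (m, l) * dlt j e l) = 0" using split[OF K] alpha0 by simp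
    then show "coef HH (L K $$ (m, j) * e) = 0" unfolding sum_at[OF j] .
  qed
  \<comment> \<open>Together with \<open>uniq\<close> this pins down the last row of every matrix of
    \<open>V\<close>; together with \<open>corner_part m V\<close> it supplies all matrices of the
    joint.\<close>
  have model: "\<exists>M'\<in>V. (\<forall>i<m. \<forall>j\<le>m. M' $$ (i, j) = M $$ (i, j)) \<and> (\<forall>j<m. M' $$ (m, j) = 0) \<and> coef HH (M' $$ (m, m)) = 0"
    if "lead m M \<in> joint m H'" for M
  proof (intro bexI conjI allI impI)
    let ?M = "L (lead m M) + N (\<lambda>i. M $$ (i, m))"
    note LN = L(1)[OF that] N(1)[of "\<lambda>i. M $$ (i, m)"]
    show "?M \<in> V" by (rule Vc(3)[OF LN])
    show "?M $$ (i, j) = M $$ (i, j)" if "i < m" "j \<le> m" for i j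
      using idx(2)[OF LN, of i j] that L(2,3)[OF \<open>lead m M \<in> joint m H'\<close>] NE[OF that] by (cases "j = m") auto
    show "?M $$ (m, j) = 0" if "j < m" for j
      using idx(2)[OF LN, of m j] that Lrow[OF \<open>lead m M \<in> joint m H'\<close>] rho0[OF that, of "\<lambda>i. M $$ (i, m)"]
      unfolding rho_def by simp
    show "coef HH (?M $$ (m, m)) = 0"
      using idx(2)[OF LN, of m m] gadd split[OF \<open>lead m M \<in> joint m H'\<close>] alpha0[of "\<lambda>i. M $$ (i, m)"]
      unfolding alpha_def kap_def by simp
  qed
  show ?thesis unfolding HH_def[symmetric]
  proof
    show "V \<subseteq> joint (Suc m) (H'(m := HH))"
    proof
      fix M assume M: "M \<in> V"
      let ?N = "N (\<lambda>i. M $$ (i, m))"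
      have "M - ?N \<in> stable_part m V"
        unfolding stable_part_def last_col_zero_iff using diffV[OF M N(1)] idx(1)[OF M N(1)] N(3) by simp
      then have "lead m (M - ?N) \<in> joint m H'" unfolding ind[symmetric] by blast
      moreover have "lead m (M - ?N) = lead m M"
        using idx(1)[OF M N(1)] N(2) by (intro eq_matI) (auto simp: lead_def)
      ultimately have lM: "lead m M \<in> joint m H'" by simp
      then obtain M' where M': "M' \<in> V" "\<forall>i<m. \<forall>j\<le>m. M' $$ (i, j) = M $$ (i, j)"
        "\<forall>j<m. M' $$ (m, j) = 0" "coef HH (M' $$ (m, m)) = 0" using model by blast
      have u: "\<forall>j<m. M $$ (m, j) = 0" "M $$ (m, m) \<in> HH"
        using uniq[OF M M'(1)] M' coef_zero_iff[OF HH] by auto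
      show "M \<in> joint (Suc m) (H'(m := HH))"
      proof (rule jointI[OF Vc(1)[OF M]])
        fix i j assume ij: "i < Suc m" "j < i"
        show "M $$ (i, j) = 0"
        proof (cases "i = m")
          case False
          then have "lead m M $$ (i, j) = 0" using joint_index(2)[OF lM] ij by auto
          then show ?thesis using ij False by simp
        qed (use u ij in auto)
      next
        fix i assume "i < Suc m"
        then show "M $$ (i, i) \<in> (H'(m := HH)) i"
          using joint_index(3)[OF lM, of i] u by (cases "i = m") auto
      qed
    qed
    show "joint (Suc m) (H'(m := HH)) \<subseteq> V"
    proof
      fix M assume M: "M \<in> joint (Suc m) (H'(m := HH))"
      note Mj = joint_index[OF M]
      have "lead m M \<in> joint m H'"
      proof (rule jointI)
        show "lead m M $$ (i, i) \<in> H' i" if "i < m" for i using Mj(3)[of i] that by simp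
      qed (use Mj(2) in auto)
      then obtain M' where M': "M' \<in> V" "\<forall>i<m. \<forall>j\<le>m. M' $$ (i, j) = M $$ (i, j)"
        "\<forall>j<m. M' $$ (m, j) = 0" "coef HH (M' $$ (m, m)) = 0" using model by blast
      have "coef HH (M $$ (m, m)) = 0" using Mj(3)[of m] coef_zero_iff[OF HH] by simp
      then have "coef HH (M $$ (m, m) - M' $$ (m, m)) = 0" unfolding gdiff M'(4) by simp
      then have "M $$ (m, m) - M' $$ (m, m) \<in> HH" using coef_zero_iff[OF HH] by blast
      then obtain Z where Z: "Z \<in> corner_part m V" "M $$ (m, m) - M' $$ (m, m) = Z $$ (m, m)"
        unfolding HH_def corners_def by blast
      have ZV: "Z \<in> V" "\<And>i j. i < m \<Longrightarrow> j \<le> m \<Longrightarrow> Z $$ (i, j) = 0" using Z corner by auto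
      have "M = M' + Z"
      proof (rule eq_matI)
        fix i j assume "i < dim_row (M' + Z)" "j < dim_col (M' + Z)"
        then have ij: "i \<le> m" "j \<le> m" using carrier_matD[OF Vc(1)[OF ZV(1)]] by auto
        show "M $$ (i, j) = (M' + Z) $$ (i, j)"
        proof (cases "i < m")
          case True
          then show ?thesis using idx(2)[OF M'(1) ZV(1) ij] M'(2) ZV(2) ij by simp
        next
          case False
          then have i: "i = m" using ij by simp
          show ?thesis
          proof (cases "j < m")
            case True
            then show ?thesis using idx(2)[OF M'(1) ZV(1) ij] M'(3) corner_row[OF Z(1) True] Mj(2)[of m j] i by simp
          next
            case False
            then have "j = m" using ij by simp
            then show ?thesis using idx(2)[OF M'(1) ZV(1) ij] Z(2)[symmetric] i by simp
          qed
        qed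
      qed (use carrier_matD[OF Vc(1)[OF ZV(1)]] carrier_matD[OF Mj(1)] in simp_all)
      then show "M \<in> V" using Vc(3)[OF M'(1) ZV(1)] by simp
    qed
  qed
qed

text \<open>In closed form \<open>d n (n - 1) / 2 + n (d - 1)\<close> for \<open>d = degF\<close>;
  the recursion follows the three terms of \<open>dim_split\<close>.\<close>

fun optdim :: "nat \<Rightarrow> nat" where
  "optdim 0 = 0"
| "optdim (Suc m) = optdim m + m * degF + (degF - 1)"

lemma degree_at_least_three: "\<not> quadratic_type F \<Longrightarrow> degF \<ge> 3"
proof -
  assume nq: "\<not> quadratic_type F"
  have "degF \<ge> 1" using ddim_mono[OF dsub_F dsub_UNIV] ddim_F ddim_UNIV by simp
  moreover have "degF \<noteq> 1" using nq unfolding quadratic_type_def by blast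
  moreover have "degF \<noteq> 2" using nq quadratic_type_degree_two by blast
  ultimately show ?thesis by simp
qed

lemma third_element:
  assumes "infinite F \<or> 3 \<le> card F"
  obtains t where "t \<in> F" "t \<noteq> 0" "t \<noteq> 1"
proof -
  have "\<not> F \<subseteq> {0, 1}"
  proof
    assume s: "F \<subseteq> {0, 1}"
    then have "finite F" using finite_subset by blast
    moreover have "card F \<le> 2" using card_mono[OF _ s] by simp
    ultimately show False using assms by simp
  qed
  then show ?thesis using that by blast
qed

text \<open>Conjugation by such a matrix acts on the leading block without moving the last basis
  column and row.\<close>

definition bordered :: "nat \<Rightarrow> 'a mat \<Rightarrow> 'a mat" where
  "bordered m Q = four_block_mat Q (0\<^sub>m m 1) (0\<^sub>m 1 m) (1\<^sub>m 1)"

lemma bordered_inv_pair: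
  assumes "inv_pair m Q P"
  shows "inv_pair (Suc m) (bordered m Q) (bordered m P)"
proof -
  have c: "Q \<in> carrier_mat m m" "P \<in> carrier_mat m m" "Q * P = 1\<^sub>m m" "P * Q = 1\<^sub>m m"
    using assms unfolding inv_pair_def by auto
  have prod: "bordered m A * bordered m B = 1\<^sub>m (Suc m)"
    if AB: "A \<in> carrier_mat m m" "B \<in> carrier_mat m m" "A * B = 1\<^sub>m m" for A B
  proof -
    have z: "(0\<^sub>m m 1 :: 'a mat) \<in> carrier_mat m 1" "(0\<^sub>m 1 m :: 'a mat) \<in> carrier_mat 1 m"
      "(1\<^sub>m 1 :: 'a mat) \<in> carrier_mat 1 1" by simp_all
    have "bordered m A * bordered m B = four_block_mat (A * B + 0\<^sub>m m 1 * 0\<^sub>m 1 m) (A * 0\<^sub>m m 1 + 0\<^sub>m m 1 * 1\<^sub>m 1)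
        (0\<^sub>m 1 m * B + 1\<^sub>m 1 * 0\<^sub>m 1 m) (0\<^sub>m 1 m * 0\<^sub>m m 1 + 1\<^sub>m 1 * 1\<^sub>m 1)"
      unfolding bordered_def by (rule mult_four_block_mat[OF AB(1) z AB(2) z])
    also have "\<dots> = four_block_mat (1\<^sub>m m) (0\<^sub>m m 1) (0\<^sub>m 1 m) (1\<^sub>m 1)"
      using AB by simp
    also have "\<dots> = 1\<^sub>m (Suc m)" by (auto intro!: eq_matI)
    finally show ?thesis .
  qed
  have "bordered m A \<in> carrier_mat (Suc m) (Suc m)" if "A \<in> carrier_mat m m" for A
    unfolding bordered_def using four_block_carrier_mat[OF that, of "1\<^sub>m 1" 1 1] by simp
  then show ?thesis unfolding inv_pair_def using c prod by simp
qed

lemma bordered_conj_parts: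
  assumes Q: "Q \<in> carrier_mat m m" and P: "P \<in> carrier_mat m m" and M: "M \<in> carrier_mat (Suc m) (Suc m)"
  shows "lead m (bordered m Q * M * bordered m P) = Q * lead m M * P"
    "last_col m (bordered m Q * M * bordered m P) = Q * last_col m M"
    "last_row m (bordered m Q * M * bordered m P) = last_row m M * P"
    "(bordered m Q * M * bordered m P) $$ (m, m) = M $$ (m, m)"
proof -
  define c where "c = mat 1 1 (\<lambda>p. M $$ (m, m))"
  have cc: "c \<in> carrier_mat 1 1" unfolding c_def by simp
  have z: "(0\<^sub>m m 1 :: 'a mat) \<in> carrier_mat m 1" "(0\<^sub>m 1 m :: 'a mat) \<in> carrier_mat 1 m"
    "(1\<^sub>m 1 :: 'a mat) \<in> carrier_mat 1 1" by simp_all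
  have Meq: "M = four_block_mat (lead m M) (last_col m M) (last_row m M) c"
    using carrier_matD[OF M] by (intro eq_matI) (auto simp: lead_def last_col_def last_row_def c_def less_Suc_eq)
  have QK: "Q * lead m M \<in> carrier_mat m m" and QC: "Q * last_col m M \<in> carrier_mat m 1"
    by (rule mult_carrier_mat[OF Q lead_carrier], rule mult_carrier_mat[OF Q last_col_carrier])
  have RP: "last_row m M * P \<in> carrier_mat 1 m" by (rule mult_carrier_mat[OF last_row_carrier P])
  have QKP: "Q * lead m M * P \<in> carrier_mat m m" by (rule mult_carrier_mat[OF QK P])
  have 1: "bordered m Q * M = four_block_mat (Q * lead m M) (Q * last_col m M) (last_row m M) c"
  proof -
    have "bordered m Q * M = four_block_mat (Q * lead m M + 0\<^sub>m m 1 * last_row m M) (Q * last_col m M + 0\<^sub>m m 1 * c)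
        (0\<^sub>m 1 m * lead m M + 1\<^sub>m 1 * last_row m M) (0\<^sub>m 1 m * last_col m M + 1\<^sub>m 1 * c)"
      unfolding bordered_def
      by (subst Meq) (rule mult_four_block_mat[OF Q z lead_carrier last_col_carrier last_row_carrier cc])
    then show ?thesis
      using left_mult_zero_mat[OF last_row_carrier] left_mult_zero_mat[OF cc]
        left_mult_zero_mat[OF lead_carrier] left_mult_zero_mat[OF last_col_carrier]
        left_mult_one_mat[OF last_row_carrier] left_mult_one_mat[OF cc]
        right_add_zero_mat[OF QK] right_add_zero_mat[OF QC] left_add_zero_mat[OF last_row_carrier]
        left_add_zero_mat[OF cc] by simp
  qed
  have 2: "bordered m Q * M * bordered m P = four_block_mat (Q * lead m M * P) (Q * last_col m M) (last_row m M * P) c"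
  proof -
    have "bordered m Q * M * bordered m P = four_block_mat (Q * lead m M * P + Q * last_col m M * 0\<^sub>m 1 m)
        (Q * lead m M * 0\<^sub>m m 1 + Q * last_col m M * 1\<^sub>m 1) (last_row m M * P + c * 0\<^sub>m 1 m)
        (last_row m M * 0\<^sub>m m 1 + c * 1\<^sub>m 1)"
      unfolding 1 unfolding bordered_def by (rule mult_four_block_mat[OF QK QC last_row_carrier cc P z])
    then show ?thesis
      using right_mult_zero_mat[OF QC] right_mult_zero_mat[OF QK] right_mult_zero_mat[OF cc]
        right_mult_zero_mat[OF last_row_carrier] right_mult_one_mat[OF QC] right_mult_one_mat[OF cc]
        right_add_zero_mat[OF QKP] left_add_zero_mat[OF QC] right_add_zero_mat[OF RP] left_add_zero_mat[OF cc]
      by simp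
  qed
  note d = carrier_matD[OF QKP] carrier_matD[OF QC] carrier_matD[OF RP] carrier_matD[OF cc]
  show "lead m (bordered m Q * M * bordered m P) = Q * lead m M * P"
    unfolding 2 using d by (intro eq_matI) (simp_all add: lead_def del: index_mult_mat(1))
  show "last_col m (bordered m Q * M * bordered m P) = Q * last_col m M"
    unfolding 2 using d by (intro eq_matI) (simp_all add: last_col_def[of m "four_block_mat _ _ _ _"] del: index_mult_mat(1))
  show "last_row m (bordered m Q * M * bordered m P) = last_row m M * P"
    unfolding 2 using d by (intro eq_matI) (simp_all add: last_row_def[of m "four_block_mat _ _ _ _"] del: index_mult_mat(1))
  show "(bordered m Q * M * bordered m P) $$ (m, m) = M $$ (m, m)"
    unfolding 2 using d by (simp add: c_def del: index_mult_mat(1))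
qed

text \<open>A matrix of \<open>corner_part m V\<close> reduces to its last diagonal entry, so the
  dimension carries over; an entry 1 there would fix the last basis column.\<close>

lemma corners_hyper:
  assumes V: "msub (Suc m) (Suc m) V" and nf: "nofix (Suc m) V"
    and row0: "\<And>M. M \<in> corner_part m V \<Longrightarrow> last_row m M = 0\<^sub>m 1 m"
    and dim: "Suc (mdim (Suc m) (Suc m) (corner_part m V)) = degF"
  shows "hyper (corners m V)"
proof -
  have Z: "msub (Suc m) (Suc m) (corner_part m V)" by (rule stable_corner_subspaces(3)[OF V])
  note Zc = msub_closed[OF Z]
  have e: "M $$ (i, j) = 0" if "M \<in> corner_part m V" "i < Suc m" "j < Suc m" "(i, j) \<noteq> (m, m)" for M i j
    using that row0[OF that(1)]
    unfolding corner_part_def stable_part_def last_col_zero_iff lead_zero_iff last_row_zero_iff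
    by (cases "i = m"; cases "j = m") auto
  have a: "(M + N) $$ (m, m) = M $$ (m, m) + N $$ (m, m)" if "M \<in> corner_part m V" "N \<in> corner_part m V" for M N
    using carrier_matD[OF Zc(1)[OF that(1)]] carrier_matD[OF Zc(1)[OF that(2)]] by simp
  have b: "(k \<cdot>\<^sub>m M) $$ (m, m) = k * M $$ (m, m)" if "M \<in> corner_part m V" for k M
    using carrier_matD[OF Zc(1)[OF that]] by simp
  have "M = 0\<^sub>m (Suc m) (Suc m)" if "M \<in> corner_part m V" "M $$ (m, m) = 0" for M
  proof (rule eq_matI)
    fix i j assume "i < dim_row (0\<^sub>m (Suc m) (Suc m) :: 'a mat)" "j < dim_col (0\<^sub>m (Suc m) (Suc m) :: 'a mat)"
    then show "M $$ (i, j) = 0\<^sub>m (Suc m) (Suc m) $$ (i, j)"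
      using e[OF that(1), of i j] that(2) by (cases "(i, j) = (m, m)") auto
  qed (use carrier_matD[OF Zc(1)[OF that(1)]] in simp_all)
  then have "{M \<in> corner_part m V. M $$ (m, m) = 0} \<subseteq> {0\<^sub>m (Suc m) (Suc m)}" by blast
  moreover have "(0\<^sub>m (Suc m) (Suc m) :: 'a mat) $$ (m, m) = 0" by simp
  ultimately have ker: "{M \<in> corner_part m V. M $$ (m, m) = 0} = {0\<^sub>m (Suc m) (Suc m)}" using Zc(2) by blast
  note rn = mat_ring_rank_nullity[OF Z, of "\<lambda>M. M $$ (m, m)", OF a b]
  have "dsub (corners m V)" unfolding corners_def by (rule rn(2))
  moreover have "Suc (ddim (corners m V)) = degF"
    using rn(1) dim ker mdim_zero unfolding corners_def by simp
  moreover have "1 \<notin> corners m V"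
  proof
    assume "1 \<in> corners m V"
    then obtain M where M: "M \<in> corner_part m V" "M $$ (m, m) = 1" unfolding corners_def by auto
    then have "M \<in> V" "\<And>i. i < m \<Longrightarrow> M $$ (i, m) = 0"
      unfolding corner_part_def stable_part_def last_col_zero_iff by auto
    then show False using nofix_no_fixed_column[OF V nf, of M "\<lambda>_. 0"] M(2) by simp
  qed
  ultimately show ?thesis unfolding hyper_def by blast
qed

text \<open>Bound and structure are proved together, because equality in size \<open>Suc m\<close>
  forces equality for the leading blocks, to which the structural half of the induction hypothesis
  applies.\<close>

lemma nofix_bound_and_structure:
  assumes nq: "\<not> quadratic_type F"
  shows "msub n n V \<Longrightarrow> nofix n V \<Longrightarrow> infinite F \<or> n * degF \<le> card F \<Longrightarrow>
    mdim n n V \<le> optdim n \<and>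
    (mdim n n V = optdim n \<longrightarrow> (\<exists>H. (\<forall>i<n. hyper (H i)) \<and> similar_sets n (joint n H) V))"
proof (induction n arbitrary: V)
  case 0
  \<comment> \<open>The induction starts at size 0, where the empty matrix is the only one and forms
    every joint.\<close>
  have all: "M = 0\<^sub>m 0 0" if "M \<in> carrier_mat 0 0" for M :: "'a mat" using that by (intro eq_matI) auto
  have Vc: "V \<subseteq> carrier_mat 0 0" "0\<^sub>m 0 0 \<in> V" using 0(1) msub_iff by auto
  have "V = carrier_mat 0 0" using Vc all by auto
  moreover have "joint 0 H = carrier_mat 0 0" for H :: "nat \<Rightarrow> 'a set"
    unfolding joint_def upper_triangular_def by auto
  ultimately have "similar_sets 0 (joint 0 (\<lambda>_. {})) V"
    unfolding similar_sets_iff using inv_pair_one[of 0] conj_one[of V 0] Vc by metis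
  then show ?case using mdim_mono[OF 0(1) msub_carrier Vc(1)] mdim_carrier[of 0 0] by auto
next
  case (Suc m)
  have deg: "degF \<ge> 3" by (rule degree_at_least_three[OF nq])
  let ?n = "Suc m"
  obtain Q P where QP: "inv_pair ?n Q P"
    and le: "Suc (mdim 1 ?n (rank_one_rows ?n (conj_set Q P V) (ecol m))) \<le> degF"
    and eq: "Suc (mdim 1 ?n (rank_one_rows ?n (conj_set Q P V) (ecol m))) = degF \<Longrightarrow>
       (\<forall>w\<in>rank_one_rows ?n (conj_set Q P V) (ecol m). \<exists>h. w = h \<cdot>\<^sub>m erow m) \<and>
       (\<forall>y\<in>carrier_mat ?n 1. \<exists>w\<in>carrier_mat 1 ?n. y * erow m + ecol m * w \<in> conj_set Q P V)"
    using normal_form[OF Suc.prems(1,2) deg Suc.prems(3)] by blast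
  define V1 where "V1 = conj_set Q P V"
  note le = le[folded V1_def] and eq = eq[folded V1_def]
  have Vsub: "V \<subseteq> carrier_mat ?n ?n" using Suc.prems(1) msub_iff by simp
  have V1: "msub ?n ?n V1" "mdim ?n ?n V1 = mdim ?n ?n V" "nofix ?n V1"
    unfolding V1_def using conj_subspace[OF QP Suc.prems(1)] conj_nofix[OF QP Vsub Suc.prems(2)] by auto
  have big: "infinite F \<or> m * degF \<le> card F" using Suc.prems(3) by auto
  note IH = Suc.IH[OF stable_corner_subspaces(2)[OF V1(1)] lead_nofix[OF V1(1,3)] big]
  note split = dim_split[OF V1(1)] and corner = dim_corner_part[OF V1(1)]
  have IH1: "mdim m m (lead m ` stable_part m V1) \<le> optdim m" using IH by blast
  have le1: "mdim ?n ?n (corner_part m V1) \<le> degF - 1" unfolding corner using le by linarith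
  have bound: "mdim ?n ?n V \<le> optdim ?n" using split le1 IH1 V1(2) by simp
  moreover have "\<exists>H. (\<forall>i<?n. hyper (H i)) \<and> similar_sets ?n (joint ?n H) V" if full: "mdim ?n ?n V = optdim ?n"
  proof -
    have c1: "Suc (mdim ?n ?n (corner_part m V1)) = degF"
      and l1: "mdim m m (lead m ` stable_part m V1) = optdim m"
      using split le1 IH1 V1(2) full deg by simp_all
    have L: "\<And>w. w \<in> rank_one_rows ?n V1 (ecol m) \<Longrightarrow> \<exists>h. w = h \<cdot>\<^sub>m erow m"
      and Y: "\<And>y. y \<in> carrier_mat ?n 1 \<Longrightarrow> \<exists>w\<in>carrier_mat 1 ?n. y * erow m + ecol m * w \<in> V1"
      using eq[OF c1[unfolded corner]] by blast+
    have row0: "last_row m M = 0\<^sub>m 1 m" if M: "M \<in> corner_part m V1" for M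
    proof -
      obtain w where w: "w \<in> rank_one_rows ?n V1 (ecol m)" "\<And>j. j \<le> m \<Longrightarrow> w $$ (0, j) = M $$ (m, j)"
        using corner_part_row[OF V1(1) M] by metis
      obtain h where "w = h \<cdot>\<^sub>m erow m" using L[OF w(1)] by blast
      then have "w $$ (0, j) = 0" if "j < m" for j using that by simp
      then show ?thesis unfolding last_row_zero_iff using w(2) by simp
    qed
    have hyp: "hyper (corners m V1)" by (rule corners_hyper[OF V1(1,3) row0 c1])
    obtain H' where H': "\<forall>i<m. hyper (H' i)" "similar_sets m (joint m H') (lead m ` stable_part m V1)"
      using IH l1 by blast
    obtain Q1 P1 where QP1: "inv_pair m Q1 P1" "lead m ` stable_part m V1 = conj_set Q1 P1 (joint m H')"
      using H'(2) unfolding similar_sets_iff by blast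
    have jc: "joint m H' \<subseteq> carrier_mat m m" unfolding joint_def by auto
    note PQ1 = inv_pair_sym[OF QP1(1)]
    have c: "P1 \<in> carrier_mat m m" "Q1 \<in> carrier_mat m m" "P1 * Q1 = 1\<^sub>m m" "Q1 * P1 = 1\<^sub>m m"
      using QP1(1) unfolding inv_pair_def by auto
    \<comment> \<open>So far the leading blocks are only similar to a joint. This conjugation makes
      them equal to it, as \<open>joint_structure\<close> requires, and keeps the corner entries and
      the vanishing of the last rows.\<close>
    let ?B = "bordered m P1" and ?C = "bordered m Q1"
    have BC: "inv_pair ?n ?B ?C" by (rule bordered_inv_pair[OF PQ1])
    define V2 where "V2 = conj_set ?B ?C V1"
    have V1c: "V1 \<subseteq> carrier_mat ?n ?n" using V1(1) msub_iff by simp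
    have V2: "msub ?n ?n V2" "nofix ?n V2"
      unfolding V2_def using conj_subspace[OF BC V1(1)] conj_nofix[OF BC V1c V1(3)] by auto
    note parts = bordered_conj_parts[OF c(1,2)]
    have cancel: "P1 * A = 0\<^sub>m m k \<longleftrightarrow> A = 0\<^sub>m m k" if A: "A \<in> carrier_mat m k" for A k
    proof
      assume "P1 * A = 0\<^sub>m m k"
      then have "Q1 * (P1 * A) = 0\<^sub>m m k" using c by simp
      then show "A = 0\<^sub>m m k" unfolding assoc_mult_mat[OF c(2,1) A, symmetric] c(4) using A by simp
    qed (use c in simp)
    have st: "stable_part m V2 = (\<lambda>M. ?B * M * ?C) ` stable_part m V1"
    proof -
      have "last_col m (?B * M * ?C) = 0\<^sub>m m 1 \<longleftrightarrow> last_col m M = 0\<^sub>m m 1" if "M \<in> V1" for M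
      proof -
        have "M \<in> carrier_mat ?n ?n" using that V1c by blast
        from parts(2)[OF this] show ?thesis using cancel[OF last_col_carrier] by metis
      qed
      then show ?thesis unfolding stable_part_def V2_def conj_set_def by blast
    qed
    have leadst: "lead m ` stable_part m V2 = joint m H'"
    proof -
      have "stable_part m V1 \<subseteq> carrier_mat ?n ?n" using V1c unfolding stable_part_def by auto
      then have "lead m ` stable_part m V2 = conj_set P1 Q1 (lead m ` stable_part m V1)"
        unfolding st conj_set_def image_image using parts(1) by (intro image_cong) auto
      then show ?thesis unfolding QP1(2) using conj_cancel[OF QP1(1) jc] by simp
    qed
    have lead0: "lead m (?B * M * ?C) = 0\<^sub>m m m \<longleftrightarrow> lead m M = 0\<^sub>m m m" if "M \<in> V1" for M
    proof -
      have Mc: "M \<in> carrier_mat ?n ?n" using that V1c by blast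
      have "P1 * lead m M * Q1 = 0\<^sub>m m m \<longleftrightarrow> lead m M = 0\<^sub>m m m"
      proof
        assume "P1 * lead m M * Q1 = 0\<^sub>m m m"
        then have "Q1 * (P1 * lead m M * Q1) * P1 = 0\<^sub>m m m" using c by simp
        then show "lead m M = 0\<^sub>m m m" using cancel_conj[OF PQ1 lead_carrier] by simp
      qed (use c in simp)
      then show ?thesis unfolding parts(1)[OF Mc] .
    qed
    have cp: "corner_part m V2 = (\<lambda>M. ?B * M * ?C) ` corner_part m V1"
      unfolding corner_part_def st using lead0 unfolding stable_part_def by auto
    have cpc: "M \<in> carrier_mat ?n ?n" if "M \<in> corner_part m V1" for M
      using that V1c unfolding corner_part_def stable_part_def by auto
    have cor: "corners m V2 = corners m V1"
      unfolding corners_def cp image_image using parts(4) cpc by (intro image_cong) auto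
    have row02: "last_row m M = 0\<^sub>m 1 m" if "M \<in> corner_part m V2" for M
    proof -
      obtain N where N: "N \<in> corner_part m V1" "M = ?B * N * ?C" using \<open>M \<in> corner_part m V2\<close> unfolding cp by blast
      show ?thesis unfolding N(2) parts(3)[OF cpc[OF N(1)]] row0[OF N(1)] by (rule left_mult_zero_mat[OF c(2)])
    qed
    have cols: "\<exists>M\<in>V2. lead m M = 0\<^sub>m m m \<and> (\<forall>i<m. M $$ (i, m) = C i)" for C
    proof -
      define C0 where "C0 = mat m 1 (\<lambda>(i, j). C i)"
      have C0: "C0 \<in> carrier_mat m 1" unfolding C0_def by simp
      \<comment> \<open>The new conjugation multiplies last columns by \<open>P1\<close>, so the
        prescribed column is multiplied by the inverse \<open>Q1\<close> beforehand.\<close>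
      define C1 where "C1 = Q1 * C0"
      have C1: "C1 \<in> carrier_mat m 1" unfolding C1_def by (rule mult_carrier_mat[OF c(2) C0])
      define y where "y = mat ?n 1 (\<lambda>(i, j). if i < m then C1 $$ (i, 0) else 0)"
      have y: "y \<in> carrier_mat ?n 1" unfolding y_def by simp
      obtain w where w: "w \<in> carrier_mat 1 ?n" "y * erow m + ecol m * w \<in> V1" using Y[OF y] by blast
      define M where "M = y * erow m + ecol m * w"
      have M: "M \<in> V1" "M \<in> carrier_mat ?n ?n" using w V1c unfolding M_def by auto
      have idx: "M $$ (i, j) = (if j = m then C1 $$ (i, 0) else 0)" if "i < m" "j \<le> m" for i j
        unfolding M_def using that carrier_matD[OF w(1)] by (simp add: y_def del: index_mult_mat(1))
      have "lead m M = 0\<^sub>m m m" unfolding lead_zero_iff using idx by simp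
      then have "lead m (?B * M * ?C) = 0\<^sub>m m m" using lead0[OF M(1)] by simp
      moreover have "last_col m M = C1" using idx C1 by (intro eq_matI) (auto simp: last_col_def)
      then have "last_col m (?B * M * ?C) = C0"
        unfolding parts(2)[OF M(2)] C1_def using assoc_mult_mat[OF c(1,2) C0] c(3) left_mult_one_mat[OF C0] by simp
      then have "(?B * M * ?C) $$ (i, m) = C i" if "i < m" for i
        using last_col_index[OF that, of "?B * M * ?C"] that unfolding C0_def by simp
      moreover have "?B * M * ?C \<in> V2" unfolding V2_def conj_set_def using M(1) by blast
      ultimately show ?thesis by blast
    qed
    have "1 * 3 \<le> ?n * degF" using deg by (intro mult_le_mono) auto
    then have "infinite F \<or> 3 \<le> card F" using Suc.prems(3) by auto
    then obtain t0 where t0: "t0 \<in> F" "t0 \<noteq> 0" "t0 \<noteq> 1" using third_element by blast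
    have "degF \<ge> 2" using deg by simp
    from joint_structure[OF V2 nq this t0 hyp[folded cor] row02 cols leadst]
    have V2j: "V2 = joint ?n (H'(m := corners m V2))" using H'(1) by blast
    have "similar_sets ?n V V2"
      unfolding similar_sets_iff V2_def V1_def conj_conj[OF QP BC Vsub] using inv_pair_mult[OF QP BC] by blast
    then have "similar_sets ?n V2 V" by (rule similar_sets_sym[OF Vsub])
    then have "similar_sets ?n (joint ?n (H'(m := corners m V2))) V" using V2j by simp
    moreover have "\<forall>i<?n. hyper ((H'(m := corners m V2)) i)" using H'(1) hyp cor by (auto simp: less_Suc_eq)
    ultimately show ?thesis by blast
  qed
  ultimately show ?case by blast
qed

section \<open>Joints\<close>

text \<open>Induction on the block form \<open>[L c; 0 t]\<close>, with inverse
  \<open>[L' (- L' c t'); 0 t']\<close> where \<open>L'\<close> and \<open>t'\<close> invert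
  \<open>L\<close> and \<open>t\<close>.\<close>

lemma upper_triangular_inverse:
  assumes "T \<in> carrier_mat n n" "\<And>i j. i < n \<Longrightarrow> j < i \<Longrightarrow> T $$ (i, j) = 0" "\<And>i. i < n \<Longrightarrow> T $$ (i, i) \<noteq> 0"
  shows "\<exists>B. inv_pair n T B"
  using assms
proof (induction n arbitrary: T)
  case 0
  have "A = 1\<^sub>m 0" if "A \<in> carrier_mat 0 0" for A :: "'a mat" using that by (intro eq_matI) auto
  then have "T = 1\<^sub>m 0" using 0 by blast
  then show ?case using inv_pair_one by blast
next
  case (Suc m)
  define L where "L = lead m T"
  define c where "c = last_col m T"
  define t where "t = mat 1 1 (\<lambda>p. T $$ (m, m))"
  define t' where "t' = mat 1 1 (\<lambda>p. inverse (T $$ (m, m)))"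
  have Lc: "L \<in> carrier_mat m m" and cc: "c \<in> carrier_mat m 1" and tc: "t \<in> carrier_mat 1 1" "t' \<in> carrier_mat 1 1"
    unfolding L_def c_def t_def t'_def using last_col_carrier by simp_all
  have tt: "t * t' = 1\<^sub>m 1" "t' * t = 1\<^sub>m 1"
    using Suc.prems(3)[of m] by (auto intro!: eq_matI simp: t_def t'_def scalar_prod_def)
  have Teq: "T = four_block_mat L c (0\<^sub>m 1 m) t"
    using carrier_matD[OF Suc.prems(1)] Suc.prems(2)
    by (intro eq_matI) (auto simp: L_def c_def t_def lead_def last_col_def less_Suc_eq)
  obtain L' where L': "inv_pair m L L'"
  proof -
    have "\<exists>B. inv_pair m L B" unfolding L_def using Suc.prems by (intro Suc.IH) auto
    then show ?thesis using that by blast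
  qed
  have L'c: "L' \<in> carrier_mat m m" "L * L' = 1\<^sub>m m" "L' * L = 1\<^sub>m m" using L' unfolding inv_pair_def by auto
  define b where "b = L' * (c * t')"
  have ct: "c * t' \<in> carrier_mat m 1" by (rule mult_carrier_mat[OF cc tc(2)])
  have bc: "b \<in> carrier_mat m 1" unfolding b_def by (rule mult_carrier_mat[OF L'c(1) ct])
  have mb: "- b \<in> carrier_mat m 1" using bc by simp
  define B where "B = four_block_mat L' (- b) (0\<^sub>m 1 m) t'"
  have z: "(0\<^sub>m 1 m :: 'a mat) \<in> carrier_mat 1 m" by simp
  have Lb: "L * b = c * t'"
    unfolding b_def assoc_mult_mat[OF Lc L'c(1) ct, symmetric] L'c(2) by (rule left_mult_one_mat[OF ct])
  have bt: "b * t = L' * c"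
    unfolding b_def assoc_mult_mat[OF L'c(1) ct tc(1)] assoc_mult_mat[OF cc tc(2,1)] tt
    using right_mult_one_mat[OF cc] by simp
  have one: "four_block_mat (1\<^sub>m m) (0\<^sub>m m 1) (0\<^sub>m 1 m) (1\<^sub>m 1) = (1\<^sub>m (Suc m) :: 'a mat)"
    by (auto intro!: eq_matI)
  have neg: "A * (- D) = - (A * D)" "(- A) * D = - (A * D)"
    if "A \<in> carrier_mat r k" "D \<in> carrier_mat k l" for A D :: "'a mat" and r k l
    using that by (auto intro!: eq_matI simp: scalar_prod_def sum_negf)
  have cancel: "- A + A = 0\<^sub>m m 1" if "A \<in> carrier_mat m 1" for A :: "'a mat" using that by (auto intro!: eq_matI)
  have "T * B = four_block_mat (L * L' + c * 0\<^sub>m 1 m) (L * - b + c * t') (0\<^sub>m 1 m * L' + t * 0\<^sub>m 1 m) (0\<^sub>m 1 m * - b + t * t')"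
    unfolding B_def by (subst Teq) (rule mult_four_block_mat[OF Lc cc z tc(1) L'c(1) mb z tc(2)])
  also have "\<dots> = 1\<^sub>m (Suc m)"
    using cancel[OF ct] right_mult_zero_mat[OF cc] left_mult_zero_mat[OF L'c(1)] left_mult_zero_mat[OF mb]
      right_mult_zero_mat[OF tc(1)] one
    by (simp add: L'c neg(1)[OF Lc bc] Lb tt)
  finally have TB: "T * B = 1\<^sub>m (Suc m)" .
  have Lcc: "L' * c \<in> carrier_mat m 1" by (rule mult_carrier_mat[OF L'c(1) cc])
  have cancel': "A + - A = 0\<^sub>m m 1" if "A \<in> carrier_mat m 1" for A :: "'a mat" using that by (auto intro!: eq_matI)
  have "B * T = four_block_mat (L' * L + - b * 0\<^sub>m 1 m) (L' * c + - b * t) (0\<^sub>m 1 m * L + t' * 0\<^sub>m 1 m) (0\<^sub>m 1 m * c + t' * t)"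
    unfolding B_def by (subst Teq) (rule mult_four_block_mat[OF L'c(1) mb z tc(2) Lc cc z tc(1)])
  also have "\<dots> = 1\<^sub>m (Suc m)"
    using cancel'[OF Lcc] right_mult_zero_mat[OF mb] left_mult_zero_mat[OF Lc] left_mult_zero_mat[OF cc]
      right_mult_zero_mat[OF tc(2)] one
    by (simp add: L'c neg(2)[OF bc tc(1)] bt tt)
  finally have BT: "B * T = 1\<^sub>m (Suc m)" .
  have "B \<in> carrier_mat (Suc m) (Suc m)"
    unfolding B_def using four_block_carrier_mat[OF L'c(1) tc(2)] by simp
  then show ?case unfolding inv_pair_def using TB BT Suc.prems(1) by blast
qed

text \<open>The definition of \<open>invertible_mat\<close> leaves the shape of the inverse open;
  the dimensions of the two identity matrices determine it.\<close>

lemma invertible_mat_iff: "A \<in> carrier_mat n n \<Longrightarrow> invertible_mat A \<longleftrightarrow> (\<exists>B. inv_pair n A B)"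
proof
  assume A: "A \<in> carrier_mat n n" and "invertible_mat A"
  then obtain B where B: "A * B = 1\<^sub>m n" "B * A = 1\<^sub>m (dim_row B)"
    unfolding invertible_mat_def inverts_mat_def by auto
  have "dim_col B = n" using arg_cong[OF B(1), of dim_col] by simp
  moreover have "dim_row B = n" using arg_cong[OF B(2), of dim_col] A by simp
  ultimately show "\<exists>B. inv_pair n A B" unfolding inv_pair_def using A B by auto
qed (auto simp: invertible_mat_def inverts_mat_def inv_pair_def)

lemma trivial_spectrum_iff:
  "trivial_spectrum F n V \<longleftrightarrow> msub n n V \<and> (\<forall>M\<in>V. \<exists>B. inv_pair n (1\<^sub>m n - M) B)"
proof -
  have "1\<^sub>m n - M \<in> carrier_mat n n" if "msub n n V" "M \<in> V" for M
    by (rule minus_carrier_mat[OF msub_closed(1)[OF that]])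
  then show ?thesis unfolding trivial_spectrum_def matrix_subspace_def using invertible_mat_iff by blast
qed

lemma trivial_spectrum_nofix:
  assumes "trivial_spectrum F n V"
  shows "nofix n V"
  unfolding nofix_def
proof (intro ballI conjI impI)
  have V: "msub n n V" using assms unfolding trivial_spectrum_iff by blast
  fix M v assume M: "M \<in> V"
  then have Mc: "M \<in> carrier_mat n n" using msub_closed(1)[OF V] by blast
  obtain B where "inv_pair n (1\<^sub>m n - M) B" using assms M unfolding trivial_spectrum_iff by blast
  then have B: "B \<in> carrier_mat n n" "B * (1\<^sub>m n - M) = 1\<^sub>m n" "(1\<^sub>m n - M) * B = 1\<^sub>m n" "1\<^sub>m n - M \<in> carrier_mat n n"
    unfolding inv_pair_def by auto
  {
    assume v: "v \<in> carrier_mat n 1" "M * v = v"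
    have "(1\<^sub>m n - M) * v = v - v"
      using minus_mult_distrib_mat[OF one_carrier_mat Mc v(1)] v left_mult_one_mat[OF v(1)] by simp
    also have "\<dots> = 0\<^sub>m n 1" using v by (auto intro!: eq_matI)
    finally have "B * ((1\<^sub>m n - M) * v) = 0\<^sub>m n 1" using right_mult_zero_mat[OF B(1)] by simp
    then show "v = 0\<^sub>m n 1"
      unfolding assoc_mult_mat[OF B(1,4) v(1), symmetric] B(2) left_mult_one_mat[OF v(1)] .
  next
    assume v: "v \<in> carrier_mat 1 n" "v * M = v"
    have "v * (1\<^sub>m n - M) = v - v"
      using mult_minus_distrib_mat[OF v(1) one_carrier_mat Mc] v right_mult_one_mat[OF v(1)] by simp
    also have "\<dots> = 0\<^sub>m 1 n" using v by (auto intro!: eq_matI)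
    finally have "v * (1\<^sub>m n - M) * B = 0\<^sub>m 1 n" using left_mult_zero_mat[OF B(1)] by simp
    then show "v = 0\<^sub>m 1 n"
      unfolding assoc_mult_mat[OF v(1) B(4,1)] B(3) right_mult_one_mat[OF v(1)] .
  }
qed

lemma trivial_spectrum_conj:
  assumes Q: "inv_pair n Q P" and V: "trivial_spectrum F n V"
  shows "trivial_spectrum F n (conj_set Q P V)"
  unfolding trivial_spectrum_iff
proof (intro conjI ballI)
  have Vs: "msub n n V" using V unfolding trivial_spectrum_iff by blast
  show "msub n n (conj_set Q P V)" by (rule conj_subspace(1)[OF Q Vs])
  fix N assume "N \<in> conj_set Q P V"
  then obtain M where M: "M \<in> V" "N = Q * M * P" unfolding conj_set_def by blast
  have c: "Q \<in> carrier_mat n n" "P \<in> carrier_mat n n" "Q * P = 1\<^sub>m n" using Q unfolding inv_pair_def by auto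
  have Mc: "M \<in> carrier_mat n n" using msub_closed(1)[OF Vs M(1)] .
  obtain B where B: "inv_pair n (1\<^sub>m n - M) B" using V M unfolding trivial_spectrum_iff by blast
  have "Q * (1\<^sub>m n - M) * P = Q * P - Q * M * P"
    using mult_minus_distrib_mat[OF c(1) one_carrier_mat Mc] right_mult_one_mat[OF c(1)]
      minus_mult_distrib_mat[OF c(1) mult_carrier_mat[OF c(1) Mc] c(2)] by simp
  then have e: "1\<^sub>m n - N = Q * (1\<^sub>m n - M) * P" unfolding M(2) c(3) by simp
  have "inv_pair n (Q * ((1\<^sub>m n - M) * P)) (Q * B * P)"
  proof -
    have "inv_pair n ((1\<^sub>m n - M) * P) (Q * B)" by (rule inv_pair_mult[OF inv_pair_sym[OF Q] B])
    then show ?thesis by (rule inv_pair_mult[OF _ Q])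
  qed
  moreover have "Q * ((1\<^sub>m n - M) * P) = Q * (1\<^sub>m n - M) * P"
    by (rule assoc_mult_mat[OF c(1) minus_carrier_mat[OF Mc] c(2), symmetric])
  ultimately show "\<exists>B. inv_pair n (1\<^sub>m n - N) B" unfolding e by auto
qed

text \<open>The condition \<open>i < n\<close> makes every entry set a subspace, also at positions
  outside the matrix, where nothing is known about \<open>H\<close>.\<close>

lemma joint_eq_box:
  "joint n H = box n n (\<lambda>(i, j). if i < j then UNIV else if i = j \<and> i < n then H i else {0})"
  unfolding joint_def box_def upper_triangular_def by (auto split: if_splits)

lemma joint_space:
  assumes H: "\<And>i. i < n \<Longrightarrow> hyper (H i)"
  shows "msub n n (joint n H)" "mdim n n (joint n H) = optdim n" "trivial_spectrum F n (joint n H)"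
proof -
  define A where "A = (\<lambda>(i, j). if i < j then UNIV else if i = j \<and> i < n then H i else {0 :: 'a})"
  have A: "dsub (A p)" for p
    using H dsub_UNIV dsub_zero unfolding A_def hyper_def by (cases p) auto
  have jA: "joint n H = box n n A" unfolding A_def by (rule joint_eq_box)
  show ms: "msub n n (joint n H)" unfolding jA by (rule msub_box[OF A])
  have dA: "ddim (A (i, j)) = (if i < j then degF else if i = j then degF - 1 else 0)" if "i < n" for i j
    using H[OF that] that ddim_UNIV ddim_zero unfolding A_def hyper_def by auto
  \<comment> \<open>A new index adds \<open>k\<close> full entries above the diagonal, one
    hyperplane on it, and nothing below it.\<close>
  have sum: "(\<Sum>i<k. \<Sum>j<k. if i < j then degF else if i = j then degF - 1 else 0) = optdim k" for k
  proof (induction k)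
    case (Suc k)
    have "(\<Sum>j<k. if k < j then degF else if k = j then degF - 1 else 0) = 0" by (intro sum.neutral) auto
    moreover have "(\<Sum>i<k. (\<Sum>j<k. if i < j then degF else if i = j then degF - 1 else 0) +
        (if i < k then degF else if i = k then degF - 1 else 0)) = optdim k + k * degF"
      by (simp add: sum.distrib Suc)
    ultimately show ?case by simp
  qed simp
  have "mdim n n (joint n H) = (\<Sum>i<n. \<Sum>j<n. ddim (A (i, j)))"
    unfolding jA mdim_box[OF A] by (simp add: sum.cartesian_product case_prod_unfold)
  also have "\<dots> = (\<Sum>i<n. \<Sum>j<n. if i < j then degF else if i = j then degF - 1 else 0)"
    by (intro sum.cong) (simp_all add: dA)
  finally show "mdim n n (joint n H) = optdim n" unfolding sum .
  show "trivial_spectrum F n (joint n H)"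
    unfolding trivial_spectrum_iff
  proof (intro conjI ballI)
    fix M assume M: "M \<in> joint n H"
    note Mj = joint_index[OF M]
    show "\<exists>B. inv_pair n (1\<^sub>m n - M) B"
    proof (rule upper_triangular_inverse)
      show "1\<^sub>m n - M \<in> carrier_mat n n" by (rule minus_carrier_mat[OF Mj(1)])
      show "(1\<^sub>m n - M) $$ (i, j) = 0" if "i < n" "j < i" for i j
        using Mj(2)[OF that] that carrier_matD[OF Mj(1)] by simp
      show "(1\<^sub>m n - M) $$ (i, i) \<noteq> 0" if "i < n" for i
        using Mj(3)[OF that] H[OF that] that carrier_matD[OF Mj(1)] unfolding hyper_def by auto
    qed
  qed (rule ms)
qed

lemma hyper_exists: "\<exists>H. hyper H"
proof -
  obtain T where T: "dsub T" "F \<inter> T = {0}"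
    "ddim F + ddim T = vectorspace.dim K (ring_module :: ('a, 'a) module)"
    using vectorspace.complement_exists[OF ring_vs ring_fd dsub_F] by auto
  then have "Suc (ddim T) = degF" using ddim_F unfolding degree_over_def by simp
  moreover have "1 \<notin> T" using T(2) F_one by (metis IntI singletonD zero_neq_one)
  ultimately show ?thesis unfolding hyper_def using T(1) by blast
qed

text \<open>A hyperplane avoiding 1 exists, as a complement of \<open>F\<close>, and the joint built
  from it attains the bound. So the greatest dimension is exactly \<open>optdim n\<close>, and the
  case of equality applies to every optimal space.\<close>

lemma optimal_iff:
  assumes nq: "\<not> quadratic_type F" and big: "infinite F \<or> n * degF \<le> card F"
  shows "optimal_trivial_spectrum F n S \<longleftrightarrow>
    (\<exists>H. (\<forall>i<n. hyper (H i)) \<and> similar_sets n (joint n H) S)"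
proof
  note bound = nofix_bound_and_structure[OF nq _ trivial_spectrum_nofix big]
  assume opt: "optimal_trivial_spectrum F n S"
  obtain H0 where H0: "hyper H0" using hyper_exists by blast
  have S: "trivial_spectrum F n S" "msub n n S"
    using opt unfolding optimal_trivial_spectrum_def trivial_spectrum_iff by auto
  have "mdim n n (joint n (\<lambda>_. H0)) \<le> mdim n n S"
    using opt joint_space(3)[of n "\<lambda>_. H0"] H0 unfolding optimal_trivial_spectrum_def matrix_dim_def by blast
  then have "mdim n n S = optdim n" using joint_space(2)[of n "\<lambda>_. H0"] H0 bound[OF S(2,1)] by simp
  then show "\<exists>H. (\<forall>i<n. hyper (H i)) \<and> similar_sets n (joint n H) S" using bound[OF S(2,1)] by blast
next
  note bound = nofix_bound_and_structure[OF nq _ trivial_spectrum_nofix big]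
  assume "\<exists>H. (\<forall>i<n. hyper (H i)) \<and> similar_sets n (joint n H) S"
  then obtain H Q P where H: "\<And>i. i < n \<Longrightarrow> hyper (H i)" and QP: "inv_pair n Q P" "S = conj_set Q P (joint n H)"
    unfolding similar_sets_iff by blast
  have "trivial_spectrum F n S" unfolding QP(2) by (rule trivial_spectrum_conj[OF QP(1) joint_space(3)[OF H]])
  moreover have "mdim n n S = optdim n"
    using conj_subspace(2)[OF QP(1) joint_space(1)[OF H]] joint_space(2)[OF H] unfolding QP(2) by simp
  moreover have "mdim n n T \<le> optdim n" if "trivial_spectrum F n T" for T
    using bound[OF _ that] that unfolding trivial_spectrum_iff by blast
  ultimately show "optimal_trivial_spectrum F n S"
    unfolding optimal_trivial_spectrum_def matrix_dim_def by simp
qed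

section \<open>Similarity between joints\<close>

definition diagm :: "nat \<Rightarrow> (nat \<Rightarrow> 'a) \<Rightarrow> 'a mat" where
  "diagm n a = mat n n (\<lambda>(i, j). if i = j then a i else 0)"

lemma diagm_carrier [simp]: "diagm n a \<in> carrier_mat n n"
  by (simp add: diagm_def)

lemma diagm_mult_index:
  assumes "M \<in> carrier_mat n n" "i < n" "j < n"
  shows "(diagm n a * M) $$ (i, j) = a i * M $$ (i, j)" "(M * diagm n b) $$ (i, j) = M $$ (i, j) * b j"
proof -
  have "(diagm n a * M) $$ (i, j) = (\<Sum>k\<in>{0..<n}. (if k = i then a i else 0) * M $$ (k, j))"
    using carrier_matD[OF assms(1)] assms(2,3) by (auto simp: scalar_prod_def diagm_def intro!: sum.cong)
  then show "(diagm n a * M) $$ (i, j) = a i * M $$ (i, j)"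
    using sum_delta_left[OF assms(2), of "a i" "\<lambda>k. M $$ (k, j)"] by simp
  have "(M * diagm n b) $$ (i, j) = (\<Sum>k\<in>{0..<n}. M $$ (i, k) * (if k = j then b j else 0))"
    using carrier_matD[OF assms(1)] assms(2,3) by (auto simp: scalar_prod_def diagm_def intro!: sum.cong)
  then show "(M * diagm n b) $$ (i, j) = M $$ (i, j) * b j"
    using sum_delta_right[OF assms(3), of "\<lambda>k. M $$ (i, k)" "b j"] by simp
qed

lemma conj_diagm_index:
  assumes "M \<in> carrier_mat n n" "i < n" "j < n"
  shows "(diagm n a * M * diagm n b) $$ (i, j) = a i * M $$ (i, j) * b j"
  using diagm_mult_index(2)[OF mult_carrier_mat[OF diagm_carrier assms(1)] assms(2,3)]
    diagm_mult_index(1)[OF assms] by simp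

text \<open>A diagonal conjugation multiplies the entry \<open>(i, j)\<close> by \<open>a i\<close>
  on the left and by \<open>inverse (a j)\<close> on the right: the diagonal sets are conjugated,
  and the free entries above the diagonal remain free.\<close>

lemma similar_joint_if_conjugate:
  fixes H H' :: "nat \<Rightarrow> 'a set"
  assumes c: "\<And>i. i < n \<Longrightarrow> conjugate_sets (H i) (H' i)"
  shows "similar_sets n (joint n H) (joint n H')"
proof -
  have "\<forall>i. \<exists>a. i < n \<longrightarrow> a \<noteq> 0 \<and> H' i = (\<lambda>x. a * x * inverse a) ` H i"
    using c unfolding conjugate_sets_def by blast
  then obtain a where a: "\<And>i. i < n \<Longrightarrow> a i \<noteq> 0" "\<And>i. i < n \<Longrightarrow> H' i = (\<lambda>x. a i * x * inverse (a i)) ` H i"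
    by metis
  define Q P where "Q = diagm n a" and "P = diagm n (\<lambda>i. inverse (a i))"
  have QP: "inv_pair n Q P"
  proof -
    have "diagm n b * diagm n c = 1\<^sub>m n" if "\<And>i. i < n \<Longrightarrow> b i * c i = 1" for b c
    proof (rule eq_matI)
      fix i j assume "i < dim_row (1\<^sub>m n :: 'a mat)" "j < dim_col (1\<^sub>m n :: 'a mat)"
      then have ij: "i < n" "j < n" by simp_all
      show "(diagm n b * diagm n c) $$ (i, j) = 1\<^sub>m n $$ (i, j)"
        using diagm_mult_index(1)[OF diagm_carrier ij, of b c] ij that by (simp add: diagm_def)
    qed (simp_all add: diagm_def)
    then show ?thesis unfolding inv_pair_def Q_def P_def using a(1) by simp
  qed
  have sub: "diagm n b * M * diagm n c \<in> joint n G'"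
    if "M \<in> joint n G" and g: "\<And>i x. i < n \<Longrightarrow> x \<in> G i \<Longrightarrow> b i * x * c i \<in> G' i" for b c M and G G' :: "nat \<Rightarrow> 'a set"
  proof (rule jointI)
    note Mj = joint_index[OF that(1)]
    show "diagm n b * M * diagm n c \<in> carrier_mat n n"
      by (rule mult_carrier_mat[OF mult_carrier_mat[OF diagm_carrier Mj(1)] diagm_carrier])
    show "(diagm n b * M * diagm n c) $$ (i, j) = 0" if "i < n" "j < i" for i j
      using conj_diagm_index[OF Mj(1), of i j b c] Mj(2)[OF that] that by simp
    show "(diagm n b * M * diagm n c) $$ (i, i) \<in> G' i" if "i < n" for i
      using conj_diagm_index[OF Mj(1) that that, of b c] g[OF that Mj(3)[OF that]] by simp
  qed
  have "joint n H' = conj_set Q P (joint n H)"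
  proof
    show "conj_set Q P (joint n H) \<subseteq> joint n H'"
      unfolding conj_set_def Q_def P_def using sub[of _ H a "\<lambda>i. inverse (a i)" H'] a(2) by auto
    show "joint n H' \<subseteq> conj_set Q P (joint n H)"
    proof
      fix M assume M: "M \<in> joint n H'"
      have "inverse (a i) * x * a i \<in> H i" if i: "i < n" "x \<in> H' i" for i x
      proof -
        obtain h where h: "h \<in> H i" "x = a i * h * inverse (a i)" using a(2)[OF i(1)] i(2) by auto
        have "inverse (a i) * x * a i = (inverse (a i) * a i) * h * (inverse (a i) * a i)"
          unfolding h(2) by (simp only: mult.assoc)
        then show ?thesis using h(1) a(1)[OF i(1)] by simp
      qed
      then have "P * M * Q \<in> joint n H" unfolding P_def Q_def by (rule sub[OF M])
      moreover have "joint n H \<subseteq> carrier_mat n n" unfolding joint_def by auto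
      ultimately show "M \<in> conj_set Q P (joint n H)" using conj_mem_iff[OF QP] joint_index(1)[OF M] by blast
    qed
  qed
  then show ?thesis unfolding similar_sets_iff using QP by blast
qed

lemma single_mult_index:
  assumes "Q \<in> carrier_mat n n" "P \<in> carrier_mat n n" "a < n" "b < n" "i < n" "j < n"
  shows "(Q * single n n (a, b) x * P) $$ (i, j) = Q $$ (i, a) * x * P $$ (b, j)"
proof -
  have s: "Q * single n n (a, b) x \<in> carrier_mat n n" by (rule mult_carrier_mat[OF assms(1) single_carrier])
  have "(Q * single n n (a, b) x) $$ (i, k) = (if k = b then Q $$ (i, a) * x else 0)" if k: "k < n" for k
  proof -
    have "(Q * single n n (a, b) x) $$ (i, k) = (\<Sum>l\<in>{0..<n}. Q $$ (i, l) * (if l = a then (if k = b then x else 0) else 0))"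
      using carrier_matD[OF assms(1)] assms k by (auto simp: scalar_prod_def intro!: sum.cong)
    then show ?thesis using sum_delta_right[OF assms(3), of "\<lambda>l. Q $$ (i, l)"] by simp
  qed
  then have "(Q * single n n (a, b) x * P) $$ (i, j) = (\<Sum>k\<in>{0..<n}. (if k = b then Q $$ (i, a) * x else 0) * P $$ (k, j))"
    using carrier_matD[OF s] carrier_matD[OF assms(2)] assms
    by (auto simp: scalar_prod_def[of "row (Q * single n n (a, b) x) i"] simp del: index_mult_mat(1)
        simp: index_mult_mat(1)[of i "Q * single n n (a, b) x" j P] intro!: sum.cong)
  then show ?thesis using sum_delta_left[OF assms(4), of "Q $$ (i, a) * x" "\<lambda>k. P $$ (k, j)"] by simp
qed

text \<open>If \<open>Q\<^sub>i\<^sub>a \<noteq> 0\<close> with \<open>a < i\<close> minimal, the columns of \<open>P\<close> of index less than \<open>i\<close> vanish from row \<open>a\<close> on,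
  which contradicts \<open>(Q P)\<^sub>a\<^sub>a = 1\<close>.\<close>

lemma conj_joint_upper_triangular:
  assumes QP: "inv_pair n Q P" and sub: "\<And>M. M \<in> joint n H \<Longrightarrow> Q * M * P \<in> joint n H'"
    and H: "\<And>i. i < n \<Longrightarrow> hyper (H i)" and deg: "degF \<ge> 2"
  shows "a < i \<Longrightarrow> i < n \<Longrightarrow> Q $$ (i, a) = 0"
proof (induction a arbitrary: i rule: less_induct)
  case (less a)
  have c: "Q \<in> carrier_mat n n" "P \<in> carrier_mat n n" "Q * P = 1\<^sub>m n" using QP unfolding inv_pair_def by auto
  show ?case
  proof (rule ccontr)
    assume nz: "Q $$ (i, a) \<noteq> 0"
    have an: "a < n" using less by simp
    have P0: "P $$ (b, a) = 0" if b: "a \<le> b" "b < n" for b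
    proof -
      \<comment> \<open>Nonzero entries are available on and above the diagonal; on it this takes
        \<open>degF \<ge> 2\<close>. The entry \<open>(i, a)\<close> of the conjugate, below the
        diagonal, is \<open>Q $$ (i, a) * x * P $$ (b, a)\<close> and must vanish.\<close>
      have "\<exists>x. x \<noteq> 0 \<and> single n n (a, b) x \<in> joint n H"
      proof (cases "a = b")
        case True
        have "dsub (H a)" "0 < ddim (H a)" using H[OF an] deg unfolding hyper_def by auto
        then obtain x where x: "x \<in> H a" "x \<noteq> 0" using ddim_pos by blast
        then have "single n n (a, b) x \<in> joint n H"
          using True hyper_zero[OF H] by (intro jointI) auto
        then show ?thesis using x by blast
      next
        case False
        then have "single n n (a, b) 1 \<in> joint n H"
          using b hyper_zero[OF H] by (intro jointI) auto
        then show ?thesis using zero_neq_one by metis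
      qed
      then obtain x where x: "x \<noteq> 0" "single n n (a, b) x \<in> joint n H" by blast
      have "(Q * single n n (a, b) x * P) $$ (i, a) = 0"
        by (rule joint_index(2)[OF sub[OF x(2)] less.prems(2,1)])
      then have "Q $$ (i, a) * x * P $$ (b, a) = 0"
        using single_mult_index[OF c(1,2) an b(2) less.prems(2) an, of x] by simp
      then show ?thesis using nz x(1) by simp
    qed
    have "(Q * P) $$ (a, a) = (\<Sum>k\<in>{0..<n}. Q $$ (a, k) * P $$ (k, a))"
      using carrier_matD[OF c(1)] carrier_matD[OF c(2)] an by (simp add: scalar_prod_def)
    also have "\<dots> = 0"
    \<comment> \<open>In row \<open>a\<close> of \<open>Q\<close>, the entries left of the diagonal
      vanish by the induction hypothesis; the other terms vanish by \<open>P0\<close>.\<close>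
    proof (rule sum.neutral, intro ballI)
      fix k assume k: "k \<in> {0..<n}"
      show "Q $$ (a, k) * P $$ (k, a) = 0"
        using P0[of k] less.IH[of k a] k an by (cases "k < a") auto
    qed
    finally show False unfolding c(3) using an by simp
  qed
qed

lemma upper_triangular_mult_diag:
  assumes "A \<in> carrier_mat n n" "B \<in> carrier_mat n n" "\<forall>i<n. \<forall>j<i. A $$ (i, j) = 0"
    "\<forall>i<n. \<forall>j<i. B $$ (i, j) = (0 :: 'a)"
  shows "i < n \<Longrightarrow> (A * B) $$ (i, i) = A $$ (i, i) * B $$ (i, i)"
    "j < i \<Longrightarrow> i < n \<Longrightarrow> (A * B) $$ (i, j) = 0"
proof -
  have e: "(A * B) $$ (i, j) = (\<Sum>k\<in>{0..<n}. A $$ (i, k) * B $$ (k, j))" if "i < n" "j < n" for i j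
    using carrier_matD[OF assms(1)] carrier_matD[OF assms(2)] that by (simp add: scalar_prod_def)
  {
    assume i: "i < n"
    have "(A * B) $$ (i, i) = (\<Sum>k\<in>{0..<n}. if k = i then A $$ (i, i) * B $$ (i, i) else 0)"
      unfolding e[OF i i]
    proof (rule sum.cong[OF refl])
      fix k assume "k \<in> {0..<n}"
      then show "A $$ (i, k) * B $$ (k, i) = (if k = i then A $$ (i, i) * B $$ (i, i) else 0)"
        using assms(3,4) i by (cases "k < i"; cases "k = i") auto
    qed
    then show "(A * B) $$ (i, i) = A $$ (i, i) * B $$ (i, i)" using i by simp
  next
    assume ij: "j < i" "i < n"
    then have jn: "j < n" by simp
    show "(A * B) $$ (i, j) = 0"
      unfolding e[OF ij(2) jn]
    proof (rule sum.neutral, intro ballI)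
      fix k assume "k \<in> {0..<n}"
      then show "A $$ (i, k) * B $$ (k, j) = 0"
        using assms(3,4) ij by (cases "k < i") auto
    qed
  }
qed

text \<open>\<open>Q\<close> and its inverse are both triangular, so the conjugation acts on the
  \<open>i\<close>-th diagonal entry as conjugation by \<open>Q $$ (i, i)\<close>. Matrices with a
  single diagonal entry show that this takes \<open>H i\<close> onto \<open>H' i\<close>.\<close>

lemma conjugate_if_similar_joint:
  assumes H: "\<And>i. i < n \<Longrightarrow> hyper (H i)" and H': "\<And>i. i < n \<Longrightarrow> hyper (H' i)" and deg: "degF \<ge> 2"
    and sim: "similar_sets n (joint n H) (joint n H')" and i: "i < n"
  shows "conjugate_sets (H i) (H' i)"
proof -
  obtain Q P where QP: "inv_pair n Q P" and J: "joint n H' = conj_set Q P (joint n H)"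
    using sim unfolding similar_sets_iff by blast
  have c: "Q \<in> carrier_mat n n" "P \<in> carrier_mat n n" "Q * P = 1\<^sub>m n" using QP unfolding inv_pair_def by auto
  have jc: "joint n H \<subseteq> carrier_mat n n" unfolding joint_def by auto
  have J': "joint n H = conj_set P Q (joint n H')" unfolding J using conj_cancel[OF QP jc] by simp
  have "Q $$ (i, a) = 0" if "a < i" "i < n" for a i
    by (rule conj_joint_upper_triangular[where H' = H', OF QP _ H deg that]) (auto simp: J conj_set_def)
  then have Qu: "\<forall>i<n. \<forall>j<i. Q $$ (i, j) = 0" by blast
  have "P $$ (i, a) = 0" if "a < i" "i < n" for a i
    by (rule conj_joint_upper_triangular[where H' = H, OF inv_pair_sym[OF QP] _ H' deg that]) (auto simp: J' conj_set_def)
  then have Pu: "\<forall>i<n. \<forall>j<i. P $$ (i, j) = 0" by blast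
  have one: "Q $$ (i, i) * P $$ (i, i) = 1"
    using upper_triangular_mult_diag(1)[OF c(1,2) Qu Pu i] c(3) i by simp
  define a where "a = Q $$ (i, i)"
  have a0: "a \<noteq> 0" using one a_def by auto
  have Pi: "P $$ (i, i) = inverse a" using one inverse_unique a_def by metis
  have diag: "(Q * M * P) $$ (i, i) = a * M $$ (i, i) * inverse a" if M: "M \<in> joint n H" for M
  proof -
    note Mj = joint_index[OF M]
    have Mu: "\<forall>i<n. \<forall>j<i. M $$ (i, j) = 0" using Mj(2) by blast
    note QM1 = upper_triangular_mult_diag(1)[OF c(1) Mj(1) Qu Mu i]
    have QM2: "\<forall>i<n. \<forall>j<i. (Q * M) $$ (i, j) = 0" using upper_triangular_mult_diag(2)[OF c(1) Mj(1) Qu Mu] by blast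
    show ?thesis
      using upper_triangular_mult_diag(1)[OF mult_carrier_mat[OF c(1) Mj(1)] c(2) QM2 Pu i] QM1 Pi
      unfolding a_def by simp
  qed
  have s: "single n n (i, i) x \<in> joint n G" if "x \<in> G i" "\<And>j. j < n \<Longrightarrow> hyper (G j)" for x and G
    using that hyper_zero by (intro jointI) auto
  have "H' i = (\<lambda>x. a * x * inverse a) ` H i"
  proof
    show "H' i \<subseteq> (\<lambda>x. a * x * inverse a) ` H i"
    proof
      fix y assume "y \<in> H' i"
      then have "single n n (i, i) y \<in> conj_set Q P (joint n H)" using s[of y H'] H' J by blast
      then obtain M where M: "M \<in> joint n H" "single n n (i, i) y = Q * M * P" unfolding conj_set_def by blast
      have "y = (single n n (i, i) y) $$ (i, i)" using i by simp
      also have "\<dots> = a * M $$ (i, i) * inverse a" unfolding M(2) by (rule diag[OF M(1)])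
      finally show "y \<in> (\<lambda>x. a * x * inverse a) ` H i" using joint_index(3)[OF M(1) i] by blast
    qed
    show "(\<lambda>x. a * x * inverse a) ` H i \<subseteq> H' i"
    proof
      fix y assume "y \<in> (\<lambda>x. a * x * inverse a) ` H i"
      then obtain x where x: "x \<in> H i" "y = a * x * inverse a" by blast
      have S: "single n n (i, i) x \<in> joint n H" using s[of x H] x(1) H by blast
      then have "Q * single n n (i, i) x * P \<in> joint n H'" unfolding J conj_set_def by blast
      then have "(Q * single n n (i, i) x * P) $$ (i, i) \<in> H' i" using joint_index(3) i by blast
      then show "y \<in> H' i" unfolding diag[OF S] x(2) using i by simp
    qed
  qed
  then show ?thesis unfolding conjugate_sets_def using a0 by blast
qed

end

theorem theorem1p17:
  fixes F :: "'a::division_ring set" and n :: nat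
  assumes "central_subfield F"
    and "finite_degree F"
    and "n \<ge> 1"
    and "infinite F \<or> card F \<ge> n * degree_over F"
    and "\<not> quadratic_type F"
  shows "(\<forall>S. optimal_trivial_spectrum F n S \<longleftrightarrow>
            (\<exists>H. (\<forall>i<n. linear_hyperplane F (H i) \<and> 1 \<notin> H i) \<and> similar_sets n (joint n H) S)) \<and>
         (\<forall>H H'. (\<forall>i<n. linear_hyperplane F (H i) \<and> 1 \<notin> H i) \<longrightarrow>
            (\<forall>i<n. linear_hyperplane F (H' i) \<and> 1 \<notin> H' i) \<longrightarrow>
            (similar_sets n (joint n H) (joint n H') \<longleftrightarrow>
             (\<forall>i<n. conjugate_sets (H i) (H' i))))"
proof -
  interpret central_division F using assms(1,2) by unfold_locales
  have deg: "degF \<ge> 2" using degree_at_least_three[OF assms(5)] by simp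
  show ?thesis
    unfolding hyper_iff[symmetric] optimal_iff[OF assms(5,4)]
    using similar_joint_if_conjugate conjugate_if_similar_joint[OF _ _ deg] by blast
qed

end
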